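(* Let $L$ be an extremal Type II lattice of rank $72$, i.e., an even unimodular lattice of rank $72$ whose minimum nonzero norm is $\min(L)=8$. Then $L$ is generated by its vectors of norm $\min(L)+2=10$; that is, $\mathcal{L}_{10}(L)=L$, where $\mathcal{L}_{10}(L)$ denotes the sublattice ($\mathbb{Z}$-submodule) of $L$ generated by $\Lambda_{10}(L)=\{x\in L:\langle x,x\rangle=10\}$.
   Context: A lattice of rank $n$ is a free $\mathbb{Z}$-module $L$ of rank $n$ equipped with a positive-definite inner product $\langle\cdot,\cdot\rangle\colon L\times L\to\mathbb{R}$. The norm of $x\in L$ is $\langle x,x\rangle$ (not its square root). A lattice is even if $\langle x,x\rangle\in 2\mathbb{Z}$ for all $x\in L$, and unimodular (self-dual) if $L=L^*$, where $L^*$ is the dual lattice. A Type II lattice is an even unimodular lattice. Its minimum nonzero norm is denoted $\min(L)$. For a Type II lattice of rank $n$ one has $\min(L)\le 2\lfloor n/24\rfloor+2$ (Mallows--Odlyzko--Sloane), and a Type II lattice attaining equality is called extremal; for $n=72$ this means $\min(L)=8$. For $j\ge 0$, $\Lambda_j(L)=\{x\in L:\langle x,x\rangle=j\}$ and $\mathcal{L}_j(L)$ is the sublattice of $L$ generated by $\Lambda_j(L)$. *)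

theory Defs
  imports "HOL-Analysis.Analysis"
begin

text \<open>\<^term>\<open>int_span S\<close> is the additive subgroup (\<open>\<int>\<close>-submodule) generated by \<open>S\<close>: the
  library's notion of span, taken for integer scalars.\<close>

global_interpretation int_module:
  module "\<lambda>(k::int) (x::'a::real_vector). of_int k *\<^sub>R x"
  defines int_span = int_module.span
  by unfold_locales (simp_all add: algebra_simps)

text \<open>An abstract lattice \<open>L\<close> is identified with its image in \<open>L \<otimes> \<real>\<close>, here a subspace of an
  arbitrary real inner product space. Positive definiteness on \<open>L \<otimes> \<real>\<close> means that a
  \<open>\<int>\<close>-basis stays linearly independent over \<open>\<real>\<close>; \<^const>\<open>independent\<close> is the real notion.\<close>

definition is_lattice :: "nat \<Rightarrow> 'a::real_inner set \<Rightarrow> bool" where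
  "is_lattice n L \<longleftrightarrow> (\<exists>B. finite B \<and> card B = n \<and> independent B \<and> L = int_span B)"

text \<open>\<^term>\<open>span L\<close> plays the role of \<open>L \<otimes> \<real>\<close>; the ambient space may be larger.\<close>

definition dual_lattice :: "'a::real_inner set \<Rightarrow> 'a set" where
  "dual_lattice L = {y \<in> span L. \<forall>x\<in>L. x \<bullet> y \<in> \<int>}"

definition even_lattice :: "'a::real_inner set \<Rightarrow> bool" where
  "even_lattice L \<longleftrightarrow> (\<forall>x\<in>L. \<exists>k::int. x \<bullet> x = 2 * of_int k)"

definition unimodular :: "'a::real_inner set \<Rightarrow> bool" where
  "unimodular L \<longleftrightarrow> dual_lattice L = L"

definition type_II_lattice :: "nat \<Rightarrow> 'a::real_inner set \<Rightarrow> bool" where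
  "type_II_lattice n L \<longleftrightarrow> is_lattice n L \<and> even_lattice L \<and> unimodular L"

text \<open>The infimum is attained for every lattice of positive rank, by discreteness.\<close>

definition min_norm :: "'a::real_inner set \<Rightarrow> real" where
  "min_norm L = Inf {x \<bullet> x |x. x \<in> L \<and> x \<noteq> 0}"

definition extremal_lattice :: "nat \<Rightarrow> 'a::real_inner set \<Rightarrow> bool" where
  "extremal_lattice n L \<longleftrightarrow>
     type_II_lattice n L \<and> min_norm L = 2 * of_int \<lfloor>real n / 24\<rfloor> + 2"

lemma extremal_lattice_72:
  "extremal_lattice 72 L \<longleftrightarrow> type_II_lattice 72 L \<and> min_norm L = 8"
  by (simp add: extremal_lattice_def)

definition shell :: "real \<Rightarrow> 'a::real_inner set \<Rightarrow> 'a set" where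
  "shell j L = {x \<in> L. x \<bullet> x = j}"

definition shell_lattice :: "real \<Rightarrow> 'a::real_inner set \<Rightarrow> 'a set" where
  "shell_lattice j L = int_span (shell j L)"

end

theory Submission
  imports Defs "HOL-Complex_Analysis.Complex_Analysis" "HOL-Probability.Characteristic_Functions"
begin

text \<open>
  For \<open>v, w \<in> span L\<close> of equal length, the difference of the Jacobi theta functions of \<open>L\<close> attached
  to \<open>v\<close> and \<open>w\<close> transforms like a Jacobi form, so its lowest nonzero Taylor coefficient in the elliptic
  variable, of order \<open>d\<close> say, is a modular form of weight \<open>36 + d\<close> that vanishes to order \<open>4\<close> at the
  cusp. Such a form is zero for \<open>d \<le> 11\<close>. Hence \<open>\<Sum> (x \<bullet> v) ^ d\<close> over a shell depends only on the length
  of \<open>v\<close>, that is, every shell is a spherical 11-design, and sums over a shell of even polynomials of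
  degree at most \<open>10\<close> in \<open>x \<bullet> v\<close> can be evaluated.

  Three such polynomials finish the proof. The one with roots \<open>0, \<plusminus>1, \<plusminus>2, \<plusminus>4, \<plusminus>8\<close>, for \<open>x\<close> and \<open>v\<close> of norm
  \<open>8\<close>, produces a vector of norm \<open>10\<close>. The one with roots \<open>0, \<plusminus>1, \<plusminus>2, \<plusminus>3, \<plusminus>5\<close>, for \<open>x\<close> of norm \<open>10\<close> and
  \<open>v\<close> of norm \<open>8\<close>, yields \<open>x \<bullet> v = \<plusminus>4\<close>, so that \<open>v\<close> is a difference of vectors of norm \<open>10\<close>. Finally
  let \<open>v\<close> be a shortest vector outside the sublattice generated by norm \<open>10\<close>; its norm is at least \<open>12\<close>, and
  minimality forces \<open>\<bar>x \<bullet> v\<bar> \<le> 4\<close> for all \<open>x\<close> of norm \<open>8\<close>. The polynomial with roots \<open>0, \<plusminus>1, \<dots>, \<plusminus>4\<close> then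
  sums to zero, but its design average is positive.
\<close>

section \<open>One-dimensional Poisson summation\<close>

text \<open>Comparing two vectors of equal length takes the place of harmonic coefficients: the
  factor that spoils invariance under inversion depends on the length alone, so it is common to both
  theta functions and factors out of their difference. Poisson summation for shifted Gaussians then
  suffices. It gives the inversion formula for purely imaginary arguments, which analytic
  continuation extends to the half plane. The bound 11 is where order 4 at the cusp stops forcing a
  form to vanish: weight 48 contains the fourth power of the discriminant. The role of the valence
  formula is taken by a maximum principle, and this is why numerical bounds on pi appear. In each of
  the three polynomials the roots are exactly the inner products left over after integrality, the
  minimum 8 and the assumption to be refuted have excluded all others. The root 0 is double, so the
  degree is 10 each time and stays within the design strength.\<close>

text \<open>Since \<open>m\<close> ranges over all integers, the sign in the exponent is immaterial.
  The conditions are bundled because together they are stable under multiplication by polynomials in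
  \<open>cis\<close>.\<close>

definition fourier_null :: "(real \<Rightarrow> complex) \<Rightarrow> bool" where
  "fourier_null D \<longleftrightarrow> continuous_on UNIV D \<and> (\<forall>a. D (a + 1) = D a) \<and>
     (\<forall>m::int. integral {0..1} (\<lambda>a. D a * cis (2 * pi * m * a)) = 0)"

lemma cis_2pi_int_mult [simp]: "cis (2 * pi * of_int n) = 1"
  by (metis cis_multiple_2pi mult.commute Ints_of_int)

lemma fourier_null_add:
  assumes "fourier_null D" "fourier_null E"
  shows "fourier_null (\<lambda>a. D a + E a)"
proof -
  have "(\<lambda>a. D a * cis (2 * pi * of_int m * a)) integrable_on {0..1}"
       "(\<lambda>a. E a * cis (2 * pi * of_int m * a)) integrable_on {0..1}" for m :: int
    using assms unfolding fourier_null_def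
    by (auto intro!: integrable_continuous_real continuous_intros
        intro: continuous_on_subset)
  with assms show ?thesis
    unfolding fourier_null_def
    by (auto simp: distrib_right Henstock_Kurzweil_Integration.integral_add intro!: continuous_intros)
qed

lemma fourier_null_cmult:
  assumes "fourier_null D"
  shows "fourier_null (\<lambda>a. D a * c)"
proof -
  have "integral {0..1} (\<lambda>a. D a * c * cis (2 * pi * of_int m * a)) =
        integral {0..1} (\<lambda>a. D a * cis (2 * pi * of_int m * a)) * c" for m :: int
    by (subst Henstock_Kurzweil_Integration.integral_mult_left [symmetric]) (simp add: mult_ac)
  with assms show ?thesis
    unfolding fourier_null_def by (auto intro!: continuous_intros)
qed

lemma fourier_null_cis:
  assumes "fourier_null D"
  shows "fourier_null (\<lambda>a. D a * cis (2 * pi * of_int k * a))"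
proof -
  have shift: "D a * cis (2 * pi * of_int k * a) * cis (2 * pi * of_int m * a) =
        D a * cis (2 * pi * of_int (k + m) * a)" for m :: int and a
    by (simp add: mult.assoc cis_mult) (simp add: algebra_simps)
  have "cis (2 * pi * of_int k * (a + 1)) = cis (2 * pi * of_int k * a)" for a
    by (simp add: distrib_left flip: cis_mult)
  with assms show ?thesis
    unfolding fourier_null_def shift by (auto intro!: continuous_intros simp del: of_int_add)
qed

text \<open>Real and imaginary part of \<open>cis (2 * pi * a)\<close> combine the characters of
  exponents 1 and -1, and multiplying by a character only shifts Fourier coefficients.
  \<open>D\<close> is generalised so that a product is absorbed one factor at a time.\<close>

lemma fourier_null_polynomial:
  assumes "real_polynomial_function p" "fourier_null D"
  shows "fourier_null (\<lambda>a. D a * of_real (p (cis (2 * pi * a))))"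
  using assms
proof (induction arbitrary: D rule: real_polynomial_function.induct)
  case (linear f)
  interpret bounded_linear f by fact
  have *: "f z = Re z * f 1 + Im z * f \<i>" for z
  proof -
    have "f z = f (Re z *\<^sub>R 1 + Im z *\<^sub>R \<i>)" by (intro arg_cong[where f = f]) (simp add: complex_eq_iff)
    then show ?thesis by (simp only: add scaleR) simp
  qed
  have eq: "(\<lambda>a. D a * of_real (f (cis (2 * pi * a)))) =
    (\<lambda>a. D a * cis (2 * pi * of_int 1 * a) * ((f 1 - \<i> * f \<i>) / 2) +
         D a * cis (2 * pi * of_int (-1) * a) * ((f 1 + \<i> * f \<i>) / 2))"
    by (rule ext) (simp add: *[of "cis _"] complex_eq_iff field_simps)
  show ?case unfolding eq
    by (intro fourier_null_add fourier_null_cmult fourier_null_cis linear.prems)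
next
  case (const c)
  then show ?case by (intro fourier_null_cmult)
next
  case (add f g)
  have "(\<lambda>a. D a * of_real (f (cis (2 * pi * a)) + g (cis (2 * pi * a)))) =
    (\<lambda>a. D a * of_real (f (cis (2 * pi * a))) + D a * of_real (g (cis (2 * pi * a))))"
    by (simp add: algebra_simps)
  with add fourier_null_add show ?case by (simp del: of_real_add)
next
  case (mult f g)
  from mult.IH(2)[OF mult.IH(1)[OF mult.prems]]
  show ?case by (simp add: mult.assoc)
qed

text \<open>For every polynomial g on the circle, D g integrates to zero, so the integral of |D|^2
  equals that of D (cnj D - g). Stone-Weierstrass makes the second factor arbitrarily small; hence
  \<open>D\<close> vanishes in mean square and, being continuous, everywhere.\<close>

lemma fourier_null_imp_zero:
  assumes "fourier_null D"
  shows "D a = 0"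
proof -
  have contD: "continuous_on UNIV D" and per: "D (x + 1) = D x" for x
    using assms by (auto simp: fourier_null_def)
  have perint: "D (x + of_int n) = D x" for x n
  proof (induction n arbitrary: x rule: int_induct[where k = 0])
    case (step1 i) then show ?case using per[of "x + of_int i"] by (simp add: add_ac)
  next
    case (step2 i) then show ?case using per[of "x + of_int (i - 1)"] by simp
  qed auto
  \<comment> \<open>\<open>Arg\<close> jumps, but the periodicity of \<open>D\<close> hides the
    jump: \<open>h\<close> is \<open>D\<close> transported to the unit circle.\<close>
  define h where "h w = D (Arg w / (2 * pi))" for w
  have h_cis: "h (cis (2 * pi * x)) = D x" for x
  proof -
    obtain n :: int where "Arg (cis (2 * pi * x)) = 2 * pi * x + 2 * pi * of_int n"
      using cis_Arg[OF cis_neq_zero, of "2 * pi * x"] sin_cos_eq_iff[of "Arg (cis (2 * pi * x))" "2 * pi * x"]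
      by (auto simp: complex_eq_iff sgn_div_norm)
    then have "Arg (cis (2 * pi * x)) / (2 * pi) = x + of_int n" by (simp add: field_simps)
    then show ?thesis by (simp add: h_def perint)
  qed
  have sph: "\<exists>x\<in>{0..1}. w = cis (2 * pi * x)" if "norm w = 1" for w
  proof -
    have "w = cis (2 * pi * (Arg2pi w / (2 * pi)))"
      using that Arg2pi_eq[of w] by (simp add: cis_conv_exp)
    moreover have "Arg2pi w / (2 * pi) \<in> {0..1}"
      using Arg2pi_lt_2pi[of w] Arg2pi_ge_0[of w] by simp
    ultimately show ?thesis by blast
  qed
  \<comment> \<open>Across the branch cut continuity comes from compactness: the preimage of a
    closed set under \<open>h\<close> is the image under \<open>cis\<close> of a compact subset of
    the interval.\<close>
  have conth: "continuous_on (sphere 0 1) h"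
    unfolding continuous_on_closed_invariant
  proof (intro allI impI)
    fix B :: "complex set" assume "closed B"
    have "closed ({0..1} \<inter> D -` B)"
      using \<open>closed B\<close> contD
      by (intro closed_Int closed_atLeastAtMost) (simp add: closed_vimage)
    then have "compact ({0..1} \<inter> D -` B)"
      by (meson compact_Icc closed_Int_compact compact_Int_closed inf.idem bounded_Int bounded_closed_interval compact_eq_bounded_closed)
    then have cl: "closed ((\<lambda>x. cis (2 * pi * x)) ` ({0..1} \<inter> D -` B))"
      by (intro compact_imp_closed compact_continuous_image continuous_intros)
    have "(\<lambda>x. cis (2 * pi * x)) ` ({0..1} \<inter> D -` B) \<inter> sphere 0 1 = h -` B \<inter> sphere 0 1"
      using sph by (auto simp: h_cis image_iff) (metis h_cis IntI vimageI)
    with cl show "\<exists>A. closed A \<and> A \<inter> sphere 0 1 = h -` B \<inter> sphere 0 1" by blast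
  qed
  define I where "I = integral {0..1} (\<lambda>x. (norm (D x))\<^sup>2)"
  obtain K where K: "\<And>x. x \<in> {0..1} \<Longrightarrow> norm (D x) \<le> K" "K > 0"
  proof -
    have "compact (D ` {0..1})"
      by (intro compact_continuous_image continuous_on_subset[OF contD]) auto
    then obtain b where "b > 0" "\<forall>y\<in>D ` {0..1}. norm y \<le> b"
      using bounded_pos[of "D ` {0..1}"] compact_imp_bounded by blast
    then show ?thesis by (intro that[of b]) auto
  qed
  have I_le: "I \<le> e * K" if "e > 0" for e
  proof -
    obtain g where g: "polynomial_function g" "\<And>w. norm w = 1 \<Longrightarrow> norm (cnj (h w) - g w) < e"
      using Stone_Weierstrass_polynomial_function[of "sphere 0 1" "\<lambda>w. cnj (h w)" e] \<open>e > 0\<close> conth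
      by (auto intro!: continuous_intros)
    have contg: "continuous_on S g" for S
      using g(1) continuous_on_polymonial_function by blast
    have "real_polynomial_function (Re \<circ> g)" "real_polynomial_function (Im \<circ> g)"
      using g(1) bounded_linear_Re bounded_linear_Im by (auto simp: polynomial_function_def)
    then have "fourier_null (\<lambda>x. D x * of_real ((Re \<circ> g) (cis (2 * pi * x))) +
          (D x * of_real ((Im \<circ> g) (cis (2 * pi * x)))) * \<i>)"
      by (intro fourier_null_add fourier_null_polynomial fourier_null_cmult assms)
    moreover have "D x * of_real ((Re \<circ> g) (cis (2 * pi * x))) +
          (D x * of_real ((Im \<circ> g) (cis (2 * pi * x)))) * \<i> = D x * g (cis (2 * pi * x))" for x
      by (simp add: complex_eq_iff algebra_simps)
    ultimately have "fourier_null (\<lambda>x. D x * g (cis (2 * pi * x)))" by simp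
    then have 0: "integral {0..1} (\<lambda>x. D x * g (cis (2 * pi * x))) = 0"
      unfolding fourier_null_def by (auto dest: spec[of _ 0])
    have "of_real I = integral {0..1} (\<lambda>x. complex_of_real ((norm (D x))\<^sup>2))"
      unfolding I_def
      by (intro integral_unique[symmetric] has_integral_of_real integrable_integral)
         (auto intro!: integrable_continuous_real continuous_intros continuous_on_subset[OF contD])
    also have "\<dots> = integral {0..1} (\<lambda>x. D x * cnj (D x))"
      by (simp only: complex_norm_square)
    also have "\<dots> = integral {0..1} (\<lambda>x. D x * cnj (D x) - D x * g (cis (2 * pi * x)))"
      by (subst Henstock_Kurzweil_Integration.integral_diff)
         (auto intro!: integrable_continuous_real continuous_intros continuous_on_subset[OF contD]
            continuous_on_compose2[OF contg[of UNIV]] simp: 0)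
    also have "norm \<dots> \<le> (e * K) * (1 - 0)"
    proof (rule integral_bound)
      show "continuous_on {0..1} (\<lambda>x. D x * cnj (D x) - D x * g (cis (2 * pi * x)))"
        by (auto intro!: continuous_intros continuous_on_subset[OF contD]
            continuous_on_compose2[OF contg[of UNIV]])
      fix x :: real assume x: "x \<in> {0..1}"
      have "norm (D x * cnj (D x) - D x * g (cis (2 * pi * x))) =
        norm (D x) * norm (cnj (h (cis (2 * pi * x))) - g (cis (2 * pi * x)))"
        by (simp add: h_cis norm_mult flip: right_diff_distrib)
      also have "\<dots> \<le> K * e"
        using K(1)[OF x] g(2)[of "cis (2 * pi * x)"] K(2) by (intro mult_mono) auto
      finally show "norm (D x * cnj (D x) - D x * g (cis (2 * pi * x))) \<le> e * K" by (simp add: mult.commute)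
    qed simp
    finally show ?thesis by simp
  qed
  have "I \<le> 0"
  proof (rule field_le_epsilon)
    fix e :: real assume "e > 0"
    then show "I \<le> 0 + e" using I_le[of "e / K"] K(2) by simp
  qed
  moreover have "I \<ge> 0" unfolding I_def by (intro integral_nonneg)
      (auto intro!: integrable_continuous_real continuous_intros continuous_on_subset[OF contD])
  ultimately have I0: "((\<lambda>x. (norm (D x))\<^sup>2) has_integral 0) (cbox 0 1)"
    unfolding I_def 
    by (auto simp: has_integral_iff intro!: integrable_continuous_real continuous_intros continuous_on_subset[OF contD])
  have zero01: "D x = 0" if "x \<in> {0..1}" for x
  proof -
    have "(norm (D x))\<^sup>2 = 0"
    proof (rule has_integral_0_cbox_imp_0[OF _ _ I0])
      show "continuous_on (cbox 0 1) (\<lambda>x. (norm (D x))\<^sup>2)"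
        by (intro continuous_intros continuous_on_subset[OF contD]) auto
    qed (use that in auto)
    then show ?thesis by simp
  qed
  have "D a = D (frac a)" using perint[of a "- \<lfloor>a\<rfloor>"] by (simp add: frac_def)
  then show ?thesis using zero01[of "frac a"] frac_lt_1[of a] by (simp add: less_imp_le)
qed

section \<open>Gaussian integrals, periodisation and the Poisson formula on the line\<close>

text \<open>The frequency \<open>\<kappa>\<close> serves the passage to lattices: adding a basis
  vector leads to modulated Gaussian sums whose frequency is the inner product of a dual vector with
  the projection of the new vector.\<close>

definition gauss :: "real \<Rightarrow> real \<Rightarrow> real \<Rightarrow> complex" where
  "gauss \<alpha> \<kappa> x = of_real (exp (- pi * \<alpha> * x\<^sup>2)) * cis (2 * pi * \<kappa> * x)"

lemma norm_gauss [simp]: "norm (gauss \<alpha> \<kappa> x) = exp (- pi * \<alpha> * x\<^sup>2)"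
  by (simp add: gauss_def norm_mult)

lemma continuous_on_gauss [continuous_intros]:
  "continuous_on S f \<Longrightarrow> continuous_on S (\<lambda>x. gauss \<alpha> \<kappa> (f x))"
  unfolding gauss_def by (intro continuous_intros)

lemma summable_on_exp_neg_square:
  fixes \<beta> :: real
  assumes "\<beta> > 0"
  shows "(\<lambda>n::int. exp (- \<beta> * (of_int n)\<^sup>2)) summable_on UNIV"
proof -
  have nat: "(\<lambda>n::nat. exp (- \<beta> * (of_nat n)\<^sup>2)) summable_on UNIV"
  proof (rule summable_on_comparison_test)
    have "summable (\<lambda>n. (exp (- \<beta>)) ^ n)" using assms by (intro summable_geometric) simp
    then show "(\<lambda>n. (exp (- \<beta>)) ^ n) summable_on UNIV"
      by (subst summable_on_UNIV_nonneg_real_iff) auto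
    fix n :: nat
    have "real n \<le> (real n)\<^sup>2" by (cases n) (simp_all add: power2_eq_square)
    then show "exp (- \<beta> * (real n)\<^sup>2) \<le> exp (- \<beta>) ^ n"
      using assms by (simp add: mult.commute flip: exp_of_nat_mult)
  qed auto
  have "(\<lambda>n::int. exp (- \<beta> * (of_int n)\<^sup>2)) summable_on (range int \<union> range (\<lambda>n. - int n))"
  proof (rule summable_on_union)
    show "(\<lambda>n::int. exp (- \<beta> * (of_int n)\<^sup>2)) summable_on range int"
      by (subst summable_on_reindex) (use nat in \<open>auto simp: o_def\<close>)
    show "(\<lambda>n::int. exp (- \<beta> * (of_int n)\<^sup>2)) summable_on range (\<lambda>n. - int n)"
      by (subst summable_on_reindex) (use nat in \<open>auto simp: o_def inj_on_def\<close>)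
  qed
  moreover have "range int \<union> range (\<lambda>n. - int n) = UNIV"
    by (auto simp: image_iff) (metis int_cases2)
  ultimately show ?thesis by simp
qed

text \<open>The exponents differ by a nonnegative multiple of (n + 2 a)^2. Separating
  \<open>n\<close> from \<open>a\<close> gives majorants that are uniform for bounded
  \<open>a\<close>.\<close>

lemma exp_neg_square_shift_le:
  assumes "\<alpha> > 0"
  shows "exp (- pi * \<alpha> * (n + a)\<^sup>2) \<le> exp (pi * \<alpha> * a\<^sup>2) * exp (- (pi * \<alpha> / 2) * n\<^sup>2)"
proof -
  have "0 \<le> pi * \<alpha> / 2 * (n + 2 * a)\<^sup>2" using assms by simp
  then show ?thesis by (simp add: power2_eq_square algebra_simps flip: exp_add)
qed

lemma summable_on_exp_neg_square_shift:
  assumes "\<alpha> > 0"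
  shows "(\<lambda>n::int. exp (- pi * \<alpha> * (of_int n + a)\<^sup>2)) summable_on UNIV"
proof (rule summable_on_comparison_test)
  show "(\<lambda>n::int. exp (pi * \<alpha> * a\<^sup>2) * exp (- (pi * \<alpha> / 2) * (of_int n)\<^sup>2)) summable_on UNIV"
    using assms by (intro summable_on_cmult_right summable_on_exp_neg_square) auto
qed (use exp_neg_square_shift_le[OF assms] in auto)

text \<open>Rescaling by \<open>c\<close> turns the integral into the characteristic function of the
  standard normal distribution.\<close>

lemma gauss_integral:
  assumes "\<alpha> > 0"
  shows "integrable lborel (gauss \<alpha> \<kappa>)"
    and "integral\<^sup>L lborel (gauss \<alpha> \<kappa>) = of_real (exp (- pi * \<kappa>\<^sup>2 / \<alpha>) / sqrt \<alpha>)"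
proof -
  define c where "c = sqrt (2 * pi * \<alpha>)"
  have c: "c > 0" "c\<^sup>2 = 2 * pi * \<alpha>" using assms by (auto simp: c_def)
  have eq: "std_normal_density (c * x) *\<^sub>R iexp (2 * pi * \<kappa> / c * (c * x)) =
      of_real (1 / sqrt (2 * pi)) * gauss \<alpha> \<kappa> x" for x
    using c by (simp add: std_normal_density_def gauss_def cis_conv_exp power_mult_distrib scaleR_conv_of_real mult.assoc)
  have int: "integrable lborel (\<lambda>x. std_normal_density x *\<^sub>R iexp (t * x))" for t
  proof (rule Bochner_Integration.integrable_bound)
    show "integrable lborel std_normal_density" using integrable_std_normal_moment[of 0] by simp
  qed (auto simp: norm_mult)
  have "integrable lborel (\<lambda>x. std_normal_density (0 + c * x) *\<^sub>R iexp (2 * pi * \<kappa> / c * (0 + c * x)))"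
    using lborel_integrable_real_affine[OF int, of c 0 "2 * pi * \<kappa> / c"] c by simp
  then have "integrable lborel (\<lambda>x. of_real (1 / sqrt (2 * pi)) * gauss \<alpha> \<kappa> x)"
    by (simp only: add_0 eq)
  then have "integrable lborel (\<lambda>x. of_real (sqrt (2 * pi)) * (of_real (1 / sqrt (2 * pi)) * gauss \<alpha> \<kappa> x))"
    by (rule integrable_mult_right)
  then show "integrable lborel (gauss \<alpha> \<kappa>)" by (simp flip: mult.assoc of_real_mult)
  have "of_real (exp (- ((2 * pi * \<kappa> / c)\<^sup>2) / 2)) = char std_normal_distribution (2 * pi * \<kappa> / c)"
    by (simp add: char_std_normal_distribution)
  also have "\<dots> = (CLINT x|lborel. std_normal_density x *\<^sub>R iexp (2 * pi * \<kappa> / c * x))"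
    unfolding char_def by (subst integral_density) auto
  also have "\<dots> = c *\<^sub>R (CLINT x|lborel. std_normal_density (0 + c * x) *\<^sub>R iexp (2 * pi * \<kappa> / c * (0 + c * x)))"
    using c by (subst lborel_integral_real_affine[of c _ 0]) auto
  also have "\<dots> = of_real (c / sqrt (2 * pi)) * integral\<^sup>L lborel (gauss \<alpha> \<kappa>)"
    by (simp only: add_0 eq integral_mult_right_zero) (simp add: scaleR_conv_of_real)
  also have "c / sqrt (2 * pi) = sqrt \<alpha>" by (simp add: c_def real_sqrt_mult)
  also have "(2 * pi * \<kappa> / c)\<^sup>2 = 2 * pi * \<kappa>\<^sup>2 / \<alpha>"
    using assms by (simp add: power_divide c(2) power_mult_distrib) (simp add: power2_eq_square)
  finally show "integral\<^sup>L lborel (gauss \<alpha> \<kappa>) = of_real (exp (- pi * \<kappa>\<^sup>2 / \<alpha>) / sqrt \<alpha>)"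
    using assms by (simp add: field_simps)
qed

lemma continuous_on_UNIV_bounded_intervals:
  fixes f :: "real \<Rightarrow> complex"
  assumes "\<And>r. continuous_on {-r<..<r} f"
  shows "continuous_on UNIV f"
proof -
  have "isCont f x" for x
  proof -
    have "x \<in> {- (\<bar>x\<bar> + 1)<..<\<bar>x\<bar> + 1}" by auto
    then show ?thesis using assms[of "\<bar>x\<bar> + 1"] continuous_on_eq_continuous_at open_greaterThanLessThan by blast
  qed
  then show ?thesis by (simp add: continuous_at_imp_continuous_on)
qed

lemma continuous_on_infsum_bound:
  fixes f :: "'i \<Rightarrow> real \<Rightarrow> complex"
  assumes "\<And>i x r. \<bar>x\<bar> < r \<Longrightarrow> norm (f i x) \<le> M r i" "\<And>r. M r summable_on UNIV"
    "\<And>i. continuous_on UNIV (f i)"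
  shows "continuous_on UNIV (\<lambda>x. \<Sum>\<^sub>\<infinity>i. f i x)"
proof (rule continuous_on_UNIV_bounded_intervals)
  fix r :: real
  have "uniform_limit {-r<..<r} (\<lambda>X x. \<Sum>i\<in>X. f i x) (\<lambda>x. \<Sum>\<^sub>\<infinity>i. f i x) (finite_subsets_at_top UNIV)"
    using assms(1,2) by (intro Weierstrass_m_test_general[where M = "M r"]) auto
  then show "continuous_on {-r<..<r} (\<lambda>x. \<Sum>\<^sub>\<infinity>i. f i x)"
    by (rule uniform_limit_theorem[rotated])
       (auto intro!: always_eventually continuous_intros continuous_on_subset[OF assms(3)])
qed

lemma continuous_on_gauss_sum:
  assumes "\<alpha> > 0"
  shows "continuous_on UNIV (\<lambda>a. \<Sum>\<^sub>\<infinity>n::int. gauss \<alpha> \<theta> (of_int n + a))"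
proof (rule continuous_on_infsum_bound)
  fix n :: int and a r :: real assume "\<bar>a\<bar> < r"
  then have "a\<^sup>2 \<le> r\<^sup>2" using abs_le_square_iff by fastforce
  then show "norm (gauss \<alpha> \<theta> (of_int n + a)) \<le> exp (pi * \<alpha> * r\<^sup>2) * exp (- (pi * \<alpha> / 2) * (of_int n)\<^sup>2)"
    using exp_neg_square_shift_le[OF assms, of "of_int n" a] assms
    by (auto elim!: order_trans)
next
  fix r
  show "(\<lambda>n::int. exp (pi * \<alpha> * r\<^sup>2) * exp (- (pi * \<alpha> / 2) * (of_int n)\<^sup>2)) summable_on UNIV"
    using assms by (intro summable_on_cmult_right summable_on_exp_neg_square) auto
qed (intro continuous_intros)

text \<open>Unfolding: integrating the sum of all unit translates over one period is integrating
  over the whole line.\<close>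

lemma integral_gauss_sum:
  assumes "\<alpha> > 0"
  shows "integral {0..1} (\<lambda>a. \<Sum>\<^sub>\<infinity>n::int. gauss \<alpha> \<theta> (of_int n + a)) =
         of_real (exp (- pi * \<theta>\<^sup>2 / \<alpha>) / sqrt \<alpha>)"
proof -
  define h where "h = gauss \<alpha> \<theta>"
  \<comment> \<open>Enumerating the integers turns the sum into a series, the form in which it is
    exchanged with the Lebesgue integral.\<close>
  define N :: "nat \<Rightarrow> real" where "N i = of_int (int_decode i)" for i
  define M where "M i = exp (pi * \<alpha>) * exp (- (pi * \<alpha> / 2) * (N i)\<^sup>2)" for i
  have sumM: "summable M"
  proof -
    have "(\<lambda>n::int. exp (pi * \<alpha>) * exp (- (pi * \<alpha> / 2) * (of_int n)\<^sup>2)) summable_on UNIV"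
      using assms by (intro summable_on_cmult_right summable_on_exp_neg_square) auto
    then have "M summable_on UNIV"
      unfolding M_def N_def
      by (subst (asm) summable_on_reindex_bij_betw[OF bij_int_decode, symmetric])
    then show ?thesis by (rule summable_on_imp_summable)
  qed
  have bound: "norm (h (N i + a)) \<le> M i" if "0 \<le> a" "a \<le> 1" for i a
  proof -
    have "a\<^sup>2 \<le> 1" using that by (simp add: power_le_one_iff)
    then show ?thesis
      using exp_neg_square_shift_le[OF assms, of "N i" a] assms
      by (auto simp: h_def M_def elim!: order_trans)
  qed
  have meas [measurable]: "h \<in> borel_measurable borel"
    unfolding h_def by (intro borel_measurable_continuous_onI continuous_intros)
  have "(\<Sum>\<^sub>\<infinity>n::int. h (of_int n + a)) = (\<Sum>i. h (N i + a))" for a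
  proof -
    have "(\<lambda>n::int. norm (h (of_int n + a))) summable_on UNIV"
      using summable_on_exp_neg_square_shift[OF assms] by (simp add: h_def)
    then have "(\<lambda>n::int. h (of_int n + a)) summable_on UNIV" by (rule abs_summable_summable)
    then have "((\<lambda>n::int. h (of_int n + a)) has_sum (\<Sum>\<^sub>\<infinity>n::int. h (of_int n + a))) UNIV" by simp
    then have "((\<lambda>i. h (N i + a)) has_sum (\<Sum>\<^sub>\<infinity>n::int. h (of_int n + a))) UNIV"
      unfolding N_def by (subst (asm) has_sum_reindex_bij_betw[OF bij_int_decode, symmetric])
    then show ?thesis using has_sum_imp_sums sums_unique by blast
  qed
  note series = this
  \<comment> \<open>Half-open intervals make the translates disjoint; the missing endpoint is a null
    set and is restored at the end.\<close>
  have "(LINT a:{0..<1}|lborel. (\<Sum>i. h (N i + a))) = (LINT a|lborel. (\<Sum>i. indicator {0..<1} a *\<^sub>R h (N i + a)))"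
    unfolding set_lebesgue_integral_def
  proof (rule Bochner_Integration.integral_cong)
    fix a :: real
    show "indicator {0..<1} a *\<^sub>R (\<Sum>i. h (N i + a)) = (\<Sum>i. indicator {0..<1} a *\<^sub>R h (N i + a))"
      by (auto simp: indicator_def)
  qed simp
  also have "\<dots> = (\<Sum>i. LINT a|lborel. indicator {0..<1} a *\<^sub>R h (N i + a))"
  proof (rule integral_suminf)
    have le: "norm (indicator {0..<1::real} a *\<^sub>R h (N i + a)) \<le> indicator {0..<1} a * M i" for i a
      using bound[of a i] by (auto simp: indicator_def)
    have intM: "integrable lborel (\<lambda>a. indicator {0..<1::real} a * M i)" for i
      by (intro integrable_mult_left integrable_real_indicator) auto
    show int: "integrable lborel (\<lambda>a. indicator {0..<1::real} a *\<^sub>R h (N i + a))" for i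
      by (rule Bochner_Integration.integrable_bound[OF intM[of i]]) (use le[of _ i] in \<open>auto simp: M_def\<close>)
    show "AE a in lborel. summable (\<lambda>i. norm (indicator {0..<1::real} a *\<^sub>R h (N i + a)))"
    proof (intro always_eventually allI summable_comparison_test'[OF sumM])
      fix a :: real and i
      show "norm (norm (indicator {0..<1::real} a *\<^sub>R h (N i + a))) \<le> M i"
        using le[of a i] by (auto simp: indicator_def M_def split: if_splits)
    qed
    show "summable (\<lambda>i. LINT a|lborel. norm (indicator {0..<1::real} a *\<^sub>R h (N i + a)))"
    proof (intro summable_comparison_test'[OF sumM])
      fix i
      have "(LINT a|lborel. norm (indicator {0..<1::real} a *\<^sub>R h (N i + a))) \<le> (LINT a|lborel. indicator {0..<1::real} a * M i)"
        by (intro integral_mono integrable_norm int intM le)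
      also have "\<dots> = M i" by simp
      finally show "norm (LINT a|lborel. norm (indicator {0..<1::real} a *\<^sub>R h (N i + a))) \<le> M i"
        by simp
    qed
  qed
  also have "(\<lambda>i. LINT a|lborel. indicator {0..<1} a *\<^sub>R h (N i + a)) = (\<lambda>i. LINT a:{N i..<N i + 1}|lborel. h a)"
  proof
    fix i
    have "(LINT a:{N i..<N i + 1}|lborel. h a) = (LINT a|lborel. indicator {N i..<N i + 1} (N i + 1 * a) *\<^sub>R h (N i + 1 * a))"
      unfolding set_lebesgue_integral_def by (subst lborel_integral_real_affine[of 1 _ "N i"]) simp_all
    also have "\<dots> = (LINT a|lborel. indicator {0..<1} a *\<^sub>R h (N i + a))"
      by (intro Bochner_Integration.integral_cong) (auto simp: indicator_def)
    finally show "(LINT a|lborel. indicator {0..<1} a *\<^sub>R h (N i + a)) = (LINT a:{N i..<N i + 1}|lborel. h a)" by simp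
  qed
  also have "(\<Sum>i. LINT a:{N i..<N i + 1}|lborel. h a) = (LINT a:(\<Union>i. {N i..<N i + 1})|lborel. h a)"
  proof (rule lebesgue_integral_countable_add[symmetric])
    fix i j :: nat assume "i \<noteq> j"
    then have "int_decode i \<noteq> int_decode j" by (simp add: int_decode_eq)
    then have "N i + 1 \<le> N j \<or> N j + 1 \<le> N i" unfolding N_def by linarith
    then show "{N i..<N i + 1} \<inter> {N j..<N j + 1} = {}" by auto
  next
    have "set_integrable lborel UNIV h"
      unfolding set_integrable_def h_def using gauss_integral(1)[OF assms] by simp
    then show "set_integrable lborel (\<Union>i. {N i..<N i + 1}) h"
      by (rule set_integrable_subset) auto
  qed simp
  also have "(\<Union>i. {N i..<N i + 1}) = UNIV"
  proof -
    have "x \<in> {N (int_encode \<lfloor>x\<rfloor>)..<N (int_encode \<lfloor>x\<rfloor>) + 1}" for x by (simp add: N_def)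
    then show ?thesis by blast
  qed
  also have "(LINT a:UNIV|lborel. h a) = of_real (exp (- pi * \<theta>\<^sup>2 / \<alpha>) / sqrt \<alpha>)"
    unfolding set_lebesgue_integral_def h_def using gauss_integral(2)[OF assms] by simp
  finally have eq: "(LINT a:{0..<1}|lborel. (\<Sum>\<^sub>\<infinity>n::int. h (of_int n + a))) = \<dots>"
    by (simp only: series)
  have cont: "continuous_on {0..1} (\<lambda>a. \<Sum>\<^sub>\<infinity>n::int. h (of_int n + a))"
    using continuous_on_gauss_sum[OF assms, of \<theta>] continuous_on_subset unfolding h_def by blast
  have "integral {0..1} (\<lambda>a. \<Sum>\<^sub>\<infinity>n::int. h (of_int n + a)) = (LINT a:{0..1}|lborel. (\<Sum>\<^sub>\<infinity>n::int. h (of_int n + a)))"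
    by (rule set_borel_integral_eq_integral(2)[symmetric], unfold set_integrable_def, rule borel_integrable_compact[OF _ cont]) simp
  also have "\<dots> = (LINT a:{0..<1}|lborel. (\<Sum>\<^sub>\<infinity>n::int. h (of_int n + a)))"
    unfolding set_lebesgue_integral_def
  proof (rule integral_discrete_difference[where X = "{1}"])
  qed (auto simp: indicator_def)
  finally show ?thesis using eq unfolding h_def by simp
qed

lemma integral_cis_2pi:
  "((\<lambda>a. cis (2 * pi * of_int k * a)) has_integral (if k = 0 then 1 else 0)) {0..1}"
proof (cases "k = 0")
  case True
  then show ?thesis using has_integral_const_real[of "1::complex" 0 1] by simp
next
  case False
  define c where "c = 2 * pi * of_int k * \<i>"
  have c: "c \<noteq> 0" using False by (simp add: c_def)
  have "((\<lambda>a. exp (c * of_real a)) has_integral (exp (c * of_real 1) / c - exp (c * of_real 0) / c)) {0..1}"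
  proof (rule fundamental_theorem_of_calculus)
    fix x :: real
    have "((\<lambda>z. exp (c * z) / c) has_field_derivative exp (c * of_real x)) (at (of_real x))"
      using c by (auto intro!: derivative_eq_intros)
    then show "((\<lambda>x. exp (c * of_real x) / c) has_vector_derivative exp (c * of_real x)) (at x within {0..1})"
      by (rule has_vector_derivative_real_field)
  qed simp
  moreover have "exp c = 1"
    using cis_2pi_int_mult[of k] by (simp add: c_def cis_conv_exp mult_ac)
  moreover have "exp (c * of_real a) = cis (2 * pi * of_int k * a)" for a
    by (simp add: cis_conv_exp c_def mult_ac)
  ultimately show ?thesis using False by simp
qed

text \<open>Both sides are continuous, 1-periodic and have the same Fourier coefficients.\<close>

theorem poisson_gauss:
  assumes "\<alpha> > 0"
  shows "(\<Sum>\<^sub>\<infinity>n::int. gauss \<alpha> \<theta> (of_int n + a)) =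
         (\<Sum>\<^sub>\<infinity>m::int. of_real (exp (- pi * (of_int m - \<theta>)\<^sup>2 / \<alpha>) / sqrt \<alpha>) * cis (2 * pi * of_int m * a))"
proof -
  define S where "S a = (\<Sum>\<^sub>\<infinity>n::int. gauss \<alpha> \<theta> (of_int n + a))" for a
  define c where "c m = exp (- pi * (of_int m - \<theta>)\<^sup>2 / \<alpha>) / sqrt \<alpha>" for m :: int
  define T where "T a = (\<Sum>\<^sub>\<infinity>m::int. of_real (c m) * cis (2 * pi * of_int m * a))" for a
  have sumc: "c summable_on UNIV"
  proof -
    have "(\<lambda>m::int. exp (- pi * (1 / \<alpha>) * (of_int m + (- \<theta>))\<^sup>2) * (1 / sqrt \<alpha>)) summable_on UNIV"
      using assms by (intro summable_on_cmult_left summable_on_exp_neg_square_shift) auto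
    then show ?thesis by (simp add: c_def[abs_def])
  qed
  have c0: "c m \<ge> 0" for m using assms by (simp add: c_def)
  have contS: "continuous_on UNIV S" unfolding S_def by (rule continuous_on_gauss_sum[OF assms])
  have contT: "continuous_on UNIV T" unfolding T_def
    by (rule continuous_on_infsum_bound[where M = "\<lambda>_. c"]) (auto simp: norm_mult c0 sumc intro!: continuous_intros)
  have perS: "S (a + 1) = S a" for a
    unfolding S_def
    by (rule infsum_reindex_bij_witness[where i = "\<lambda>n. n - 1" and j = "\<lambda>n. n + 1"]) (auto simp: add_ac)
  have perT: "T (a + 1) = T a" for a
    unfolding T_def by (simp add: distrib_left flip: cis_mult)
  \<comment> \<open>A character multiplied into the sum only moves the frequency from
    \<open>\<theta>\<close> to \<open>\<theta> + k\<close>, because it is 1 at integers. The index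
    is \<open>- k\<close> because the character enters without conjugation.\<close>
  have intS: "integral {0..1} (\<lambda>a. S a * cis (2 * pi * of_int k * a)) = of_real (c (- k))" for k
  proof -
    have shift: "gauss \<alpha> (\<theta> + of_int k) (of_int n + a) = gauss \<alpha> \<theta> (of_int n + a) * cis (2 * pi * of_int k * a)" for n :: int and a
    proof -
      have "cis (2 * pi * (\<theta> + of_int k) * (of_int n + a)) =
        cis (2 * pi * \<theta> * (of_int n + a) + 2 * pi * of_int k * a + 2 * pi * of_int (k * n))"
        by (intro arg_cong[where f = cis]) (simp add: algebra_simps)
      also have "\<dots> = cis (2 * pi * \<theta> * (of_int n + a)) * cis (2 * pi * of_int k * a)"
        by (simp only: cis_mult[symmetric] cis_2pi_int_mult mult_1_right)
      finally show ?thesis by (simp add: gauss_def)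
    qed
    have "integral {0..1} (\<lambda>a. S a * cis (2 * pi * of_int k * a)) = of_real (exp (- pi * (\<theta> + of_int k)\<^sup>2 / \<alpha>) / sqrt \<alpha>)"
      using integral_gauss_sum[OF assms, of "\<theta> + of_int k"] by (simp only: shift infsum_cmult_left' S_def)
    also have "(\<theta> + of_int k)\<^sup>2 = (of_int (- k) - \<theta>)\<^sup>2" by (simp add: power2_eq_square algebra_simps)
    finally show ?thesis by (simp add: c_def)
  qed
  have intT: "integral {0..1} (\<lambda>a. T a * cis (2 * pi * of_int k * a)) = of_real (c (- k))" for k
  proof -
    define f where "f m a = of_real (c m) * cis (2 * pi * of_int (m + k) * a)" for m :: int and a :: real
    have cis_add: "cis (2 * pi * of_int m * a) * cis (2 * pi * of_int k * a) = cis (2 * pi * of_int (m + k) * a)" for m a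
      by (simp add: cis_mult) (simp add: algebra_simps)
    have f: "T a * cis (2 * pi * of_int k * a) = (\<Sum>\<^sub>\<infinity>m. f m a)" for a
      unfolding T_def infsum_cmult_left'[symmetric] f_def by (simp only: mult.assoc[of "of_real _"] cis_add)
    have "uniform_limit {0..1} (\<lambda>X a. \<Sum>m\<in>X. f m a) (\<lambda>a. \<Sum>\<^sub>\<infinity>m. f m a) (finite_subsets_at_top UNIV)"
      by (rule Weierstrass_m_test_general[where M = c]) (auto simp: f_def norm_mult c0 sumc simp del: of_int_add)
    then obtain I J where IJ: "\<And>X. ((\<lambda>a. \<Sum>m\<in>X. f m a) has_integral I X) {0..1}"
      "((\<lambda>a. \<Sum>\<^sub>\<infinity>m. f m a) has_integral J) {0..1}" "(I \<longlongrightarrow> J) (finite_subsets_at_top UNIV)"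
      by (rule uniform_limit_integral) (auto simp: f_def intro!: continuous_intros)
    have "((\<lambda>a. \<Sum>m\<in>X. f m a) has_integral (\<Sum>m\<in>X. of_real (c m) * (if m + k = 0 then 1 else 0))) {0..1}" if "finite X" for X
      unfolding f_def using that
      by (intro has_integral_sum has_integral_mult_right integral_cis_2pi) auto
    then have I: "I X = (\<Sum>m\<in>X. of_real (c m) * (if m + k = 0 then 1 else 0))" if "finite X" for X
      using IJ(1)[of X] that has_integral_unique by blast
    have "eventually (\<lambda>X. I X = of_real (c (- k))) (finite_subsets_at_top UNIV)"
      unfolding eventually_finite_subsets_at_top
    proof (intro exI[of _ "{- k}"] conjI allI impI)
      fix X assume X: "finite X \<and> {- k} \<subseteq> X \<and> X \<subseteq> UNIV"
      have "I X = (\<Sum>m\<in>X. of_real (c m) * (if m + k = 0 then 1 else 0))"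
        using X by (intro I) auto
      also have "\<dots> = (\<Sum>m\<in>X. if m = - k then of_real (c m) else 0)"
        by (intro sum.cong) (auto simp: eq_neg_iff_add_eq_0)
      finally show "I X = of_real (c (- k))" using X by simp
    qed auto
    then have "(I \<longlongrightarrow> of_real (c (- k))) (finite_subsets_at_top UNIV)"
      by (rule tendsto_eventually)
    then have "J = of_real (c (- k))"
      using IJ(3) by (intro tendsto_unique[OF finite_subsets_at_top_neq_bot])
    then show ?thesis using IJ(2) by (simp add: f integral_unique)
  qed
  have "fourier_null (\<lambda>a. S a - T a)"
    unfolding fourier_null_def
  proof (intro conjI allI)
    show "continuous_on UNIV (\<lambda>a. S a - T a)" by (intro continuous_intros contS contT)
    fix m :: int
    have "integral {0..1} (\<lambda>a. (S a - T a) * cis (2 * pi * of_int m * a)) =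
      integral {0..1} (\<lambda>a. S a * cis (2 * pi * of_int m * a)) - integral {0..1} (\<lambda>a. T a * cis (2 * pi * of_int m * a))"
      unfolding left_diff_distrib
      by (intro Henstock_Kurzweil_Integration.integral_diff integrable_continuous_real continuous_intros
          continuous_on_subset[OF contS] continuous_on_subset[OF contT]) auto
    then show "integral {0..1} (\<lambda>a. (S a - T a) * cis (2 * pi * of_int m * a)) = 0"
      by (simp add: intS intT)
  qed (simp add: perS perT)
  from fourier_null_imp_zero[OF this, of a] show ?thesis by (simp add: S_def T_def c_def)
qed

section \<open>Poisson summation for lattices\<close>

lemma infsum_complex_of_real:
  "f summable_on A \<Longrightarrow> (\<Sum>\<^sub>\<infinity>x\<in>A. complex_of_real (f x)) = of_real (\<Sum>\<^sub>\<infinity>x\<in>A. f x)"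
  by (intro infsumI has_sum_of_real has_sum_infsum)

text \<open>After Poisson summation the shift \<open>a\<close> survives only in phases, so absolute
  values give a bound independent of \<open>a\<close>. The uniformity is used where the shift varies
  with a dual vector.\<close>

lemma gauss_sum_bounded:
  assumes "\<alpha> > 0"
  obtains K where "\<And>a. (\<Sum>\<^sub>\<infinity>n::int. exp (- pi * \<alpha> * (of_int n + a)\<^sup>2)) \<le> K"
proof
  fix a
  have sum: "(\<lambda>m::int. exp (- pi * (of_int m)\<^sup>2 / \<alpha>) / sqrt \<alpha>) summable_on UNIV"
    using summable_on_cmult_left[OF summable_on_exp_neg_square[of "pi / \<alpha>"], of "1 / sqrt \<alpha>"] assms by simp
  have "(\<Sum>\<^sub>\<infinity>n::int. exp (- pi * \<alpha> * (of_int n + a)\<^sup>2)) = norm (\<Sum>\<^sub>\<infinity>n::int. gauss \<alpha> 0 (of_int n + a))"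
    using summable_on_exp_neg_square_shift[OF assms, of a]
    by (simp add: gauss_def infsum_complex_of_real infsum_nonneg)
  also have "\<dots> = norm (\<Sum>\<^sub>\<infinity>m::int. of_real (exp (- pi * (of_int m)\<^sup>2 / \<alpha>) / sqrt \<alpha>) * cis (2 * pi * of_int m * a))"
    by (simp only: poisson_gauss[OF assms] diff_zero)
  also have "\<dots> \<le> (\<Sum>\<^sub>\<infinity>m::int. exp (- pi * (of_int m)\<^sup>2 / \<alpha>) / sqrt \<alpha>)"
  proof (rule norm_infsum_le[OF has_sum_infsum has_sum_infsum[OF sum]])
    show "(\<lambda>m. of_real (exp (- pi * (of_int m)\<^sup>2 / \<alpha>) / sqrt \<alpha>) * cis (2 * pi * of_int m * a)) summable_on UNIV"
      by (rule abs_summable_summable) (use sum assms in \<open>simp add: norm_mult norm_divide\<close>)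
  qed (use assms in \<open>simp add: norm_mult norm_divide\<close>)
  finally show "(\<Sum>\<^sub>\<infinity>n::int. exp (- pi * \<alpha> * (of_int n + a)\<^sup>2)) \<le> (\<Sum>\<^sub>\<infinity>m::int. exp (- pi * (of_int m)\<^sup>2 / \<alpha>) / sqrt \<alpha>)" .
qed

section \<open>Lattices, their duals, and the effect of one more basis vector\<close>

lemma int_span_subset_span: "int_span B \<subseteq> span B"
proof
  fix x assume "x \<in> int_span B"
  then show "x \<in> span B"
    by (induction rule: int_module.span_induct_alt) (auto intro: span_zero span_add span_scale span_base)
qed

lemma span_int_span: "span (int_span B) = span B"
  by (metis int_span_subset_span int_module.span_superset span_mono span_span subset_antisym)

lemma dual_lattice_int_span:
  "dual_lattice (int_span B) = {y \<in> span B. \<forall>b\<in>B. b \<bullet> y \<in> \<int>}"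
proof -
  have "x \<bullet> y \<in> \<int>" if "x \<in> int_span B" "\<forall>b\<in>B. b \<bullet> y \<in> \<int>" for x y
    using that by (induction rule: int_module.span_induct_alt) (auto simp: inner_add_left)
  then show ?thesis
    unfolding dual_lattice_def span_int_span using int_module.span_base by blast
qed

text \<open>One Gram-Schmidt step per vector, valid in any real inner product space. If
  \<open>a\<close> already lies in \<open>span B\<close>, then \<open>d\<close> is 0 and division by
  zero yields the required coefficient 0.\<close>

lemma orthogonal_projection_exists:
  fixes b :: "'a::real_inner"
  assumes "finite B"
  shows "\<exists>p\<in>span B. \<forall>x\<in>span B. (b - p) \<bullet> x = 0"
  using assms
proof (induction B arbitrary: b)
  case empty
  then show ?case by simp
next
  case (insert a B)
  obtain pa where pa: "pa \<in> span B" "\<And>x. x \<in> span B \<Longrightarrow> (a - pa) \<bullet> x = 0" using insert.IH by blast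
  obtain pb where pb: "pb \<in> span B" "\<And>x. x \<in> span B \<Longrightarrow> (b - pb) \<bullet> x = 0" using insert.IH by blast
  define d where "d = a - pa"
  define p where "p = pb + ((b - pb) \<bullet> d / (d \<bullet> d)) *\<^sub>R d"
  have sub: "x \<in> span (insert a B)" if "x \<in> span B" for x
    using that span_mono[of B "insert a B"] by auto
  have "d \<in> span (insert a B)"
    unfolding d_def by (intro span_diff sub[OF pa(1)] span_base) simp
  then have "p \<in> span (insert a B)"
    unfolding p_def by (intro span_add span_scale sub[OF pb(1)])
  moreover have "(b - p) \<bullet> x = 0" if x: "x \<in> span (insert a B)" for x
  proof -
    obtain k where k: "x - k *\<^sub>R a \<in> span B" using x span_breakdown_eq by blast
    define y where "y = x - k *\<^sub>R a + k *\<^sub>R pa"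
    have y: "y \<in> span B" unfolding y_def by (intro span_add k span_scale pa)
    have x_eq: "x = y + k *\<^sub>R d" by (simp add: y_def d_def algebra_simps)
    have "(b - p) \<bullet> y = 0"
      using pb(2)[OF y] pa(2)[OF y] unfolding p_def d_def[symmetric]
      by (simp add: inner_diff_left inner_add_left)
    moreover have "(b - p) \<bullet> d = 0"
      unfolding p_def by (cases "d = 0") (simp_all add: inner_diff_left inner_add_left)
    ultimately show ?thesis by (simp add: x_eq inner_add_right)
  qed
  ultimately show ?case by blast
qed

text \<open>The multiple of \<open>b\<close> is read off from the component along
  \<open>b - p\<close>, to which \<open>int_span B\<close> contributes nothing; the floor merely
  converts a real number that is already integral.\<close>

lemma bij_betw_int_span_insert:
  assumes "finite B" "p \<in> span B" "\<And>x. x \<in> span B \<Longrightarrow> (b - p) \<bullet> x = 0" "b \<notin> span B"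
  shows "bij_betw (\<lambda>(n::int, x). x + of_int n *\<^sub>R b) (UNIV \<times> int_span B) (int_span (insert b B))"
proof (rule bij_betw_byWitness[where f' = "\<lambda>x. (\<lfloor>(b - p) \<bullet> x / ((b - p) \<bullet> (b - p))\<rfloor>,
      x - of_int \<lfloor>(b - p) \<bullet> x / ((b - p) \<bullet> (b - p))\<rfloor> *\<^sub>R b)"])
  have "b \<noteq> p" using assms by auto
  moreover have "(b - p) \<bullet> b = (b - p) \<bullet> (b - p)"
    using assms(3)[OF assms(2)] by (simp add: inner_diff_right)
  ultimately have *: "(b - p) \<bullet> (x + of_int n *\<^sub>R b) / ((b - p) \<bullet> (b - p)) = of_int n" if "x \<in> int_span B" for x n
    using assms(3)[of x] that int_span_subset_span[of B] by (auto simp: inner_add_right)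
  show "\<forall>a\<in>UNIV \<times> int_span B. (\<lambda>x. (\<lfloor>(b - p) \<bullet> x / ((b - p) \<bullet> (b - p))\<rfloor>,
      x - of_int \<lfloor>(b - p) \<bullet> x / ((b - p) \<bullet> (b - p))\<rfloor> *\<^sub>R b)) (case a of (n, x) \<Rightarrow> x + of_int n *\<^sub>R b) = a"
    by (auto simp: *)
  show "(\<lambda>(n::int, x). x + of_int n *\<^sub>R b) ` (UNIV \<times> int_span B) \<subseteq> int_span (insert b B)"
  proof clarsimp
    fix n :: int and x assume "x \<in> int_span B"
    then have "x \<in> int_span (insert b B)" using int_module.span_mono[of B "insert b B"] by auto
    then show "x + of_int n *\<^sub>R b \<in> int_span (insert b B)"
      by (rule int_module.span_add[OF _ int_module.span_scale[OF int_module.span_base]]) simp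
  qed
  {
    fix x assume "x \<in> int_span (insert b B)"
    then obtain k where k: "x - of_int k *\<^sub>R b \<in> int_span B" using int_module.span_breakdown_eq by blast
    have "(b - p) \<bullet> x / ((b - p) \<bullet> (b - p)) = of_int k" using *[OF k, of k] by simp
    then have "\<lfloor>(b - p) \<bullet> x / ((b - p) \<bullet> (b - p))\<rfloor> = k" by simp
    then have "x - of_int \<lfloor>(b - p) \<bullet> x / ((b - p) \<bullet> (b - p))\<rfloor> *\<^sub>R b \<in> int_span B" using k by simp
  }
  then show "(\<lambda>x. (\<lfloor>(b - p) \<bullet> x / ((b - p) \<bullet> (b - p))\<rfloor>,
      x - of_int \<lfloor>(b - p) \<bullet> x / ((b - p) \<bullet> (b - p))\<rfloor> *\<^sub>R b)) ` int_span (insert b B) \<subseteq> UNIV \<times> int_span B"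
    by auto
qed auto

text \<open>A vector dual to the enlarged lattice splits into \<open>y\<close> in
  \<open>span B\<close> and a multiple of \<open>b - p\<close>. Prescribing the inner product
  \<open>m\<close> with \<open>b\<close> forces the coefficient of the second part.\<close>

lemma bij_betw_dual_insert:
  fixes B :: "'a::real_inner set"
  assumes "finite B" "p \<in> span B" "\<And>x. x \<in> span B \<Longrightarrow> (b - p) \<bullet> x = 0" "b \<notin> span B"
  shows "bij_betw (\<lambda>(y, m::int). y + ((of_int m - y \<bullet> p) / ((b - p) \<bullet> (b - p))) *\<^sub>R (b - p))
           (dual_lattice (int_span B) \<times> UNIV) (dual_lattice (int_span (insert b B)))"
proof -
  define d where "d = b - p"
  define f where "f = (\<lambda>(y, m::int). y + ((of_int m - y \<bullet> p) / (d \<bullet> d)) *\<^sub>R d)"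
  define g where "g = (\<lambda>y. (y - (d \<bullet> y / (d \<bullet> d)) *\<^sub>R d, \<lfloor>b \<bullet> y\<rfloor>))"
  have "d \<noteq> 0" using assms by (auto simp: d_def)
  then have dd: "d \<bullet> d \<noteq> 0" by simp
  have d_orth: "d \<bullet> x = 0" "x \<bullet> d = 0" if "x \<in> span B" for x
    using assms(3)[OF that] by (auto simp: d_def inner_commute)
  have b: "b = p + d" by (simp add: d_def)
  have sub: "x \<in> span (insert b B)" if "x \<in> span B" for x
    using that span_mono[of B "insert b B"] by auto
  have d_span: "d \<in> span (insert b B)"
    unfolding d_def by (intro span_diff sub[OF assms(2)] span_base) simp
  have b_f: "b \<bullet> f (y, m) = of_int m" if "y \<in> span B" for y m
    using dd by (simp add: f_def b inner_add_left inner_add_right d_orth that assms(2) inner_commute[of p y])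
  have "bij_betw f (dual_lattice (int_span B) \<times> UNIV) (dual_lattice (int_span (insert b B)))"
  proof (rule bij_betw_byWitness[where f' = g])
    have "g (f (y, m)) = (y, m)" if "y \<in> span B" for y m
    proof -
      have "d \<bullet> f (y, m) / (d \<bullet> d) = (of_int m - y \<bullet> p) / (d \<bullet> d)"
        using dd by (simp add: f_def inner_add_right d_orth that)
      then show ?thesis unfolding g_def b_f[OF that, of m] by (simp only:) (simp add: f_def)
    qed
    then show "\<forall>a\<in>dual_lattice (int_span B) \<times> UNIV. g (f a) = a"
      by (auto simp: dual_lattice_int_span)
    have fD: "f (y, m) \<in> dual_lattice (int_span (insert b B))" if "y \<in> dual_lattice (int_span B)" for y m
    proof -
      have y: "y \<in> span B" using that by (simp add: dual_lattice_int_span)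
      have "f (y, m) \<in> span (insert b B)"
        unfolding f_def prod.case by (intro span_add span_scale d_span sub[OF y])
      moreover have "x \<bullet> f (y, m) = x \<bullet> y" if "x \<in> B" for x
        using span_base[OF that] by (simp add: f_def inner_add_right d_orth)
      ultimately show ?thesis
        using that b_f[OF y, of m] by (auto simp: dual_lattice_int_span)
    qed
    then show "f ` (dual_lattice (int_span B) \<times> UNIV) \<subseteq> dual_lattice (int_span (insert b B))" by auto
    have gD: "fst (g y) \<in> dual_lattice (int_span B)" and fg: "f (g y) = y" if y: "y \<in> dual_lattice (int_span (insert b B))" for y
    proof -
      obtain k where k: "y - k *\<^sub>R b \<in> span B" 
      proof -
        have "y \<in> span (insert b B)" using y by (simp add: dual_lattice_int_span)
        then show ?thesis using that span_breakdown_eq by blast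
      qed
      define z where "z = y - k *\<^sub>R b + k *\<^sub>R p"
      have z: "z \<in> span B" unfolding z_def by (intro span_add k span_scale assms)
      have y_eq: "y = z + k *\<^sub>R d" by (simp add: z_def d_def algebra_simps)
      have dy: "d \<bullet> y / (d \<bullet> d) = k" using dd by (simp add: y_eq inner_add_right d_orth z)
      have fst: "fst (g y) = z" by (simp add: g_def dy) (simp add: y_eq)
      have "x \<bullet> z = x \<bullet> y" if "x \<in> B" for x
        using d_orth[OF span_base[OF that]] by (simp add: y_eq inner_add_right)
      then show "fst (g y) \<in> dual_lattice (int_span B)"
        using y z by (auto simp: dual_lattice_int_span fst)
      have "b \<bullet> y \<in> \<int>" using y by (auto simp: dual_lattice_int_span)
      then have snd: "of_int (snd (g y)) = b \<bullet> y" by (auto simp: g_def elim: Ints_cases)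
      have "b \<bullet> y = p \<bullet> z + k * (d \<bullet> d)"
        by (simp add: b y_eq inner_add_left inner_add_right d_orth z assms(2))
      then have "(of_int (snd (g y)) - z \<bullet> p) / (d \<bullet> d) = k" using dd by (simp add: snd inner_commute)
      then show "f (g y) = y" by (cases "g y") (use fst in \<open>simp add: f_def y_eq\<close>)
    qed
    then show "\<forall>a'\<in>dual_lattice (int_span (insert b B)). f (g a') = a'" by auto
    show "g ` dual_lattice (int_span (insert b B)) \<subseteq> dual_lattice (int_span B) \<times> UNIV"
      by (simp add: image_subset_iff mem_Times_iff gD)
  qed
  then show ?thesis by (simp add: f_def d_def)
qed

lemma summable_on_product_nonneg:
  fixes f :: "'b \<Rightarrow> real" and g :: "'c \<Rightarrow> real"
  assumes "f summable_on A" "g summable_on B" "\<And>x. f x \<ge> 0" "\<And>y. g y \<ge> 0"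
  shows "(\<lambda>(x, y). f x * g y) summable_on A \<times> B"
proof (rule summable_on_SigmaI)
  show "((\<lambda>y. case (x, y) of (x, y) \<Rightarrow> f x * g y) has_sum f x * infsum g B) B" for x
    unfolding prod.case by (rule has_sum_cmult_right[OF has_sum_infsum[OF assms(2)]])
  show "(\<lambda>x. f x * infsum g B) summable_on A"
    by (rule summable_on_cmult_left[OF assms(1)])
qed (use assms in auto)

text \<open>
  Adding a basis vector \<open>b\<close> with component \<open>d\<close> orthogonal to \<open>span B\<close>: the Poisson formula for \<open>int_span B\<close>,
  applied for each multiple of \<open>b\<close>, is combined with the one-dimensional formula along \<open>d\<close>.
\<close>

lemma lattice_poisson_step:
  fixes B :: "'a::real_inner set"
  assumes B: "finite B" and p: "p \<in> span B" "\<And>x. x \<in> span B \<Longrightarrow> (b - p) \<bullet> x = 0" and b: "b \<notin> span B"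
    and s: "s > 0" and u: "u \<in> span (insert b B)"
    and sumL: "\<And>u. u \<in> span B \<Longrightarrow> (\<lambda>x. exp (- pi * s * (norm (x + u))\<^sup>2)) summable_on int_span B"
    and sumD: "(\<lambda>y. exp (- pi / s * (norm y)\<^sup>2)) summable_on dual_lattice (int_span B)"
    and eq: "\<And>u. u \<in> span B \<Longrightarrow> (\<Sum>\<^sub>\<infinity>x\<in>int_span B. complex_of_real (exp (- pi * s * (norm (x + u))\<^sup>2))) =
        of_real C * (\<Sum>\<^sub>\<infinity>y\<in>dual_lattice (int_span B). of_real (exp (- pi / s * (norm y)\<^sup>2)) * cis (2 * pi * (y \<bullet> u)))"
    and C: "C > 0"
  defines "d \<equiv> b - p"
  shows "(\<lambda>x. exp (- pi * s * (norm (x + u))\<^sup>2)) summable_on int_span (insert b B)"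
    and "(\<lambda>y. exp (- pi / s * (norm y)\<^sup>2)) summable_on dual_lattice (int_span (insert b B))"
    and "(\<Sum>\<^sub>\<infinity>x\<in>int_span (insert b B). complex_of_real (exp (- pi * s * (norm (x + u))\<^sup>2))) =
      of_real (C / sqrt (s * (d \<bullet> d))) * (\<Sum>\<^sub>\<infinity>y\<in>dual_lattice (int_span (insert b B)).
         of_real (exp (- pi / s * (norm y)\<^sup>2)) * cis (2 * pi * (y \<bullet> u)))"
proof -
  have "d \<noteq> 0" using p b by (auto simp: d_def)
  then have dd: "d \<bullet> d > 0" by simp
  have d_orth: "d \<bullet> x = 0" "x \<bullet> d = 0" if "x \<in> span B" for x
    using p(2)[OF that] by (auto simp: d_def inner_commute)
  define \<alpha> where "\<alpha> = s * (d \<bullet> d)"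
  have \<alpha>: "\<alpha> > 0" using s dd by (simp add: \<alpha>_def)
  \<comment> \<open>Splitting the shift \<open>u\<close> along \<open>span B\<close> and
    \<open>d\<close> makes the squared norms in the exponent separate.\<close>
  obtain w where w: "u - w *\<^sub>R b \<in> span B" using u span_breakdown_eq by blast
  define u' where "u' = u - w *\<^sub>R b + w *\<^sub>R p"
  have u': "u' \<in> span B" unfolding u'_def by (intro span_add w span_scale p)
  have u_eq: "u = u' + w *\<^sub>R d" by (simp add: u'_def d_def algebra_simps)
  define v where "v n = of_int n *\<^sub>R p + u'" for n :: int
  have v: "v n \<in> span B" for n unfolding v_def by (intro span_add span_scale p u')
  define L where "L = int_span B"
  define D where "D = dual_lattice L"
  have LD: "x \<in> L \<Longrightarrow> x \<in> span B" "y \<in> D \<Longrightarrow> y \<in> span B" for x y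
    using int_span_subset_span by (auto simp: L_def D_def dual_lattice_int_span)
  define e where "e n = exp (- pi * \<alpha> * (of_int n + w)\<^sup>2)" for n :: int
  define E where "E y = exp (- pi / s * (norm y)\<^sup>2)" for y :: 'a
  define k where "k y m = exp (- pi * (of_int m - y \<bullet> p)\<^sup>2 / \<alpha>)" for y :: 'a and m :: int
  have nonneg: "e n \<ge> 0" "E y \<ge> 0" "k y m \<ge> 0" for n y m by (simp_all add: e_def E_def k_def)
  define \<phi> where "\<phi> = (\<lambda>(n, x). e n * exp (- pi * s * (norm (x + v n))\<^sup>2))"
  define f where "f = (\<lambda>(n::int, x). x + of_int n *\<^sub>R b)"
  define h where "h = (\<lambda>(y, m::int). y + ((of_int m - y \<bullet> p) / (d \<bullet> d)) *\<^sub>R d)"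
  have bij: "bij_betw f (UNIV \<times> L) (int_span (insert b B))"
    unfolding f_def L_def using B p b by (rule bij_betw_int_span_insert)
  have bijD: "bij_betw h (D \<times> UNIV) (dual_lattice (int_span (insert b B)))"
    unfolding h_def D_def L_def d_def using B p b by (rule bij_betw_dual_insert)
  have sume: "e summable_on UNIV"
    unfolding e_def by (rule summable_on_exp_neg_square_shift[OF \<alpha>])
  have norm_add: "(norm (x + a *\<^sub>R d))\<^sup>2 = (norm x)\<^sup>2 + a\<^sup>2 * (d \<bullet> d)" if "x \<in> span B" for x a
    unfolding power2_norm_eq_inner
    by (simp add: inner_add_left inner_add_right d_orth[OF that] power2_eq_square)
  have \<phi>_eq: "exp (- pi * s * (norm (f z + u))\<^sup>2) = \<phi> z" if "z \<in> UNIV \<times> L" for z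
  proof -
    obtain n x where z: "z = (n, x)" "x \<in> L" using \<open>z \<in> UNIV \<times> L\<close> by auto
    have "f z + u = (x + v n) + (of_int n + w) *\<^sub>R d"
      by (simp add: z f_def u_eq v_def d_def algebra_simps)
    moreover have "x + v n \<in> span B" using LD z v by (intro span_add) auto
    ultimately have "(norm (f z + u))\<^sup>2 = (norm (x + v n))\<^sup>2 + (of_int n + w)\<^sup>2 * (d \<bullet> d)"
      by (simp only: norm_add)
    then show ?thesis
      by (simp only: \<phi>_def z prod.case e_def \<alpha>_def flip: exp_add) (simp add: ring_distribs)
  qed
  \<comment> \<open>On the dual side of the assumed formula the shift \<open>v n\<close> occurs only
    in phases. This bounds the sums over \<open>L\<close> uniformly in \<open>n\<close>, which makes
    the double sum converge.\<close>
  define K where "K = \<bar>C\<bar> * (\<Sum>\<^sub>\<infinity>y\<in>D. E y)"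
  have sumE: "E summable_on D" using sumD unfolding E_def[abs_def] D_def L_def .
  have K: "(\<Sum>\<^sub>\<infinity>x\<in>L. exp (- pi * s * (norm (x + v n))\<^sup>2)) \<le> K" for n
  proof -
    have "(\<Sum>\<^sub>\<infinity>x\<in>L. exp (- pi * s * (norm (x + v n))\<^sup>2)) =
      norm (\<Sum>\<^sub>\<infinity>x\<in>L. complex_of_real (exp (- pi * s * (norm (x + v n))\<^sup>2)))"
      using sumL[OF v] by (subst infsum_complex_of_real) (auto simp: L_def infsum_nonneg)
    also have "\<dots> = \<bar>C\<bar> * norm (\<Sum>\<^sub>\<infinity>y\<in>D. of_real (E y) * cis (2 * pi * (y \<bullet> v n)))"
      unfolding L_def D_def eq[OF v] E_def by (simp add: norm_mult)
    also have "norm (\<Sum>\<^sub>\<infinity>y\<in>D. of_real (E y) * cis (2 * pi * (y \<bullet> v n))) \<le> (\<Sum>\<^sub>\<infinity>y\<in>D. E y)"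
    proof (rule norm_infsum_le[OF has_sum_infsum has_sum_infsum[OF sumE]])
      show "(\<lambda>y. of_real (E y) * cis (2 * pi * (y \<bullet> v n))) summable_on D"
        by (rule abs_summable_summable) (use sumE in \<open>simp add: norm_mult nonneg\<close>)
    qed (simp add: norm_mult nonneg)
    finally show ?thesis by (simp add: K_def mult_left_mono)
  qed
  have sum\<phi>: "\<phi> summable_on UNIV \<times> L"
  proof (rule summable_on_SigmaI)
    fix n :: int
    show "((\<lambda>x. \<phi> (n, x)) has_sum e n * (\<Sum>\<^sub>\<infinity>x\<in>L. exp (- pi * s * (norm (x + v n))\<^sup>2))) L"
      unfolding \<phi>_def prod.case by (intro has_sum_cmult_right has_sum_infsum sumL[OF v, folded L_def])
  next
    show "(\<lambda>n. e n * (\<Sum>\<^sub>\<infinity>x\<in>L. exp (- pi * s * (norm (x + v n))\<^sup>2))) summable_on UNIV"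
    proof (rule summable_on_comparison_test)
      show "(\<lambda>n. e n * K) summable_on UNIV" by (rule summable_on_cmult_left[OF sume])
    qed (rule mult_left_mono[OF K nonneg(1)], rule mult_nonneg_nonneg[OF nonneg(1) infsum_nonneg], simp)
  qed (auto simp: \<phi>_def nonneg)
  show "(\<lambda>x. exp (- pi * s * (norm (x + u))\<^sup>2)) summable_on int_span (insert b B)"
  proof (rule summable_on_reindex_bij_betw[OF bij, THEN iffD1])
    show "(\<lambda>z. exp (- pi * s * (norm (f z + u))\<^sup>2)) summable_on UNIV \<times> L"
      using sum\<phi> by (subst summable_on_cong[OF \<phi>_eq])
  qed
  have E_h: "exp (- pi / s * (norm (h (y, m)))\<^sup>2) = E y * k y m" if "y \<in> D" for y m
  proof -
    have "(norm (h (y, m)))\<^sup>2 = (norm y)\<^sup>2 + (of_int m - y \<bullet> p)\<^sup>2 / (d \<bullet> d)"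
    proof -
      have "(norm (h (y, m)))\<^sup>2 = (norm y)\<^sup>2 + ((of_int m - y \<bullet> p) / (d \<bullet> d))\<^sup>2 * (d \<bullet> d)"
        unfolding h_def prod.case by (rule norm_add[OF LD(2)[OF that]])
      moreover have "(t / D)\<^sup>2 * D = t\<^sup>2 / D" if "D > 0" for t D :: real
        using that by (simp add: power2_eq_square)
      ultimately show ?thesis using dd by (simp only:)
    qed
    then have "- pi / s * (norm (h (y, m)))\<^sup>2 = - pi / s * (norm y)\<^sup>2 + - pi * (of_int m - y \<bullet> p)\<^sup>2 / \<alpha>"
      using s dd by (simp add: \<alpha>_def ring_distribs)
    then show ?thesis by (simp only: E_def k_def exp_add)
  qed
  have k_eq: "k y m = exp (- pi * (1 / \<alpha>) * (of_int m + - (y \<bullet> p))\<^sup>2)" for y m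
    by (simp add: k_def)
  have sumk: "k y summable_on UNIV" for y
    unfolding k_eq[abs_def] by (rule summable_on_exp_neg_square_shift) (use \<alpha> in auto)
  obtain K' where "\<And>a. (\<Sum>\<^sub>\<infinity>n::int. exp (- pi * (1 / \<alpha>) * (of_int n + a)\<^sup>2)) \<le> K'"
    using gauss_sum_bounded[of "1 / \<alpha>"] \<alpha> by auto
  then have K': "(\<Sum>\<^sub>\<infinity>m. k y m) \<le> K'" for y unfolding k_eq[abs_def] .
  have sumEk: "(\<lambda>(y, m). E y * k y m) summable_on D \<times> UNIV"
  proof (rule summable_on_SigmaI)
    fix y
    show "((\<lambda>m. case (y, m) of (y, m) \<Rightarrow> E y * k y m) has_sum E y * (\<Sum>\<^sub>\<infinity>m. k y m)) UNIV"
      unfolding prod.case by (intro has_sum_cmult_right has_sum_infsum sumk)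
  next
    show "(\<lambda>y. E y * (\<Sum>\<^sub>\<infinity>m. k y m)) summable_on D"
    proof (rule summable_on_comparison_test)
      show "(\<lambda>y. E y * K') summable_on D" by (rule summable_on_cmult_left[OF sumE])
    qed (rule mult_left_mono[OF K' nonneg(2)], rule mult_nonneg_nonneg[OF nonneg(2) infsum_nonneg[OF nonneg(3)]])
  qed (auto simp: nonneg)
  show "(\<lambda>y. exp (- pi / s * (norm y)\<^sup>2)) summable_on dual_lattice (int_span (insert b B))"
  proof (rule summable_on_reindex_bij_betw[OF bijD, THEN iffD1])
    show "(\<lambda>z. exp (- pi / s * (norm (h z))\<^sup>2)) summable_on D \<times> UNIV"
      using sumEk by (rule summable_on_cong[THEN iffD1, rotated]) (use E_h in auto)
  qed
  \<comment> \<open>For a fixed dual vector the sum over multiples of \<open>b\<close> is a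
    one-dimensional Gaussian sum of frequency \<open>y \<bullet> p\<close>; its Poisson transform is
    the sum over the new dual coordinate \<open>m\<close>.\<close>
  have inner_n: "(\<Sum>\<^sub>\<infinity>n. of_real (e n) * cis (2 * pi * (y \<bullet> v n))) =
      (\<Sum>\<^sub>\<infinity>m. of_real (k y m) * cis (2 * pi * (h (y, m) \<bullet> u))) / sqrt \<alpha>" if "y \<in> D" for y
  proof -
    have "of_real (e n) * cis (2 * pi * (y \<bullet> v n)) =
      gauss \<alpha> (y \<bullet> p) (of_int n + w) * cis (2 * pi * (y \<bullet> u' - (y \<bullet> p) * w))" for n
    proof -
      have "cis (2 * pi * (y \<bullet> v n)) =
         cis (2 * pi * (y \<bullet> p) * (of_int n + w)) * cis (2 * pi * (y \<bullet> u' - (y \<bullet> p) * w))"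
        unfolding cis_mult by (intro arg_cong[where f = cis]) (simp add: v_def inner_add_right algebra_simps)
      then show ?thesis by (simp add: gauss_def e_def)
    qed
    then have "(\<Sum>\<^sub>\<infinity>n. of_real (e n) * cis (2 * pi * (y \<bullet> v n))) =
      (\<Sum>\<^sub>\<infinity>n::int. gauss \<alpha> (y \<bullet> p) (of_int n + w)) * cis (2 * pi * (y \<bullet> u' - (y \<bullet> p) * w))"
      by (simp add: infsum_cmult_left')
    also have "\<dots> = (\<Sum>\<^sub>\<infinity>m. of_real (k y m / sqrt \<alpha>) * cis (2 * pi * of_int m * w) * cis (2 * pi * (y \<bullet> u' - (y \<bullet> p) * w)))"
      unfolding poisson_gauss[OF \<alpha>] k_def by (simp only: infsum_cmult_left')
    also have "\<dots> = (\<Sum>\<^sub>\<infinity>m. of_real (k y m) * cis (2 * pi * (h (y, m) \<bullet> u)) * of_real (1 / sqrt \<alpha>))"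
    proof (rule infsum_cong)
      fix m :: int
      have hu: "h (y, m) \<bullet> u = y \<bullet> u' + (of_int m - y \<bullet> p) * w"
        using dd by (simp add: h_def u_eq inner_add_left inner_add_right d_orth[OF u'] d_orth[OF LD(2)[OF that]])
      have cis: "cis (2 * pi * of_int m * w) * cis (2 * pi * (y \<bullet> u' - (y \<bullet> p) * w)) = cis (2 * pi * (h (y, m) \<bullet> u))"
        unfolding cis_mult hu by (intro arg_cong[where f = cis]) (simp add: algebra_simps)
      show "of_real (k y m / sqrt \<alpha>) * cis (2 * pi * of_int m * w) * cis (2 * pi * (y \<bullet> u' - (y \<bullet> p) * w)) =
        of_real (k y m) * cis (2 * pi * (h (y, m) \<bullet> u)) * of_real (1 / sqrt \<alpha>)"
        unfolding mult.assoc[of "of_real (k y m / sqrt \<alpha>)"] cis by simp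
    qed
    also have "\<dots> = (\<Sum>\<^sub>\<infinity>m. of_real (k y m) * cis (2 * pi * (h (y, m) \<bullet> u))) * of_real (1 / sqrt \<alpha>)"
      by (rule infsum_cmult_left')
    finally show ?thesis by simp
  qed
  have "(\<Sum>\<^sub>\<infinity>x\<in>int_span (insert b B). complex_of_real (exp (- pi * s * (norm (x + u))\<^sup>2))) =
    (\<Sum>\<^sub>\<infinity>z\<in>UNIV \<times> L. complex_of_real (\<phi> z))"
    unfolding infsum_reindex_bij_betw[OF bij, symmetric] by (intro infsum_cong) (simp only: \<phi>_eq)
  also have "\<dots> = (\<Sum>\<^sub>\<infinity>n. \<Sum>\<^sub>\<infinity>x\<in>L. complex_of_real (\<phi> (n, x)))"
    by (rule infsum_Sigma_banach[symmetric]) (rule summable_on_of_real[OF sum\<phi>])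
  also have "\<dots> = (\<Sum>\<^sub>\<infinity>n. of_real (e n) * (of_real C * (\<Sum>\<^sub>\<infinity>y\<in>D. of_real (E y) * cis (2 * pi * (y \<bullet> v n)))))"
    unfolding \<phi>_def prod.case of_real_mult E_def D_def L_def eq[OF v, symmetric] by (simp only: infsum_cmult_right')
  also have "\<dots> = of_real C * (\<Sum>\<^sub>\<infinity>n. \<Sum>\<^sub>\<infinity>y\<in>D. of_real (E y) * (of_real (e n) * cis (2 * pi * (y \<bullet> v n))))"
    unfolding infsum_cmult_right'[symmetric] by (intro infsum_cong) (simp add: mult_ac)
  also have "(\<Sum>\<^sub>\<infinity>n. \<Sum>\<^sub>\<infinity>y\<in>D. of_real (E y) * (of_real (e n) * cis (2 * pi * (y \<bullet> v n)))) =
    (\<Sum>\<^sub>\<infinity>y\<in>D. \<Sum>\<^sub>\<infinity>n. of_real (E y) * (of_real (e n) * cis (2 * pi * (y \<bullet> v n))))"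
  proof (rule infsum_swap_banach, rule abs_summable_summable)
    have "(\<lambda>(n, y). e n * E y) summable_on UNIV \<times> D"
      by (rule summable_on_product_nonneg[OF sume sumE]) (auto simp: nonneg)
    then show "(\<lambda>z. norm (case z of (n, y) \<Rightarrow> of_real (E y) * (of_real (e n) * cis (2 * pi * (y \<bullet> v n))))) summable_on UNIV \<times> D"
      by (rule summable_on_cong[THEN iffD1, rotated]) (auto simp: norm_mult nonneg)
  qed
  also have "\<dots> = (\<Sum>\<^sub>\<infinity>y\<in>D. of_real (E y) * ((\<Sum>\<^sub>\<infinity>m. of_real (k y m) * cis (2 * pi * (h (y, m) \<bullet> u))) / sqrt \<alpha>))"
    unfolding infsum_cmult_right' by (intro infsum_cong) (simp add: inner_n)
  also have "\<dots> = (\<Sum>\<^sub>\<infinity>y\<in>D. (\<Sum>\<^sub>\<infinity>m. of_real (E y * k y m) * cis (2 * pi * (h (y, m) \<bullet> u))) * of_real (1 / sqrt \<alpha>))"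
    by (simp add: mult.assoc infsum_cmult_right')
  also have "\<dots> = (\<Sum>\<^sub>\<infinity>y\<in>D. \<Sum>\<^sub>\<infinity>m. of_real (E y * k y m) * cis (2 * pi * (h (y, m) \<bullet> u))) * of_real (1 / sqrt \<alpha>)"
    by (rule infsum_cmult_left')
  also have "(\<Sum>\<^sub>\<infinity>y\<in>D. \<Sum>\<^sub>\<infinity>m. of_real (E y * k y m) * cis (2 * pi * (h (y, m) \<bullet> u))) =
    (\<Sum>\<^sub>\<infinity>(y, m)\<in>D \<times> UNIV. of_real (E y * k y m) * cis (2 * pi * (h (y, m) \<bullet> u)))"
  proof (rule infsum_Sigma'_banach, rule abs_summable_summable)
    show "(\<lambda>z. norm (case z of (y, m) \<Rightarrow> of_real (E y * k y m) * cis (2 * pi * (h (y, m) \<bullet> u)))) summable_on D \<times> UNIV"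
      using sumEk by (rule summable_on_cong[THEN iffD1, rotated]) (auto simp: norm_mult nonneg)
  qed
  also have "\<dots> = (\<Sum>\<^sub>\<infinity>y\<in>dual_lattice (int_span (insert b B)).
         of_real (exp (- pi / s * (norm y)\<^sup>2)) * cis (2 * pi * (y \<bullet> u)))"
    unfolding infsum_reindex_bij_betw[OF bijD, symmetric] using E_h by (intro infsum_cong) auto
  finally show "(\<Sum>\<^sub>\<infinity>x\<in>int_span (insert b B). complex_of_real (exp (- pi * s * (norm (x + u))\<^sup>2))) =
      of_real (C / sqrt (s * (d \<bullet> d))) * (\<Sum>\<^sub>\<infinity>y\<in>dual_lattice (int_span (insert b B)).
         of_real (exp (- pi / s * (norm y)\<^sup>2)) * cis (2 * pi * (y \<bullet> u)))"
    by (simp add: \<alpha>_def)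
qed

text \<open>Each new basis vector contributes a factor 1 / (sqrt s |d|), with d its component
  orthogonal to the earlier ones. Thus \<open>c\<close> is the reciprocal covolume; only its
  positivity is recorded here, and self-duality determines it later.\<close>

theorem lattice_poisson:
  fixes B :: "'a::real_inner set"
  assumes "finite B" "independent B"
  shows "\<exists>c>0. \<forall>s>0. (\<lambda>y. exp (- pi / s * (norm y)\<^sup>2)) summable_on dual_lattice (int_span B) \<and>
    (\<forall>u\<in>span B. (\<lambda>x. exp (- pi * s * (norm (x + u))\<^sup>2)) summable_on int_span B \<and>
      (\<Sum>\<^sub>\<infinity>x\<in>int_span B. complex_of_real (exp (- pi * s * (norm (x + u))\<^sup>2))) =
      of_real (c / sqrt s ^ card B) * (\<Sum>\<^sub>\<infinity>y\<in>dual_lattice (int_span B).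
         of_real (exp (- pi / s * (norm y)\<^sup>2)) * cis (2 * pi * (y \<bullet> u))))"
  using assms
proof (induction B rule: finite_induct)
  case empty
  have "dual_lattice {0} = {0::'a}" by (auto simp: dual_lattice_def)
  then show ?case by (intro exI[of _ 1]) auto
next
  case (insert b B)
  have b: "b \<notin> span B" using insert by (simp add: independent_insert)
  have indep: "independent B" using insert.prems independent_mono by blast
  obtain p where p: "p \<in> span B" "\<And>x. x \<in> span B \<Longrightarrow> (b - p) \<bullet> x = 0"
    using orthogonal_projection_exists[OF \<open>finite B\<close>] by blast
  have "b \<noteq> p" using p b by auto
  then have dd: "(b - p) \<bullet> (b - p) > 0" by simp
  from insert.IH[OF indep] obtain c where c: "c > 0" and
    IH: "\<And>s. s > 0 \<Longrightarrow> (\<lambda>y. exp (- pi / s * (norm y)\<^sup>2)) summable_on dual_lattice (int_span B)"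
    "\<And>s u. s > 0 \<Longrightarrow> u \<in> span B \<Longrightarrow> (\<lambda>x. exp (- pi * s * (norm (x + u))\<^sup>2)) summable_on int_span B"
    "\<And>s u. s > 0 \<Longrightarrow> u \<in> span B \<Longrightarrow> (\<Sum>\<^sub>\<infinity>x\<in>int_span B. complex_of_real (exp (- pi * s * (norm (x + u))\<^sup>2))) =
      of_real (c / sqrt s ^ card B) * (\<Sum>\<^sub>\<infinity>y\<in>dual_lattice (int_span B).
         of_real (exp (- pi / s * (norm y)\<^sup>2)) * cis (2 * pi * (y \<bullet> u)))"
    by blast
  have *: "c / sqrt s ^ card B / sqrt (s * ((b - p) \<bullet> (b - p))) =
      c / sqrt ((b - p) \<bullet> (b - p)) / sqrt s ^ card (insert b B)" for s
    using insert by (simp add: real_sqrt_mult)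
  show ?case
  proof (rule exI[of _ "c / sqrt ((b - p) \<bullet> (b - p))"], intro conjI allI impI ballI)
    show "c / sqrt ((b - p) \<bullet> (b - p)) > 0" using c dd by simp
    fix s :: real assume s: "s > 0"
    then have C: "c / sqrt s ^ card B > 0" using c by simp
    note step = lattice_poisson_step[OF \<open>finite B\<close> p b s _ IH(2)[OF s] IH(1)[OF s] IH(3)[OF s] C, unfolded *]
    show "(\<lambda>y. exp (- pi / s * (norm y)\<^sup>2)) summable_on dual_lattice (int_span (insert b B))"
      by (rule step(2)[where u = 0]) (simp_all add: span_zero)
    fix u assume u: "u \<in> span (insert b B)"
    show "(\<lambda>x. exp (- pi * s * (norm (x + u))\<^sup>2)) summable_on int_span (insert b B)"
      by (rule step(1)) (simp_all add: u)
    show "(\<Sum>\<^sub>\<infinity>x\<in>int_span (insert b B). complex_of_real (exp (- pi * s * (norm (x + u))\<^sup>2))) =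
      of_real (c / sqrt ((b - p) \<bullet> (b - p)) / sqrt s ^ card (insert b B)) * (\<Sum>\<^sub>\<infinity>y\<in>dual_lattice (int_span (insert b B)).
         of_real (exp (- pi / s * (norm y)\<^sup>2)) * cis (2 * pi * (y \<bullet> u)))"
      by (rule step(3)) (simp_all add: u)
  qed
qed

section \<open>Cusp forms of small weight\<close>

lemma periodic_int:
  fixes f :: "complex \<Rightarrow> 'b"
  assumes "\<And>z. f (z + 1) = f z"
  shows "f (z + of_int n) = f z"
proof (induction n arbitrary: z rule: int_induct[where k = 0])
  case (step1 i) then show ?case using assms[of "z + of_int i"] by (simp add: add_ac)
next
  case (step2 i) then show ?case using assms[of "z + of_int (i - 1)"] by simp
qed auto

lemma Im_minus_inverse: "Im (- 1 / z) = Im z / (norm z)\<^sup>2"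
  by (simp add: Im_divide cmod_power2)

text \<open>Translation reduces the search for a maximum of the invariant function \<open>u\<close>
  to a compact box, and among the maximisers one of greatest height is taken. If it lay inside the
  unit disc, inversion would raise its height and keep \<open>u\<close>; hence it lies in the
  standard fundamental domain.\<close>

lemma modular_max_in_strip:
  fixes f :: "complex \<Rightarrow> complex"
  assumes cont: "continuous_on {z. Im z > 0} f"
    and per: "\<And>z. f (z + 1) = f z"
    and inv: "\<And>z. Im z > 0 \<Longrightarrow> norm (f (- 1 / z)) = norm z ^ (2 * j) * norm (f z)"
    and decay: "\<And>z. Im z \<ge> 4/5 \<Longrightarrow> norm (f z) \<le> K * exp (- Im z)"
    and nz: "Im z1 \<ge> 4/5" "f z1 \<noteq> 0"
  obtains z0 where "f z0 \<noteq> 0" "\<bar>Re z0\<bar> \<le> 1/2" "norm z0 \<ge> 1" "Im z0 \<ge> 4/5"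
    "\<And>z. Im z \<ge> 4/5 \<Longrightarrow> norm (f z) * Im z ^ j \<le> norm (f z0) * Im z0 ^ j"
proof -
  define u where "u z = norm (f z) * Im z ^ j" for z
  have u_shift: "u (z + of_int n) = u z" for z n
    by (simp add: u_def periodic_int[of f, OF per])
  have u_inv: "u (- 1 / z) = u z" if "Im z > 0" for z
  proof -
    have "norm z \<noteq> 0" using that by auto
    then show ?thesis unfolding u_def Im_minus_inverse inv[OF that]
      by (simp add: power_divide flip: power_mult)
  qed
  have u1: "u z1 > 0" using nz by (simp add: u_def)
  \<comment> \<open>Exponential decay beats the power of the height, so values of at least
    \<open>u z1\<close> occur only below some height \<open>Y\<close>.\<close>
  have "((\<lambda>y. K * (y ^ j / exp y)) \<longlongrightarrow> K * 0) at_top"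
    by (intro tendsto_intros tendsto_power_div_exp_0)
  then have "eventually (\<lambda>y. K * (y ^ j / exp y) < u z1) at_top"
    using u1 by (intro order_tendstoD) auto
  then obtain Y where Y: "\<And>y. y \<ge> Y \<Longrightarrow> K * (y ^ j / exp y) < u z1"
    unfolding eventually_at_top_linorder by blast
  have u_small: "u z < u z1" if "Im z \<ge> 4/5" "Im z \<ge> Y" for z
  proof -
    have "u z \<le> K * exp (- Im z) * Im z ^ j"
      unfolding u_def using decay[of z] that by (intro mult_right_mono) auto
    also have "\<dots> = K * (Im z ^ j / exp (Im z))" by (simp add: exp_minus field_simps)
    also have "\<dots> < u z1" by (rule Y) fact
    finally show ?thesis .
  qed
  define S where "S = cbox (Complex (-1/2) (4/5)) (Complex (1/2) Y)"
  have S: "z \<in> S \<longleftrightarrow> \<bar>Re z\<bar> \<le> 1/2 \<and> 4/5 \<le> Im z \<and> Im z \<le> Y" for z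
    by (auto simp: S_def in_cbox_complex_iff)
  have toS: "\<exists>w\<in>S. u w = u z \<and> Im w = Im z" if "Im z \<ge> 4/5" "u z \<ge> u z1" for z
  proof (intro bexI conjI)
    show "u (z + of_int (- round (Re z))) = u z" by (rule u_shift)
    have "Im z \<le> Y" using u_small[of z] that by linarith
    then show "z + of_int (- round (Re z)) \<in> S"
      unfolding S using that of_int_round_abs_le[of "Re z"] by (auto simp: abs_minus_commute)
  qed simp
  have contu: "continuous_on S u"
    unfolding u_def by (intro continuous_intros continuous_on_subset[OF cont]) (auto simp: S)
  have "compact S" unfolding S_def by (rule compact_cbox)
  moreover have "S \<noteq> {}" using toS[of z1] nz by auto
  ultimately obtain z2 where z2: "z2 \<in> S" "\<And>z. z \<in> S \<Longrightarrow> u z \<le> u z2"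
    using continuous_attains_sup[OF _ _ contu] by blast
  define A where "A = {z \<in> S. u z = u z2}"
  have "closed A"
    unfolding A_def by (intro continuous_closed_preimage_constant contu compact_imp_closed) fact
  then have "compact A"
    using \<open>compact S\<close> by (metis A_def compact_Int_closed inf.absorb_iff2 mem_Collect_eq subsetI)
  moreover have "z2 \<in> A" using z2 by (simp add: A_def)
  ultimately obtain z0 where z0: "z0 \<in> A" "\<And>z. z \<in> A \<Longrightarrow> Im z \<le> Im z0"
    using continuous_attains_sup[of A Im] linear_continuous_on[OF bounded_linear_Im] by blast
  have u02: "u z0 = u z2" and z0S: "z0 \<in> S" using z0 by (auto simp: A_def)
  have u12: "u z1 \<le> u z2" using toS[OF nz(1) order_refl] z2(2) by metis
  have max: "u z \<le> u z0" if "Im z \<ge> 4/5" for z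
    using toS[of z] that z2(2) u12 by (force simp: u02)
  have Im_max: "Im z \<le> Im z0" if z: "Im z \<ge> 4/5" "u z = u z0" for z
  proof -
    obtain w where "w \<in> S" "u w = u z" "Im w = Im z" using toS[of z] z u12 u02 by auto
    then show ?thesis using z0(2)[of w] z(2) by (auto simp: A_def u02)
  qed
  have "norm z0 \<ge> 1"
  proof (rule ccontr)
    assume "\<not> norm z0 \<ge> 1"
    then have "(norm z0)\<^sup>2 < 1" by (simp add: abs_square_less_1)
    moreover have pos: "Im z0 > 0" "norm z0 > 0" using z0S by (auto simp: S)
    ultimately have less: "Im z0 < Im (- 1 / z0)"
      unfolding Im_minus_inverse by (simp add: field_simps)
    then have "Im (- 1 / z0) \<le> Im z0" using z0S u_inv[OF pos(1)] by (intro Im_max) (auto simp: S)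
    with less show False by simp
  qed
  moreover have "f z0 \<noteq> 0"
  proof -
    have "u z0 > 0" using u1 u12 u02 by simp
    then show ?thesis by (auto simp: u_def)
  qed
  ultimately show ?thesis using z0S max by (intro that[of z0]) (auto simp: S u_def)
qed

text \<open>157/300 is 3.14 / 6. If pi were smaller, monotonicity would put sin (pi / 6) = 1/2 below
  the sine of 157/300, which the Taylor bound shows to be less than 1/2.\<close>

lemma pi_ge_314: "pi \<ge> 314 / 100"
proof (rule ccontr)
  assume "\<not> ?thesis"
  then have "sin (pi / 6) \<le> sin (157 / 300)"
    using pi_ge_two by (intro sin_monotone_2pi_le) auto
  moreover have "\<bar>sin (157 / 300 :: real) - (\<Sum>m<7. sin_coeff m * (157 / 300) ^ m)\<bar> \<le> inverse (fact 7) * \<bar>157 / 300\<bar> ^ 7"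
    by (rule Maclaurin_sin_bound)
  then have "sin (157 / 300 :: real) < 1 / 2"
  proof -
    have "(\<Sum>m<7. f m) = f 0 + f 1 + f 2 + f 3 + f 4 + f 5 + f 6" for f :: "nat \<Rightarrow> real"
      by (simp add: eval_nat_numeral)
    note bound = \<open>\<bar>sin (157 / 300 :: real) - (\<Sum>m<7. sin_coeff m * (157 / 300) ^ m)\<bar> \<le> inverse (fact 7) * \<bar>157 / 300\<bar> ^ 7\<close>[unfolded this]
    show ?thesis using abs_le_D1[OF bound] by (simp add: sin_coeff_def fact_numeral power_divide)
  qed
  ultimately show False by (simp add: sin_30)
qed

text \<open>The logarithmic derivative of exp (8 pi y) / y^j is 8 pi - j / y, which is positive from
  \<open>y1\<close> on, so the expression increases strictly. The inequality t <= exp (t - 1) at t =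
  y0 / y1 replaces the calculus.\<close>

lemma modular_crude_bound:
  fixes y0 y1 M :: real
  assumes y: "0 < y1" "y1 < y0" "real j < 8 * pi * y1" and M: "M > 0"
    and le: "M / y0 ^ j * exp (8 * pi * y0) \<le> M / y1 ^ j * exp (8 * pi * y1)"
  shows False
proof -
  have "y0 > 0" using y by simp
  have "(y0 / y1) ^ j \<le> exp (y0 / y1 - 1) ^ j"
    using y exp_ge_add_one_self[of "y0 / y1 - 1"] by (intro power_mono) auto
  also have "\<dots> = exp (real j * (y0 - y1) / y1)"
    using y by (simp add: diff_divide_distrib algebra_simps flip: exp_of_nat_mult)
  also have "\<dots> < exp (8 * pi * (y0 - y1))"
    using y mult_strict_right_mono[OF y(3), of "y0 - y1"] by (simp add: pos_divide_less_eq mult_ac)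
  finally have *: "(y0 / y1) ^ j < exp (8 * pi * y0) / exp (8 * pi * y1)"
    by (simp add: right_diff_distrib exp_diff)
  have "exp (8 * pi * y0) / y0 ^ j \<le> exp (8 * pi * y1) / y1 ^ j"
  proof -
    have "M * (exp (8 * pi * y0) / y0 ^ j) \<le> M * (exp (8 * pi * y1) / y1 ^ j)" using le by simp
    then show ?thesis using M by (simp only: mult_le_cancel_left_pos)
  qed
  then have "exp (8 * pi * y0) / exp (8 * pi * y1) \<le> (y0 / y1) ^ j"
    using y \<open>y0 > 0\<close> by (simp add: field_simps power_divide)
  with * show False by simp
qed

text \<open>
  The numerical heart of the Blaschke factor argument in \<open>cusp_form_vanishes\<close>: \<open>R\<close>, \<open>p\<close> and \<open>a\<close> are the
  moduli of \<open>exp (2 * pi * \<i> * z)\<close> at height \<open>4/5\<close>, at the maximum, and at the corner \<open>exp (\<i> * pi / 3)\<close>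
  of the fundamental domain.
\<close>

lemma modular_blaschke_ineq:
  fixes y0 C :: real
  assumes y0: "sqrt 3 / 2 \<le> y0" "y0 \<le> 23/25" and j: "j \<le> 23" and C: "C \<le> -1/2" "-1 \<le> C"
  defines "R \<equiv> exp (- 8/5 * pi)" and "p \<equiv> exp (- 2 * pi * y0)" and "a \<equiv> exp (- pi * sqrt 3)"
  shows "((y0 / (4/5)) ^ j * exp (- 8 * pi * (y0 - 4/5)))\<^sup>2 * (R\<^sup>2 * (p\<^sup>2 + a\<^sup>2 + 2 * a * p * C))
       < (R\<^sup>2)\<^sup>2 + a\<^sup>2 * p\<^sup>2 + 2 * R\<^sup>2 * a * p * C"
proof -
  have s3: "sqrt 3 \<ge> 1732 / 1000" by (rule real_le_rsqrt) (simp add: power2_eq_square)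
  have y0': "y0 \<ge> 866 / 1000" using s3 y0 by simp
  define g where "g = (y0 / (4/5)) ^ j * exp (- 8 * pi * (y0 - 4/5))"
  \<comment> \<open>The tangent to the exponential at height 23/25 turns the power of the height
    into an exponential: (23/25) / (4/5) = 115/100, and 23 / (23/25) = 25 nearly cancels 8
    pi.\<close>
  have "g\<^sup>2 \<le> 8/5"
  proof -
    have "y0 / (4/5) \<le> 115/100 * exp (y0 / (23/25) - 1)"
      using exp_ge_add_one_self[of "y0 / (23/25) - 1"] by simp
    also have "115/100 \<le> exp (14/100 :: real)"
    proof -
      have "115/100 \<le> (1 + 14/6400 :: real) ^ 64" by (simp add: power_divide)
      also have "\<dots> \<le> exp (14/6400) ^ 64" by (intro power_mono exp_ge_add_one_self) auto
      finally show ?thesis by (simp flip: exp_of_nat_mult)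
    qed
    finally have le: "y0 / (4/5) \<le> exp (14/100) * exp (y0 / (23/25) - 1)" by simp
    have "(y0 / (4/5)) ^ j \<le> (y0 / (4/5)) ^ 23"
      using y0' j by (intro power_increasing) auto
    also have "\<dots> \<le> (exp (14/100) * exp (y0 / (23/25) - 1)) ^ 23"
      using y0' by (intro power_mono le) auto
    also have "\<dots> = exp (322/100 + 25 * y0 - 23)"
      by (simp add: power_mult_distrib flip: exp_of_nat_mult exp_add)
    finally have "g \<le> exp (322/100 + 25 * y0 - 23) * exp (- 8 * pi * (y0 - 4/5))"
      unfolding g_def by (intro mult_right_mono) auto
    also have "\<dots> = exp (322/100 + 25 * y0 - 23 - 8 * pi * (y0 - 4/5))" by (simp flip: exp_add)
    also have "\<dots> \<le> exp (2125/10000)"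
    proof -
      have "8 * (314/100) * (y0 - 4/5) \<le> 8 * pi * (y0 - 4/5)"
        using y0' pi_ge_314 by (intro mult_right_mono) auto
      then show ?thesis using y0' by simp
    qed
    finally have "g \<le> exp (2125/10000)" .
    then have "g\<^sup>2 \<le> (exp (2125/10000))\<^sup>2" using y0' by (intro power_mono) (auto simp: g_def)
    also have "\<dots> = (exp (2125/20000)) ^ 4" by (simp flip: exp_of_nat_mult)
    also have "exp (2125/20000) \<le> 1 / (1 - 2125/20000 :: real)"
      using exp_ge_add_one_self[of "- 2125/20000 :: real"] by (simp add: exp_minus field_simps)
    then have "(exp (2125/20000)) ^ 4 \<le> (1 / (1 - 2125/20000 :: real)) ^ 4" by (intro power_mono) auto
    also have "\<dots> \<le> 8/5" by (simp add: power_divide)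
    finally show ?thesis .
  qed
  have R: "R > 0" and p: "p > 0" and a: "a > 0" by (simp_all add: R_def p_def a_def)
  \<comment> \<open>Division by \<open>R\<close> reduces the claim to a Blaschke estimate on the
    unit disc, with moduli \<open>A\<close> for the zero and \<open>P\<close> for the
    maximum.\<close>
  define A where "A = a / R"
  define P where "P = p / R"
  have P: "0 < P" "P \<le> A"
  proof -
    have "p \<le> a" unfolding p_def a_def using y0 by simp
    then show "P \<le> A" using R by (simp add: P_def A_def divide_right_mono)
  qed (use R p in \<open>simp add: P_def\<close>)
  have A: "A\<^sup>2 \<le> 45/100"
  proof -
    have "A\<^sup>2 = exp (- 2 * pi * (sqrt 3 - 8/5))"
      by (simp add: A_def a_def R_def power2_eq_square algebra_simps flip: exp_diff exp_add)
    also have "\<dots> \<le> exp (- (82/100))"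
    proof -
      have "314/100 * (132/1000) \<le> pi * (sqrt 3 - 8/5)"
        using pi_ge_314 s3 by (intro mult_mono) auto
      then show ?thesis by simp
    qed
    also have "\<dots> \<le> 45/100"
    proof -
      have "100/45 \<le> (1 + 82/3200 :: real) ^ 32" by (simp add: power_divide)
      also have "\<dots> \<le> exp (82/3200) ^ 32" by (intro power_mono exp_ge_add_one_self) auto
      finally show ?thesis by (simp add: exp_minus field_simps flip: exp_of_nat_mult)
    qed
    finally show ?thesis .
  qed
  have "A \<le> 1" using A abs_square_le_1[of A] by simp
  have "g\<^sup>2 * (P\<^sup>2 + A\<^sup>2 + 2 * A * P * C) < 1 + A\<^sup>2 * P\<^sup>2 + 2 * A * P * C"
  proof -
    have AP: "0 \<le> A * P" "P\<^sup>2 \<le> A * P" "P\<^sup>2 \<le> A\<^sup>2" using P by (auto simp: power2_eq_square intro: mult_mono)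
    have "A * P * C \<ge> A * P * (-1)" using AP C by (intro mult_left_mono) auto
    then have "P\<^sup>2 + A\<^sup>2 + 2 * A * P * C \<ge> (P - A)\<^sup>2" by (simp add: power2_eq_square algebra_simps)
    then have "P\<^sup>2 + A\<^sup>2 + 2 * A * P * C \<ge> 0" using zero_le_power2[of "P - A"] by linarith
    then have "g\<^sup>2 * (P\<^sup>2 + A\<^sup>2 + 2 * A * P * C) \<le> 8/5 * (P\<^sup>2 + A\<^sup>2 + 2 * A * P * C)"
      using \<open>g\<^sup>2 \<le> 8/5\<close> by (rule mult_right_mono[rotated])
    \<comment> \<open>The excess 3/5 of the factor 8/5 multiplies 2 A P C, and C <= -1/2 turns it
      into a gain of at least 6/10 A P, which then absorbs 3/5 P^2.\<close>
    also have "\<dots> \<le> 8/5 * (P\<^sup>2 + A\<^sup>2) + 2 * A * P * C - 6/10 * (A * P)"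
    proof -
      have "A * P * C \<le> A * P * (-1/2)" using AP C by (intro mult_left_mono) auto
      then show ?thesis by (simp add: algebra_simps)
    qed
    also have "\<dots> \<le> P\<^sup>2 + 8/5 * A\<^sup>2 + 2 * A * P * C" 
    proof -
      have "8/5 * (x + y) + z - 6/10 * w \<le> x + 8/5 * y + z" if "x \<le> w" for x y z w :: real
        using that by (simp add: distrib_left)
      from this[OF AP(2)] show ?thesis .
    qed
    also have "\<dots> < 1 + A\<^sup>2 * P\<^sup>2 + 2 * A * P * C"
    proof -
      have "(1 - A\<^sup>2) * P\<^sup>2 \<le> (1 - A\<^sup>2) * A\<^sup>2" using A AP by (intro mult_left_mono) auto
      moreover have "(1 - A\<^sup>2) * A\<^sup>2 + 8/5 * A\<^sup>2 < 1"
      proof -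
        have "(45/100 - A\<^sup>2) * (26/10 - 45/100 - A\<^sup>2) \<ge> 0" using A by (intro mult_nonneg_nonneg) auto
        then show ?thesis by (simp add: algebra_simps)
      qed
      ultimately show ?thesis by (simp add: algebra_simps)
    qed
    finally show ?thesis .
  qed
  then have "(R\<^sup>2)\<^sup>2 * (g\<^sup>2 * (P\<^sup>2 + A\<^sup>2 + 2 * A * P * C)) < (R\<^sup>2)\<^sup>2 * (1 + A\<^sup>2 * P\<^sup>2 + 2 * A * P * C)"
    using R by (intro mult_strict_left_mono) auto
  moreover have "p = P * R" "a = A * R" using R by (simp_all add: P_def A_def)
  ultimately show ?thesis unfolding g_def[symmetric] by (simp add: power2_eq_square algebra_simps)
qed


definition qexp :: "complex \<Rightarrow> complex" where
  "qexp z = exp (2 * pi * \<i> * z)"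

lemma norm_qexp: "norm (qexp z) = exp (- 2 * pi * Im z)"
  by (simp add: qexp_def)

lemma qexp_plus_1: "qexp (z + 1) = qexp z"
  by (simp add: qexp_def distrib_left exp_add)

lemma qexp_surj:
  assumes "q \<noteq> 0"
  obtains z where "qexp z = q"
proof
  show "qexp (Ln q / (2 * pi * \<i>)) = q" using assms by (simp add: qexp_def)
qed

lemma Re_qexp: "Re (qexp z) = exp (- 2 * pi * Im z) * cos (2 * pi * Re z)"
  by (simp add: qexp_def Re_exp)

lemma norm_diff_real_sq: "(norm (z + of_real a))\<^sup>2 = (norm z)\<^sup>2 + a\<^sup>2 + 2 * a * Re z"
  unfolding cmod_power2 by (simp add: power2_eq_square algebra_simps)

text \<open>
  The weight is \<open>2 * j\<close>. The invariant function \<open>\<bar>f z\<bar> * Im z ^ j\<close> attains its maximum at a point of height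
  \<open>y0 \<ge> sqrt 3 / 2\<close>. The maximum principle for \<open>f\<close> divided by the fourth power of \<open>q = exp (2 * pi * \<i> * z)\<close>
  forces \<open>y0 \<le> j / (8 * pi)\<close>, which is impossible for \<open>j = 21\<close>. For the other weights it leaves a small gap,
  but then \<open>f\<close> also vanishes at \<open>exp (\<i> * pi / 3)\<close>, since \<open>6\<close> does not divide the weight, and dividing out
  this zero by a Blaschke factor closes the gap.
\<close>

theorem cusp_form_vanishes:
  fixes c :: "nat \<Rightarrow> complex"
  assumes summ: "\<And>q. norm q < 1 \<Longrightarrow> summable (\<lambda>n. c n * q ^ n)"
    and c0: "\<And>n. n < 4 \<Longrightarrow> c n = 0"
    and j: "19 \<le> j" "j \<le> 23"
    and modular: "\<And>s::real. s > 0 \<Longrightarrow>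
      (\<Sum>n. c n * of_real (exp (- 2 * pi / s)) ^ n) = (\<i> * of_real s) ^ (2 * j) * (\<Sum>n. c n * of_real (exp (- 2 * pi * s)) ^ n)"
  shows "c n = 0"
proof -
  define F where "F q = (\<Sum>n. c n * q ^ n)" for q
  \<comment> \<open>\<open>G\<close> is the form divided by \<open>q ^ 4\<close>; it is holomorphic
    at the cusp as well, so the maximum principle applies on whole discs.\<close>
  define G where "G q = (\<Sum>n. c (n + 4) * q ^ n)" for q
  have F_sums: "(\<lambda>n. c n * q ^ n) sums F q" if "norm q < 1" for q
    unfolding F_def using summ[OF that] by (rule summable_sums)
  have summG: "summable (\<lambda>n. c (n + 4) * q ^ n)" if "norm q < 1" for q
  proof (cases "q = 0")
    case False
    have "summable (\<lambda>n. c (n + 4) * q ^ (n + 4))" using summ[OF that] by (subst summable_iff_shift)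
    then have "summable (\<lambda>n. c (n + 4) * q ^ (n + 4) * (1 / q ^ 4))" by (rule summable_mult2)
    then show ?thesis using False by (simp add: power_add)
  qed (simp add: summable_0_powser)
  have F_G: "F q = q ^ 4 * G q" if "norm q < 1" for q
  proof -
    have "F q = (\<Sum>n. c (n + 4) * q ^ (n + 4)) + (\<Sum>n<4. c n * q ^ n)"
      unfolding F_def by (rule suminf_split_initial_segment[OF summ[OF that]])
    also have "(\<Sum>n<4. c n * q ^ n) = 0" using c0 by (intro sum.neutral) auto
    also have "(\<Sum>n. c (n + 4) * q ^ (n + 4)) = (\<Sum>n. q ^ 4 * (c (n + 4) * q ^ n))"
      by (simp add: power_add mult_ac)
    also have "\<dots> = q ^ 4 * G q" unfolding G_def by (rule suminf_mult[OF summG[OF that]])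
    finally show ?thesis by simp
  qed
  have holF: "F holomorphic_on ball 0 1"
    by (rule power_series_holomorphic[where a = c]) (use F_sums in auto)
  have holG: "G holomorphic_on ball 0 1"
    by (rule power_series_holomorphic[where a = "\<lambda>n. c (n + 4)"]) (use summable_sums[OF summG] in \<open>auto simp: G_def\<close>)
  define f where "f z = F (qexp z)" for z
  have q_in: "norm (qexp z) < 1" if "Im z > 0" for z
    using that by (simp add: norm_qexp)
  have holf: "f holomorphic_on {z. Im z > 0}"
    unfolding f_def by (rule holomorphic_on_compose_gen[unfolded o_def, OF _ holF])
      (auto simp: qexp_def[abs_def] q_in[unfolded qexp_def] intro!: holomorphic_intros)
  have f_per: "f (z + 1) = f z" for z by (simp add: f_def qexp_plus_1)
  have f_inv: "f (- 1 / z) = z ^ (2 * j) * f z" if "Im z > 0" for z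
  proof -
    have Im_inv: "Im (- 1 / w) > 0" if "Im w > 0" for w
      unfolding Im_minus_inverse using that by (intro divide_pos_pos) auto
    define U where "U = {z. Re z = 0 \<and> Im z > 0}"
    \<comment> \<open>The hypothesis is the case of imaginary \<open>z\<close>. Both terms are
      holomorphic, and the imaginary axis accumulates at the imaginary unit.\<close>
    have "f (- 1 / z) - z ^ (2 * j) * f z = 0"
    proof (rule analytic_continuation[of "\<lambda>z. f (- 1 / z) - z ^ (2 * j) * f z" "{z. Im z > 0}" U \<i>])
      have "(\<lambda>z. f (- 1 / z)) holomorphic_on {z. Im z > 0}"
        by (rule holomorphic_on_compose_gen[unfolded o_def, OF _ holf])
          (use Im_inv in \<open>auto intro!: holomorphic_intros\<close>)
      then show "(\<lambda>z. f (- 1 / z) - z ^ (2 * j) * f z) holomorphic_on {z. Im z > 0}"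
        by (intro holomorphic_intros holf)
      show "open {z. Im z > 0}" by (rule open_halfspace_Im_gt)
      show "connected {z. Im z > 0}" by (intro convex_connected convex_halfspace_Im_gt)
      show "\<i> islimpt U"
        unfolding islimpt_approachable
      proof (intro allI impI)
        fix e :: real assume "e > 0"
        then show "\<exists>x'\<in>U. x' \<noteq> \<i> \<and> dist x' \<i> < e"
          by (intro bexI[of _ "Complex 0 (1 + e / 2)"]) (auto simp: U_def dist_norm cmod_def complex_eq_iff)
      qed
      fix z assume "z \<in> U"
      then obtain s where s: "z = \<i> * of_real s" "s > 0"
        by (intro that[of "Im z"]) (auto simp: U_def complex_eq_iff)
      have "qexp (- 1 / z) = of_real (exp (- 2 * pi / s))" "qexp z = of_real (exp (- 2 * pi * s))"
        using s by (auto simp: qexp_def field_simps simp flip: exp_of_real)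
      then show "f (- 1 / z) - z ^ (2 * j) * f z = 0"
        using modular[OF s(2)] by (simp add: f_def F_def s(1))
    qed (use that in \<open>auto simp: U_def\<close>)
    then show ?thesis by simp
  qed
  have cball_sub: "cball (0::complex) (exp (- 2 * pi * y)) \<subseteq> ball 0 1" if "y > 0" for y
  proof -
    have "exp (- 2 * pi * y) < 1" using that by simp
    then show "cball (0::complex) (exp (- 2 * pi * y)) \<subseteq> ball 0 1"
      by (auto simp del: one_less_exp_iff exp_less_one_iff)
  qed
  \<comment> \<open>The height 4/5 lies below sqrt 3 / 2, the least height in the fundamental
    domain, so the maximum found at \<open>z0\<close> corresponds to an interior point of the disc
    on whose boundary \<open>G\<close> gets bounded.\<close>
  have f_zero: "f z = 0" if z: "Im z \<ge> 4/5" for z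
  proof (rule ccontr)
    assume nz: "f z \<noteq> 0"
    obtain K where K: "\<And>q. norm q \<le> exp (- 2 * pi * (4/5)) \<Longrightarrow> norm (G q) \<le> K" "K > 0"
    proof -
      have "compact (G ` cball 0 (exp (- 2 * pi * (4/5))))"
        by (intro compact_continuous_image holomorphic_on_imp_continuous_on holomorphic_on_subset[OF holG] cball_sub) auto
      then obtain b where "b > 0" "\<forall>y\<in>G ` cball 0 (exp (- 2 * pi * (4/5))). norm y \<le> b"
        using bounded_pos compact_imp_bounded by blast
      then show ?thesis by (intro that[of b]) auto
    qed
    have decay: "norm (f z) \<le> K * exp (- Im z)" if "Im z \<ge> 4/5" for z
    proof -
      have "norm (f z) = norm (qexp z) ^ 4 * norm (G (qexp z))"
        unfolding f_def using that by (subst F_G) (auto simp: q_in norm_mult norm_power)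
      also have "\<dots> \<le> exp (- Im z) * K"
      proof (intro mult_mono)
        show "norm (G (qexp z)) \<le> K" using that by (intro K) (simp add: norm_qexp)
        have "Im z * 1 \<le> Im z * (8 * pi)" using that pi_ge_two by (intro mult_left_mono) auto
        then show "norm (qexp z) ^ 4 \<le> exp (- Im z)"
          unfolding norm_qexp by (simp add: mult_ac flip: exp_of_nat_mult)
      qed auto
      finally show ?thesis by (simp add: mult.commute)
    qed
    have contf: "continuous_on {z. Im z > 0} f" using holf by (rule holomorphic_on_imp_continuous_on)
    have norm_inv: "norm (f (- 1 / z)) = norm z ^ (2 * j) * norm (f z)" if "Im z > 0" for z
      unfolding f_inv[OF that] by (simp add: norm_mult norm_power)
    obtain z0 where z0: "f z0 \<noteq> 0" "\<bar>Re z0\<bar> \<le> 1/2" "norm z0 \<ge> 1" "Im z0 \<ge> 4/5"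
      and max: "\<And>z. Im z \<ge> 4/5 \<Longrightarrow> norm (f z) * Im z ^ j \<le> norm (f z0) * Im z0 ^ j"
      by (rule modular_max_in_strip[OF contf f_per norm_inv decay z nz], assumption+, rule that)
    define y0 where "y0 = Im z0"
    define M where "M = norm (f z0) * y0 ^ j"
    have y0: "y0 \<ge> 4/5" using z0 by (simp add: y0_def)
    have M: "M > 0" using z0 by (simp add: M_def y0_def)
    have Re_Im: "(Re z0)\<^sup>2 + y0\<^sup>2 \<ge> 1"
      using z0(3) by (simp add: y0_def flip: cmod_power2)
    have "(Re z0)\<^sup>2 \<le> (1/2)\<^sup>2" using z0(2) abs_le_square_iff[of "Re z0" "1/2"] by simp
    with Re_Im have y0_sq: "y0\<^sup>2 \<ge> 3/4" by (simp add: power_divide)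
    have y0_ge: "sqrt 3 / 2 \<le> y0"
      using y0_sq y0 by (intro power2_le_imp_le[of "sqrt 3 / 2"]) (auto simp: power_divide)
    have bound: "norm (G q) \<le> M / y1 ^ j * exp (8 * pi * y1)" if "norm q = exp (- 2 * pi * y1)" "y1 \<ge> 4/5" for q y1
    proof -
      have "q \<noteq> 0" using that by auto
      then obtain w where w: "qexp w = q" by (rule qexp_surj)
      have "Im w = y1" using that w norm_qexp[of w] by simp
      then have "norm (f w) * y1 ^ j \<le> M" using max[of w] that by (simp add: M_def y0_def)
      moreover have "norm (f w) = exp (- 8 * pi * y1) * norm (G q)"
        unfolding f_def w using that by (subst F_G) (auto simp: norm_mult norm_power simp flip: exp_of_nat_mult)
      ultimately have "norm (G q) * (y1 ^ j * exp (- 8 * pi * y1)) \<le> M" by (simp add: mult_ac)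
      then show ?thesis using that by (simp add: exp_minus field_simps)
    qed
    define q0 where "q0 = qexp z0"
    have nq0: "norm q0 = exp (- 2 * pi * y0)" by (simp add: q0_def norm_qexp y0_def)
    have Gq0: "norm (G q0) = M / y0 ^ j * exp (8 * pi * y0)"
    proof -
      have "norm (f z0) = exp (- 8 * pi * y0) * norm (G q0)"
        unfolding f_def q0_def[symmetric] using y0 
        by (subst F_G) (auto simp: nq0 norm_mult norm_power simp flip: exp_of_nat_mult)
      then show ?thesis using y0 by (simp add: M_def exp_minus field_simps)
    qed
    \<comment> \<open>If \<open>y0\<close> exceeded \<open>y1\<close>, then \<open>q0\<close> would
      lie inside the circle of height \<open>y1\<close>, and the maximum principle for
      \<open>G\<close> would contradict the strict growth shown in
      \<open>modular_crude_bound\<close>.\<close>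
    have crude: "y0 \<le> y1" if "y1 \<ge> 4/5" "real j < 8 * pi * y1" for y1
    proof (rule ccontr)
      assume less: "\<not> y0 \<le> y1"
      have "norm (G q0) \<le> M / y1 ^ j * exp (8 * pi * y1)"
      proof (rule maximum_modulus_frontier[of G "cball 0 (exp (- 2 * pi * y1))"])
        show "G holomorphic_on interior (cball 0 (exp (- 2 * pi * y1)))"
          using that cball_sub[of y1] by (intro holomorphic_on_subset[OF holG]) auto
        show "continuous_on (closure (cball 0 (exp (- 2 * pi * y1)))) G"
          using that cball_sub[of y1] by (intro holomorphic_on_imp_continuous_on holomorphic_on_subset[OF holG]) auto
        show "q0 \<in> cball 0 (exp (- 2 * pi * y1))" using less by (simp add: nq0)
        show "norm (G q) \<le> M / y1 ^ j * exp (8 * pi * y1)" if "q \<in> frontier (cball 0 (exp (- 2 * pi * y1)))" for q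
          using that \<open>y1 \<ge> 4/5\<close> by (intro bound) (auto simp: dist_norm)
      qed simp
      then show False
        using modular_crude_bound[of y1 y0 j M] that less M unfolding Gq0 by auto
    qed
    have s3: "sqrt 3 \<ge> 1732 / 1000" by (rule real_le_rsqrt) (simp add: power2_eq_square)
    \<comment> \<open>Weight 42 is divisible by 6, so the corner gives no zero; but 21 / (8 pi) <
      85/100 already lies below sqrt 3 / 2.\<close>
    have j21: "j \<noteq> 21"
    proof
      assume "j = 21"
      then have "y0 \<le> 85/100" using pi_ge_314 by (intro crude) auto
      with y0_ge s3 show False by simp
    qed
    \<comment> \<open>For j at most 23 the height 23/25 qualifies because 8 pi exceeds 25.\<close>
    have y0_le: "y0 \<le> 23/25" using pi_ge_314 j by (intro crude) auto
    \<comment> \<open>Modulus at least 1 and height at most 23/25 force |Re z0| into [1/3, 1/2]. So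
      \<open>q0\<close> is close in direction to the negative real axis, where the zero coming from
      the corner lies.\<close>
    have third: "1/3 \<le> \<bar>Re z0\<bar>"
    proof (rule power2_le_imp_le)
      have "y0\<^sup>2 \<le> (23/25)\<^sup>2" using y0 y0_le by (intro power_mono) auto
      with Re_Im show "(1/3)\<^sup>2 \<le> \<bar>Re z0\<bar>\<^sup>2" by (simp add: power_divide)
    qed simp
    define C where "C = cos (2 * pi * Re z0)"
    have C: "C \<le> -1/2" "-1 \<le> C"
    proof -
      have "C = cos (2 * pi * \<bar>Re z0\<bar>)" by (simp add: C_def abs_if)
      also have "\<dots> \<le> cos (2 * pi / 3)"
        using third z0(2) by (intro cos_monotone_0_pi_le) auto
      also have "cos (2 * pi / 3) = - cos (pi / 3)"
        using cos_pi_minus[of "pi / 3"] by (simp add: field_simps)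
      finally show "C \<le> -1/2" by (simp add: cos_60)
    qed (simp add: C_def)
    define \<rho> where "\<rho> = Complex (1/2) (sqrt 3 / 2)"
    have \<rho>2: "\<rho>\<^sup>2 = \<rho> - 1" by (simp add: \<rho>_def complex_eq_iff power2_eq_square)
    have \<rho>3: "\<rho> ^ 3 = - 1"
      by (simp add: power3_eq_cube) (simp add: \<rho>2[unfolded power2_eq_square] left_diff_distrib)
    have \<rho>0: "\<rho> \<noteq> 0" "Im \<rho> > 0" "\<rho> \<noteq> 2" by (auto simp: \<rho>_def complex_eq_iff)
    \<comment> \<open>Inversion sends the primitive sixth root of unity \<open>\<rho>\<close> to its
      translate \<open>\<rho> - 1\<close>, so the value at \<open>\<rho>\<close> is multiplied by
      \<open>\<rho> ^ (2 * j)\<close>, which is not 1.\<close>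
    have "f \<rho> = 0"
    proof -
      have "- 1 / \<rho> = \<rho> - 1" using \<rho>0 \<rho>2 \<rho>3 by (simp add: field_simps power2_eq_square)
      moreover have "f (\<rho> - 1) = f \<rho>" using f_per[of "\<rho> - 1"] by simp
      ultimately have "(1 - \<rho> ^ (2 * j)) * f \<rho> = 0"
        using f_inv[OF \<rho>0(2)] by (simp add: left_diff_distrib)
      moreover have "\<rho> ^ (2 * j) \<noteq> 1"
      proof -
        have e: "\<rho> ^ (3 * m + r) = (- 1) ^ m * \<rho> ^ r" for m r by (simp add: power_add power_mult \<rho>3)
        have ne: "- \<rho> \<noteq> 1" "\<rho> - 1 \<noteq> 1" using \<rho>0 by (auto simp: \<rho>_def complex_eq_iff)
        from j j21 consider "j = 19" | "j = 20" | "j = 22" | "j = 23" by linarith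
        then show ?thesis
        proof cases
          case 1 then show ?thesis using e[of 12 2] ne by (simp add: \<rho>2)
        next
          case 2 then show ?thesis using e[of 13 1] ne by simp
        next
          case 3 then show ?thesis using e[of 14 2] ne by (simp add: \<rho>2)
        next
          case 4 then show ?thesis using e[of 15 1] ne by simp
        qed
      qed
      ultimately show ?thesis by simp
    qed
    define a where "a = exp (- pi * sqrt 3)"
    have q\<rho>: "qexp \<rho> = - of_real a"
    proof -
      have "2 * pi * \<i> * \<rho> = of_real (- pi * sqrt 3) + \<i> * of_real pi"
        by (simp add: \<rho>_def complex_eq_iff)
      then show ?thesis unfolding qexp_def a_def by (simp only: exp_add) (simp flip: exp_of_real)
    qed
    have a: "a > 0" "a < 1" by (simp_all add: a_def)
    have Ga: "G (- of_real a) = 0"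
      using \<open>f \<rho> = 0\<close> F_G[of "- of_real a"] a by (auto simp: f_def q\<rho>)
    define R where "R = exp (- 8/5 * pi)"
    have R: "R > 0" "R = exp (- 2 * pi * (4/5))" by (simp_all add: R_def mult_ac)
    define H where "H q = (if q = - of_real a then deriv G (- of_real a) else (G q - G (- of_real a)) / (q - (- of_real a)))" for q
    have holH: "H holomorphic_on ball 0 1"
      unfolding H_def by (rule pole_lemma_open[OF holG]) simp
    have GH: "G q = H q * (q + of_real a)" for q
    proof (cases "q = - of_real a")
      case False
      then have "q + of_real a \<noteq> 0" by (simp add: eq_neg_iff_add_eq_0)
      then show ?thesis using False by (simp add: H_def Ga)
    qed (simp add: Ga)
    \<comment> \<open>On |q| = R the new factor has modulus R |q + a|, so there \<open>h\<close>
      satisfies the bound for \<open>G\<close> times \<open>R\<close>. At \<open>q0\<close> the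
      exchanged factors have unequal size, and that is the gain.\<close>
    define h where "h q = H q * (of_real (R\<^sup>2) + of_real a * q)" for q
    have holh: "h holomorphic_on ball 0 1" unfolding h_def by (intro holomorphic_intros holH)
    define B where "B = M / (4/5) ^ j * exp (8 * pi * (4/5)) * R"
    have "norm (h q0) \<le> B"
    proof (rule maximum_modulus_frontier[of h "cball 0 R"])
      show "h holomorphic_on interior (cball 0 R)"
        using cball_sub[of "4/5"] by (intro holomorphic_on_subset[OF holh]) (auto simp: R)
      show "continuous_on (closure (cball 0 R)) h"
        using cball_sub[of "4/5"] by (intro holomorphic_on_imp_continuous_on holomorphic_on_subset[OF holh]) (auto simp: R)
      show "q0 \<in> cball 0 R" using y0 by (simp add: nq0 R)
      fix q :: complex assume "q \<in> frontier (cball 0 R)"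
      then have q: "norm q = R" using R by (simp add: dist_norm)
      have "of_real (R\<^sup>2) + of_real a * q = q * cnj (q + of_real a)"
        using q by (simp add: complex_norm_square[symmetric] distrib_left flip: q)
      then have "norm (of_real (R\<^sup>2) + of_real a * q) = R * norm (q + of_real a)"
        by (simp only: norm_mult complex_mod_cnj q)
      then have "norm (h q) = norm (G q) * R" by (simp add: h_def GH norm_mult)
      also have "\<dots> \<le> B" unfolding B_def using R q by (intro mult_right_mono bound) auto
      finally show "norm (h q) \<le> B" .
    qed simp
    define T where "T = norm (of_real (R\<^sup>2) + of_real a * q0)"
    define N where "N = norm (q0 + of_real a)"
    have "norm (G q0) * T = norm (h q0) * N"
      by (simp add: h_def GH T_def N_def norm_mult)
    also have "\<dots> \<le> B * N" using \<open>norm (h q0) \<le> B\<close> by (intro mult_right_mono) (auto simp: N_def)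
    finally have *: "M / y0 ^ j * exp (8 * pi * y0) * T \<le> M * (exp (8 * pi * (4/5)) / (4/5) ^ j * (R * N))"
      unfolding Gq0 B_def by (simp add: mult_ac)
    have "T \<le> (y0 / (4/5)) ^ j * exp (- 8 * pi * (y0 - 4/5)) * (R * N)"
    proof -
      have "M * (exp (8 * pi * y0) / y0 ^ j * T) \<le> M * (exp (8 * pi * (4/5)) / (4/5) ^ j * (R * N))"
        using * by simp
      then have "exp (8 * pi * y0) / y0 ^ j * T \<le> exp (8 * pi * (4/5)) / (4/5) ^ j * (R * N)"
        using M by (simp only: mult_le_cancel_left_pos)
      then have "y0 ^ j * exp (- 8 * pi * y0) * (exp (8 * pi * y0) / y0 ^ j * T) \<le> y0 ^ j * exp (- 8 * pi * y0) * (exp (8 * pi * (4/5)) / (4/5) ^ j * (R * N))"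
        using y0 by (intro mult_left_mono) auto
      also have "y0 ^ j * exp (- 8 * pi * y0) * (exp (8 * pi * y0) / y0 ^ j * T) = T"
        using y0 by (simp add: exp_minus field_simps)
      also have "y0 ^ j * exp (- 8 * pi * y0) * (exp (8 * pi * (4/5)) / (4/5) ^ j * (R * N)) =
        (y0 / (4/5)) ^ j * (exp (- 8 * pi * y0) * exp (8 * pi * (4/5))) * (R * N)"
        by (simp only: power_divide times_divide_eq_left times_divide_eq_right mult_ac)
      also have "exp (- 8 * pi * y0) * exp (8 * pi * (4/5)) = exp (- 8 * pi * (y0 - 4/5))"
        by (simp add: right_diff_distrib flip: exp_add)
      finally show ?thesis .
    qed
    then have "T\<^sup>2 \<le> ((y0 / (4/5)) ^ j * exp (- 8 * pi * (y0 - 4/5)) * (R * N))\<^sup>2"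
      by (rule power_mono) (simp add: T_def)
    also have "\<dots> = ((y0 / (4/5)) ^ j * exp (- 8 * pi * (y0 - 4/5)))\<^sup>2 * (R\<^sup>2 * N\<^sup>2)"
      by (simp only: power_mult_distrib)
    also have "N\<^sup>2 = (exp (- 2 * pi * y0))\<^sup>2 + a\<^sup>2 + 2 * a * exp (- 2 * pi * y0) * C"
      unfolding N_def norm_diff_real_sq nq0 by (simp add: q0_def Re_qexp C_def y0_def)
    also have "((y0 / (4/5)) ^ j * exp (- 8 * pi * (y0 - 4/5)))\<^sup>2 * (R\<^sup>2 * ((exp (- 2 * pi * y0))\<^sup>2 + a\<^sup>2 + 2 * a * exp (- 2 * pi * y0) * C))
      < (R\<^sup>2)\<^sup>2 + a\<^sup>2 * (exp (- 2 * pi * y0))\<^sup>2 + 2 * R\<^sup>2 * a * exp (- 2 * pi * y0) * C"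
      unfolding R_def a_def by (rule modular_blaschke_ineq[OF y0_ge y0_le j(2) C])
    also have "\<dots> = T\<^sup>2"
    proof -
      have "T\<^sup>2 = (norm (of_real a * q0 + of_real (R\<^sup>2)))\<^sup>2" by (simp add: T_def add.commute)
      also have "\<dots> = a\<^sup>2 * (exp (- 2 * pi * y0))\<^sup>2 + (R\<^sup>2)\<^sup>2 + 2 * R\<^sup>2 * (a * (exp (- 2 * pi * y0) * C))"
        unfolding norm_diff_real_sq norm_mult nq0 by (simp add: q0_def Re_qexp C_def y0_def power_mult_distrib)
      finally show ?thesis by simp
    qed
    finally show False by simp
  qed
  \<comment> \<open>A nonzero power series has no zeros in some punctured disc, yet small positive
    \<open>q\<close> come from points of height at least 4/5, where the form has been shown to
    vanish.\<close>
  show "c n = 0"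
  proof (rule ccontr)
    assume cn: "c n \<noteq> 0"
    then have "n > 0" using c0[of n] by (cases "n = 0") auto
    have "F 0 = 0" using F_G[of 0] by simp
    obtain s where s: "s > 0" "\<And>q. q \<in> cball 0 s - {0} \<Longrightarrow> F q \<noteq> 0"
      by (rule powser_0_nonzero[of 1 0 c F n]) (use F_sums \<open>F 0 = 0\<close> cn \<open>n > 0\<close> in auto)
    define t where "t = min s (exp (- 2 * pi * (4/5)))"
    have t: "t > 0" "t \<le> s" "t \<le> exp (- 2 * pi * (4/5))" using s by (auto simp: t_def)
    have "complex_of_real t \<noteq> 0" using t by simp
    then obtain z where z: "qexp z = of_real t" by (rule qexp_surj)
    have "exp (- 2 * pi * Im z) = t" using norm_qexp[of z] t by (simp add: z)
    then have "exp (- 2 * pi * Im z) \<le> exp (- 2 * pi * (4/5))" using t by (simp del: exp_le_cancel_iff)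
    then have "Im z \<ge> 4/5" by simp
    then have "F (of_real t) = 0" using f_zero[of z] by (simp add: f_def z)
    with s(2)[of "of_real t"] t show False by simp
  qed
qed

section \<open>Theta functions and spherical designs\<close>

lemma finite_if_summable_const:
  fixes c :: real
  assumes "(\<lambda>_. c) summable_on A" "c \<noteq> 0"
  shows "finite A"
  using assms infsum_diverge_constant summable_on_def by metis

section \<open>Moments as Taylor coefficients of theta functions\<close>

text \<open>Completing the square: half of the Gaussian absorbs the exponential of linear
  growth.\<close>

lemma summable_on_gauss_exp:
  fixes v :: "'a::real_inner"
  assumes s: "s > 0" and sum: "\<And>s. s > 0 \<Longrightarrow> (\<lambda>x. exp (- pi * s * (norm x)\<^sup>2)) summable_on L" and a: "a \<ge> 0"
  shows "(\<lambda>x. exp (- pi * s * (norm x)\<^sup>2) * exp (a * \<bar>x \<bullet> v\<bar>)) summable_on L"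
proof (rule summable_on_comparison_test)
  define b where "b = a * norm v"
  show "(\<lambda>x. exp (- pi * (s / 2) * (norm x)\<^sup>2) * exp (b\<^sup>2 / (2 * pi * s))) summable_on L"
    using s by (intro summable_on_cmult_left sum) simp
  fix x
  have "a * \<bar>x \<bullet> v\<bar> \<le> b * norm x"
    using mult_left_mono[OF Cauchy_Schwarz_ineq2 a, of x v] by (simp add: b_def mult_ac)
  moreover have "b * norm x \<le> pi * (s / 2) * (norm x)\<^sup>2 + b\<^sup>2 / (2 * pi * s)"
  proof -
    have "0 \<le> (pi * s * norm x - b)\<^sup>2 / (2 * pi * s)" using s by simp
    also have "\<dots> = pi * (s / 2) * (norm x)\<^sup>2 + b\<^sup>2 / (2 * pi * s) - b * norm x"
      using s by (simp add: power2_eq_square field_simps)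
    finally show ?thesis by simp
  qed
  ultimately have "- pi * s * (norm x)\<^sup>2 + a * \<bar>x \<bullet> v\<bar> \<le> - pi * (s / 2) * (norm x)\<^sup>2 + b\<^sup>2 / (2 * pi * s)"
    by simp
  then show "exp (- pi * s * (norm x)\<^sup>2) * exp (a * \<bar>x \<bullet> v\<bar>) \<le> exp (- pi * (s / 2) * (norm x)\<^sup>2) * exp (b\<^sup>2 / (2 * pi * s))"
    by (simp only: exp_le_cancel_iff flip: exp_add)
qed simp

lemma power_le_fact_exp: "x \<ge> 0 \<Longrightarrow> x ^ d \<le> fact d * exp (x::real)"
proof -
  assume x: "x \<ge> 0"
  have "x ^ d /\<^sub>R fact d \<le> exp x"
  proof -
    have "(\<Sum>n\<in>{d}. x ^ n /\<^sub>R fact n) \<le> (\<Sum>n. x ^ n /\<^sub>R fact n)"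
      using x by (intro sum_le_suminf summable_exp_generic) auto
    then show ?thesis by (simp add: exp_def)
  qed
  then show ?thesis by (simp add: field_simps)
qed

lemma summable_on_gauss_moment:
  fixes v :: "'a::real_inner"
  assumes s: "s > 0" and sum: "\<And>s. s > 0 \<Longrightarrow> (\<lambda>x. exp (- pi * s * (norm x)\<^sup>2)) summable_on L"
  shows "(\<lambda>x. norm (exp (- pi * s * (norm x)\<^sup>2) * (x \<bullet> v) ^ d)) summable_on L"
proof (rule summable_on_comparison_test)
  show "(\<lambda>x. fact d * (exp (- pi * s * (norm x)\<^sup>2) * exp (1 * \<bar>x \<bullet> v\<bar>))) summable_on L"
    by (intro summable_on_cmult_right summable_on_gauss_exp s sum) simp_all
  fix x
  show "norm (exp (- pi * s * (norm x)\<^sup>2) * (x \<bullet> v) ^ d) \<le> fact d * (exp (- pi * s * (norm x)\<^sup>2) * exp (1 * \<bar>x \<bullet> v\<bar>))"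
    using power_le_fact_exp[of "\<bar>x \<bullet> v\<bar>" d] by (simp add: abs_mult power_abs)
qed simp

text \<open>Expanding the exponential and exchanging sums shows that the theta function is entire in
  the elliptic variable, with the Gaussian moments as Taylor coefficients. Absolute convergence
  comes from replacing \<open>z\<close> and the inner product by their moduli.\<close>

lemma gauss_exp_sums_moments:
  fixes v :: "'a::real_inner" and z :: complex
  assumes s: "s > 0" and sum: "\<And>s. s > 0 \<Longrightarrow> (\<lambda>x. exp (- pi * s * (norm x)\<^sup>2)) summable_on L"
  shows "(\<lambda>d. of_real (\<Sum>\<^sub>\<infinity>x\<in>L. exp (- pi * s * (norm x)\<^sup>2) * (x \<bullet> v) ^ d) / fact d * z ^ d) sums
         (\<Sum>\<^sub>\<infinity>x\<in>L. of_real (exp (- pi * s * (norm x)\<^sup>2)) * exp (z * of_real (x \<bullet> v)))"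
proof -
  define e where "e x = exp (- pi * s * (norm x)\<^sup>2)" for x :: 'a
  have e: "e x \<ge> 0" for x by (simp add: e_def)
  define f where "f = (\<lambda>(x, d). of_real (e x) * (z * of_real (x \<bullet> v)) ^ d / fact d)"
  have norm_f: "norm (f (x, d)) = e x * ((norm z * \<bar>x \<bullet> v\<bar>) ^ d / fact d)" for x d
    by (simp add: f_def norm_mult norm_divide norm_power e)
  have hs: "((\<lambda>d. norm (f (x, d))) has_sum e x * exp (norm z * \<bar>x \<bullet> v\<bar>)) UNIV" for x
    unfolding norm_f
  proof (rule has_sum_cmult_right, rule sums_nonneg_imp_has_sum)
    show "(\<lambda>d. (norm z * \<bar>x \<bullet> v\<bar>) ^ d / fact d) sums exp (norm z * \<bar>x \<bullet> v\<bar>)"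
      using exp_converges[of "norm z * \<bar>x \<bullet> v\<bar>"] by (simp add: divide_inverse mult.commute)
  qed auto
  have "(\<lambda>xd. norm (f xd)) summable_on L \<times> UNIV"
    by (rule summable_on_SigmaI[OF hs]) (use summable_on_gauss_exp[OF s sum, of "norm z" v] in \<open>auto simp: e_def\<close>)
  then have summ: "f summable_on L \<times> UNIV" by (rule abs_summable_summable)
  have inner: "(\<Sum>\<^sub>\<infinity>d. f (x, d)) = of_real (e x) * exp (z * of_real (x \<bullet> v))" for x
  proof (rule infsumI, rule norm_summable_imp_has_sum)
    have "(\<lambda>d. norm (f (x, d))) summable_on UNIV" using hs[of x] by (rule has_sum_imp_summable)
    then show "summable (\<lambda>d. norm (f (x, d)))" by (rule summable_on_imp_summable)
    show "(\<lambda>d. f (x, d)) sums (of_real (e x) * exp (z * of_real (x \<bullet> v)))"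
      using sums_mult[OF exp_converges[of "z * of_real (x \<bullet> v)"], of "of_real (e x)"]
      by (simp add: f_def scaleR_conv_of_real divide_inverse mult_ac)
  qed
  have "(f has_sum infsum f (L \<times> UNIV)) (L \<times> UNIV)" using summ by simp
  then have "((\<lambda>(d, x). f (x, d)) has_sum infsum f (L \<times> UNIV)) (UNIV \<times> L)"
    by (simp only: has_sum_swap[of f])
  then have "((\<lambda>d. z ^ d / fact d * of_real (\<Sum>\<^sub>\<infinity>x\<in>L. e x * (x \<bullet> v) ^ d)) has_sum infsum f (L \<times> UNIV)) UNIV"
  proof (rule has_sum_Sigma')
    fix d :: nat
    have "(\<lambda>x. e x * (x \<bullet> v) ^ d) summable_on L"
      unfolding e_def by (rule abs_summable_summable) (rule summable_on_gauss_moment[OF s sum])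
    then have "((\<lambda>x. z ^ d / fact d * of_real (e x * (x \<bullet> v) ^ d)) has_sum (z ^ d / fact d * of_real (\<Sum>\<^sub>\<infinity>x\<in>L. e x * (x \<bullet> v) ^ d))) L"
      by (intro has_sum_cmult_right has_sum_of_real has_sum_infsum)
    then show "((\<lambda>x. case (d, x) of (d, x) \<Rightarrow> f (x, d)) has_sum (z ^ d / fact d * of_real (\<Sum>\<^sub>\<infinity>x\<in>L. e x * (x \<bullet> v) ^ d))) L"
      by (simp add: f_def power_mult_distrib mult_ac)
  qed
  moreover have "infsum f (L \<times> UNIV) = (\<Sum>\<^sub>\<infinity>x\<in>L. of_real (e x) * exp (z * of_real (x \<bullet> v)))"
    unfolding infsum_Sigma_banach[OF summ, symmetric] inner ..
  ultimately show ?thesis using has_sum_imp_sums by (fastforce simp: e_def mult_ac)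
qed

text \<open>It allows leading coefficients to be compared by continuity at 0 rather than by repeated
  differentiation.\<close>

lemma powser_leading_coeff:
  fixes c :: "nat \<Rightarrow> complex"
  assumes "\<And>z. (\<lambda>n. c n * z ^ n) sums f z" "\<And>n. n < d \<Longrightarrow> c n = 0"
  obtains g where "\<And>z. f z = z ^ d * g z" "isCont g 0" "g 0 = c d"
proof
  define g where "g z = (\<Sum>n. c (n + d) * z ^ n)" for z
  have summ: "summable (\<lambda>n. c (n + d) * z ^ n)" for z
  proof (cases "z = 0")
    case False
    have "summable (\<lambda>n. c (n + d) * z ^ (n + d))" using sums_summable[OF assms(1)] by (subst summable_iff_shift)
    then have "summable (\<lambda>n. c (n + d) * z ^ (n + d) * (1 / z ^ d))" by (rule summable_mult2)
    then show ?thesis using False by (simp add: power_add)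
  qed (simp add: summable_0_powser)
  show "isCont g 0" unfolding g_def by (rule isCont_powser_converges_everywhere[OF summ])
  show "g 0 = c d" by (simp add: g_def)
  show "f z = z ^ d * g z" for z
  proof -
    have "f z = (\<Sum>n. c (n + d) * z ^ (n + d)) + (\<Sum>n<d. c n * z ^ n)"
      using sums_unique[OF assms(1)] suminf_split_initial_segment[OF sums_summable[OF assms(1)]] by metis
    also have "(\<Sum>n<d. c n * z ^ n) = 0" using assms(2) by (intro sum.neutral) auto
    also have "(\<Sum>n. c (n + d) * z ^ (n + d)) = (\<Sum>n. z ^ d * (c (n + d) * z ^ n))"
      by (simp add: power_add mult_ac)
    also have "\<dots> = z ^ d * g z" unfolding g_def by (rule suminf_mult[OF summ])
    finally show ?thesis by simp
  qed
qed

section \<open>Inversion formula for unimodular lattices\<close>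

text \<open>Self-duality puts the same lattice on both sides of the Poisson formula. At s = 1 and u
  = 0 a positive sum equals \<open>c\<close> times itself, so the unknown constant is 1.\<close>

lemma unimodular_theta:
  fixes L :: "'a::real_inner set"
  assumes "is_lattice n L" "unimodular L" "s > 0"
  shows "(\<lambda>x. exp (- pi * s * (norm x)\<^sup>2)) summable_on L"
    and "u \<in> span L \<Longrightarrow> (\<Sum>\<^sub>\<infinity>x\<in>L. of_real (exp (- pi * s * (norm x)\<^sup>2)) * cis (2 * pi * (x \<bullet> u))) =
      of_real (1 / sqrt s ^ n) * (\<Sum>\<^sub>\<infinity>x\<in>L. complex_of_real (exp (- pi * (1 / s) * (norm (x + u))\<^sup>2)))"
proof -
  obtain B where B: "finite B" "card B = n" "independent B" "L = int_span B"
    using assms(1) by (auto simp: is_lattice_def)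
  have dual: "dual_lattice L = L" using assms(2) by (simp add: unimodular_def)
  have span: "span B = span L" unfolding B(4) by (rule span_int_span[symmetric])
  obtain c where c: "\<And>s. s > 0 \<Longrightarrow> (\<lambda>y. exp (- pi / s * (norm y)\<^sup>2)) summable_on L"
    "\<And>s u. s > 0 \<Longrightarrow> u \<in> span L \<Longrightarrow> (\<Sum>\<^sub>\<infinity>x\<in>L. complex_of_real (exp (- pi * s * (norm (x + u))\<^sup>2))) =
      of_real (c / sqrt s ^ n) * (\<Sum>\<^sub>\<infinity>y\<in>L. of_real (exp (- pi / s * (norm y)\<^sup>2)) * cis (2 * pi * (y \<bullet> u)))"
  proof -
    note * = lattice_poisson[OF B(1,3), folded B(4), unfolded dual span B(2)]
    from * obtain c where "\<forall>s>0. (\<lambda>y. exp (- pi / s * (norm y)\<^sup>2)) summable_on L \<and>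
      (\<forall>u\<in>span L. (\<lambda>x. exp (- pi * s * (norm (x + u))\<^sup>2)) summable_on L \<and>
      (\<Sum>\<^sub>\<infinity>x\<in>L. complex_of_real (exp (- pi * s * (norm (x + u))\<^sup>2))) =
      of_real (c / sqrt s ^ n) * (\<Sum>\<^sub>\<infinity>y\<in>L. of_real (exp (- pi / s * (norm y)\<^sup>2)) * cis (2 * pi * (y \<bullet> u))))"
      by (elim exE conjE)
    then show ?thesis by (intro that[of c]) auto
  qed
  have sum: "(\<lambda>x. exp (- pi * s * (norm x)\<^sup>2)) summable_on L" if "s > 0" for s
    using c(1)[of "1 / s"] that by simp
  show "(\<lambda>x. exp (- pi * s * (norm x)\<^sup>2)) summable_on L" by (rule sum[OF assms(3)])
  define S where "S = (\<Sum>\<^sub>\<infinity>x\<in>L. exp (- pi * 1 * (norm x)\<^sup>2))"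
  have "S > 0"
  proof -
    have "0 \<in> L" unfolding B(4) by (rule int_module.span_zero)
    then have "(\<Sum>x\<in>{0}. exp (- pi * 1 * (norm x)\<^sup>2)) \<le> S"
      unfolding S_def using finite_sum_le_infsum[OF sum[OF zero_less_one], of "{0}"] by simp
    then show ?thesis by simp
  qed
  have "complex_of_real S = of_real c * of_real S"
    using c(2)[of 1 0] sum[of 1] unfolding S_def by (simp add: span_zero infsum_complex_of_real)
  then have "c = 1" using \<open>S > 0\<close> by (metis mult_cancel_right1 of_real_eq_0_iff of_real_eq_1_iff order_less_irrefl)
  then show "(\<Sum>\<^sub>\<infinity>x\<in>L. of_real (exp (- pi * s * (norm x)\<^sup>2)) * cis (2 * pi * (x \<bullet> u))) =
      of_real (1 / sqrt s ^ n) * (\<Sum>\<^sub>\<infinity>x\<in>L. complex_of_real (exp (- pi * (1 / s) * (norm (x + u))\<^sup>2)))"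
    if "u \<in> span L"
    using c(2)[of "1 / s" u] that \<open>s > 0\<close> by (simp add: real_sqrt_divide power_divide)
qed

text \<open>The Gaussian factor in the transformation depends on \<open>v\<close> only through its
  norm, so it is common to \<open>v\<close> and \<open>w\<close>, and it is 1 at z = 0. As lower
  coefficients vanish, both at \<open>s\<close> and at \<open>1 / s\<close>, the power
  \<open>z ^ d\<close> can be cancelled and z sent to 0.\<close>

lemma theta_moment_transform:
  fixes L :: "'a::real_inner set"
  assumes L: "is_lattice n L" "unimodular L"
    and v: "v \<in> span L" "w \<in> span L" "norm v = norm w"
  defines "A \<equiv> \<lambda>s d. (\<Sum>\<^sub>\<infinity>x\<in>L. exp (- pi * s * (norm x)\<^sup>2) * (x \<bullet> v) ^ d) - (\<Sum>\<^sub>\<infinity>x\<in>L. exp (- pi * s * (norm x)\<^sup>2) * (x \<bullet> w) ^ d)"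
  assumes low: "\<And>s e. s > 0 \<Longrightarrow> e < d \<Longrightarrow> A s e = 0" and s: "s > 0"
  shows "of_real (A (1 / s) d) = of_real (sqrt s ^ n * s ^ d) * (- \<i>) ^ d * complex_of_real (A s d)"
proof -
  note sum = unimodular_theta(1)[OF L]
  define T where "T s v z = (\<Sum>\<^sub>\<infinity>x\<in>L. of_real (exp (- pi * s * (norm x)\<^sup>2)) * exp (z * of_real (x \<bullet> v)))" for s :: real and v :: 'a and z :: complex
  have transf: "T s v (2 * complex_of_real pi * \<i> * complex_of_real z) = of_real (1 / sqrt s ^ n * exp (- pi * z\<^sup>2 * (norm v)\<^sup>2 / s)) * T (1 / s) v (- 2 * complex_of_real pi * complex_of_real z / complex_of_real s)"
    if "v \<in> span L" for v z
  proof -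
    have "T s v (2 * complex_of_real pi * \<i> * complex_of_real z) = (\<Sum>\<^sub>\<infinity>x\<in>L. of_real (exp (- pi * s * (norm x)\<^sup>2)) * cis (2 * pi * (x \<bullet> (z *\<^sub>R v))))"
      unfolding T_def by (simp add: cis_conv_exp mult_ac)
    also have "\<dots> = of_real (1 / sqrt s ^ n) * (\<Sum>\<^sub>\<infinity>x\<in>L. complex_of_real (exp (- pi * (1 / s) * (norm (x + z *\<^sub>R v))\<^sup>2)))"
      by (rule unimodular_theta(2)[OF L s]) (rule span_scale[OF that])
    also have "(\<Sum>\<^sub>\<infinity>x\<in>L. complex_of_real (exp (- pi * (1 / s) * (norm (x + z *\<^sub>R v))\<^sup>2))) =
      (\<Sum>\<^sub>\<infinity>x\<in>L. complex_of_real (exp (- pi * z\<^sup>2 * (norm v)\<^sup>2 / s)) * (of_real (exp (- pi * (1 / s) * (norm x)\<^sup>2)) * exp (- 2 * complex_of_real pi * complex_of_real z / complex_of_real s * complex_of_real (x \<bullet> v))))"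
    proof (rule infsum_cong)
      fix x
      have "- pi * (1 / s) * (norm (x + z *\<^sub>R v))\<^sup>2 = - pi * z\<^sup>2 * (norm v)\<^sup>2 / s + (- pi * (1 / s) * (norm x)\<^sup>2 + - 2 * pi * z / s * (x \<bullet> v))"
        using s unfolding power2_norm_eq_inner by (simp add: inner_add_left inner_add_right inner_commute[of v x] power2_eq_square field_simps)
      then have "complex_of_real (exp (- pi * (1 / s) * (norm (x + z *\<^sub>R v))\<^sup>2)) = 
        of_real (exp (- pi * z\<^sup>2 * (norm v)\<^sup>2 / s) * (exp (- pi * (1 / s) * (norm x)\<^sup>2) * exp (- 2 * pi * z / s * (x \<bullet> v))))"
        by (simp only: exp_add)
      also have "\<dots> = of_real (exp (- pi * z\<^sup>2 * (norm v)\<^sup>2 / s)) * (of_real (exp (- pi * (1 / s) * (norm x)\<^sup>2)) * exp (- 2 * complex_of_real pi * complex_of_real z / complex_of_real s * complex_of_real (x \<bullet> v)))"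
        by (simp flip: exp_of_real)
      finally show "complex_of_real (exp (- pi * (1 / s) * (norm (x + z *\<^sub>R v))\<^sup>2)) = \<dots>" .
    qed
    finally show ?thesis by (simp add: T_def infsum_cmult_right')
  qed
  define P where "P s z = T s v z - T s w z" for s z
  have sums: "(\<lambda>d. of_real (A s d) / fact d * z ^ d) sums P s z" if "s > 0" for s z
    using sums_diff[OF gauss_exp_sums_moments[OF that sum, of v z] gauss_exp_sums_moments[OF that sum, of w z]]
    unfolding P_def T_def A_def by (simp add: left_diff_distrib diff_divide_distrib)
  have P_transf: "P s (2 * complex_of_real pi * \<i> * complex_of_real z) = of_real (1 / sqrt s ^ n * exp (- pi * z\<^sup>2 * (norm v)\<^sup>2 / s)) * P (1 / s) (- 2 * complex_of_real pi * complex_of_real z / complex_of_real s)" for z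
    unfolding P_def transf[OF v(1)] transf[OF v(2)] v(3) by (simp only: right_diff_distrib)
  obtain g where g: "\<And>z. P s z = z ^ d * g z" "isCont g 0" "g 0 = of_real (A s d) / fact d"
    by (rule powser_leading_coeff[OF sums[OF s], of d]) (use low s in auto)
  obtain h where h: "\<And>z. P (1 / s) z = z ^ d * h z" "isCont h 0" "h 0 = of_real (A (1 / s) d) / fact d"
    by (rule powser_leading_coeff[OF sums[of "1 / s"], of d]) (use low s in auto)
  define l where "l z = (2 * complex_of_real pi * \<i>) ^ d * g (2 * complex_of_real pi * \<i> * complex_of_real z)" for z :: real
  define r where "r z = of_real (1 / sqrt s ^ n * exp (- pi * z\<^sup>2 * (norm v)\<^sup>2 / s)) * ((- 2 * complex_of_real pi / complex_of_real s) ^ d * h (- 2 * complex_of_real pi * complex_of_real z / complex_of_real s))" for z :: real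
  have "l z = r z" if "z \<noteq> 0" for z
  proof -
    have pw: "(2 * complex_of_real pi * \<i> * complex_of_real z) ^ d = of_real z ^ d * (2 * complex_of_real pi * \<i>) ^ d"
      "(- 2 * complex_of_real pi * complex_of_real z / complex_of_real s) ^ d = of_real z ^ d * (- 2 * complex_of_real pi / of_real s) ^ d"
      unfolding power_mult_distrib[symmetric] by (simp_all add: mult_ac)
    have "of_real z ^ d * l z = of_real z ^ d * r z"
      using P_transf[of z] unfolding g h l_def r_def pw by (simp only: mult_ac)
    then show ?thesis using that by simp
  qed
  then have ev: "eventually (\<lambda>z. l z = r z) (at 0)" by (simp add: eventually_at_filter)
  have "isCont (\<lambda>z::real. g (2 * complex_of_real pi * \<i> * complex_of_real z)) 0"
    by (rule isCont_o2[where g = g]) (use g(2) in \<open>auto intro!: continuous_intros\<close>)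
  then have contl: "isCont l 0" unfolding l_def by (intro continuous_mult continuous_const)
  have "isCont (\<lambda>z::real. h (- 2 * complex_of_real pi * complex_of_real z / complex_of_real s)) 0"
    by (rule isCont_o2[where g = h]) (use h(2) s in \<open>auto intro!: continuous_intros\<close>)
  moreover have "isCont (\<lambda>z::real. complex_of_real (1 / sqrt s ^ n * exp (- pi * z\<^sup>2 * (norm v)\<^sup>2 / s))) 0"
    using s by (intro continuous_intros) auto
  ultimately have contr: "isCont r 0" unfolding r_def by (intro continuous_mult continuous_const)
  have "(l \<longlongrightarrow> l 0) (at 0)" "(r \<longlongrightarrow> r 0) (at 0)" using contl contr by (auto simp: isCont_def)
  then have "l 0 = r 0"
    using ev tendsto_cong tendsto_unique trivial_limit_at by metis
  then have eq: "(2 * complex_of_real pi * \<i>) ^ d * of_real (A s d) = of_real (1 / sqrt s ^ n) * (- 2 * complex_of_real pi / complex_of_real s) ^ d * of_real (A (1 / s) d)"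
  proof -
    have "l 0 * fact d = (2 * complex_of_real pi * \<i>) ^ d * of_real (A s d)" by (simp add: l_def g)
    moreover have "r 0 * fact d = of_real (1 / sqrt s ^ n) * (- 2 * complex_of_real pi / complex_of_real s) ^ d * of_real (A (1 / s) d)"
      by (simp add: r_def h)
    ultimately show ?thesis using \<open>l 0 = r 0\<close> by simp
  qed
  have "(2 * complex_of_real pi * \<i>) ^ d = (- 2 * complex_of_real pi / complex_of_real s) ^ d * (of_real s ^ d * (- \<i>) ^ d)"
    unfolding power_mult_distrib[symmetric]
    by (intro arg_cong[where f = "\<lambda>x. x ^ d"]) (use s in simp)
  with eq have "(- 2 * complex_of_real pi / complex_of_real s) ^ d * (of_real s ^ d * (- \<i>) ^ d * of_real (A s d)) = (- 2 * complex_of_real pi / complex_of_real s) ^ d * (of_real (1 / sqrt s ^ n) * of_real (A (1 / s) d))"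
    by (simp only: mult_ac)
  moreover have "(- 2 * complex_of_real pi / of_real s) ^ d \<noteq> 0" using s by simp
  ultimately have "of_real s ^ d * (- \<i>) ^ d * of_real (A s d) = of_real (1 / sqrt s ^ n) * complex_of_real (A (1 / s) d)"
    by (simp only: mult_cancel_left simp_thms)
  then show ?thesis using s by (simp add: field_simps)
qed

section \<open>Extremal lattices of rank 72 and the design property of their shells\<close>

locale extremal72 =
  fixes L :: "'a::real_inner set"
  assumes extremal: "extremal_lattice 72 L"
begin

lemma lattice: "is_lattice 72 L" and unimodular: "unimodular L" and even: "even_lattice L" and min_norm: "min_norm L = 8"
  using extremal by (auto simp: extremal_lattice_72 type_II_lattice_def)

lemma subgroup: "0 \<in> L" "x \<in> L \<Longrightarrow> y \<in> L \<Longrightarrow> x - y \<in> L" "x \<in> L \<Longrightarrow> - x \<in> L" "x \<in> L \<Longrightarrow> y \<in> L \<Longrightarrow> x + y \<in> L"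
  using lattice by (auto simp: is_lattice_def int_module.span_zero int_module.span_diff int_module.span_neg int_module.span_add)

lemma inner_Ints: "x \<in> L \<Longrightarrow> y \<in> L \<Longrightarrow> x \<bullet> y \<in> \<int>"
  using unimodular by (auto simp: unimodular_def dual_lattice_def)

lemma in_span: "x \<in> L \<Longrightarrow> x \<in> span L" by (rule span_base)

lemma norm_even:
  assumes "x \<in> L"
  obtains n :: nat where "x \<bullet> x = 2 * real n"
proof -
  obtain k :: int where k: "x \<bullet> x = 2 * of_int k" using even assms by (auto simp: even_lattice_def)
  then have "real_of_int k \<ge> 0" using inner_ge_zero[of x] by linarith
  then have "x \<bullet> x = 2 * real (nat k)" using k by simp
  then show ?thesis by (rule that)
qed

lemma norm_ge_8:
  assumes "x \<in> L" "x \<noteq> 0"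
  shows "x \<bullet> x \<ge> 8"
proof -
  have "Inf {x \<bullet> x |x. x \<in> L \<and> x \<noteq> 0} \<le> x \<bullet> x"
    using assms by (intro cInf_lower bdd_belowI[of _ 0]) auto
  then show ?thesis using min_norm by (simp add: min_norm_def)
qed

text \<open>The infimum 8 yields a nonzero vector of norm below 9, and evenness together with the
  lower bound leaves only norm 8.\<close>

lemma shell_8_nonempty: "shell 8 L \<noteq> {}"
proof -
  obtain B where B: "finite B" "card B = 72" "independent B" "L = int_span B"
    using lattice by (auto simp: is_lattice_def)
  then obtain b where "b \<in> B" by fastforce
  then have "b \<in> L" "b \<noteq> 0" using B int_module.span_base dependent_zero by auto
  then have nonempty: "{x \<bullet> x |x. x \<in> L \<and> x \<noteq> 0} \<noteq> {}" by auto
  have less: "Inf {x \<bullet> x |x. x \<in> L \<and> x \<noteq> 0} < 9" using min_norm by (simp add: min_norm_def)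
  obtain z where "z \<in> {x \<bullet> x |x. x \<in> L \<and> x \<noteq> 0}" "z < 9"
    using cInf_lessD[OF nonempty less] by (elim bexE)
  then obtain x where x: "x \<in> L" "x \<noteq> 0" "x \<bullet> x < 9" by blast
  obtain n where n: "x \<bullet> x = 2 * real n" using norm_even[OF x(1)] .
  have "real 4 \<le> real n" "real n < real 5" using norm_ge_8[OF x(1,2)] x(3) n by simp_all
  then have "n = 4" by (simp only: of_nat_le_iff of_nat_less_iff)
  then have "x \<bullet> x = 8" using n by simp
  then show ?thesis using x by (auto simp: shell_def)
qed

lemma summable_gauss: "s > 0 \<Longrightarrow> (\<lambda>x. exp (- pi * s * (norm x)\<^sup>2)) summable_on L"
  by (rule unimodular_theta(1)[OF lattice unimodular])

lemma summable_moment: "s > 0 \<Longrightarrow> (\<lambda>x. norm (exp (- pi * s * (norm x)\<^sup>2) * (x \<bullet> v) ^ d)) summable_on L"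
  by (erule summable_on_gauss_moment) (rule summable_gauss)

text \<open>The Gaussian is a nonzero constant on a shell and summable over it.\<close>

lemma finite_shell: "finite (shell r L)"
proof (rule finite_if_summable_const)
  have "(\<lambda>x. exp (- pi * 1 * (norm x)\<^sup>2)) summable_on shell r L"
    by (rule summable_on_subset[OF summable_gauss]) (auto simp: shell_def)
  then show "(\<lambda>_. exp (- pi * r)) summable_on shell r L"
    by (rule summable_on_cong[THEN iffD1, rotated]) (simp add: shell_def power2_norm_eq_inner)
qed simp

text \<open>Grouping by norm makes a theta sum a power series in exp (-2 pi s); evenness of the
  lattice leaves only integral exponents.\<close>

lemma theta_sums_shells:
  fixes p :: "'a \<Rightarrow> real"
  assumes "(\<lambda>x. exp (- pi * s * (norm x)\<^sup>2) * p x) summable_on L"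
  shows "(\<lambda>n. (\<Sum>x\<in>shell (2 * real n) L. p x) * exp (- 2 * pi * s) ^ n) sums (\<Sum>\<^sub>\<infinity>x\<in>L. exp (- pi * s * (norm x)\<^sup>2) * p x)"
proof -
  define f where "f x = exp (- pi * s * (norm x)\<^sup>2) * p x" for x
  have bij: "bij_betw snd (Sigma UNIV (\<lambda>n. shell (2 * real n) L)) L"
  proof (rule bij_betwI')
    show "snd y \<in> L" if "y \<in> Sigma UNIV (\<lambda>n. shell (2 * real n) L)" for y
      using that by (auto simp: shell_def)
    show "\<exists>y\<in>Sigma UNIV (\<lambda>n. shell (2 * real n) L). x = snd y" if "x \<in> L" for x
      using norm_even[OF that] that by (force simp: shell_def)
  qed (auto simp: shell_def)
  have "(f has_sum infsum f L) L" using assms unfolding f_def by (rule has_sum_infsum)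
  then have "((\<lambda>y. f (snd y)) has_sum infsum f L) (Sigma UNIV (\<lambda>n. shell (2 * real n) L))"
    by (rule has_sum_reindex_bij_betw[OF bij, THEN iffD2])
  then have "((\<lambda>n. (\<Sum>x\<in>shell (2 * real n) L. p x) * exp (- 2 * pi * s) ^ n) has_sum infsum f L) UNIV"
  proof (rule has_sum_Sigma')
    fix n :: nat
    have "f x = p x * exp (- 2 * pi * s) ^ n" if "x \<in> shell (2 * real n) L" for x
      using that by (simp add: f_def shell_def power2_norm_eq_inner mult_ac flip: exp_of_nat_mult)
    then have eq: "(\<Sum>x\<in>shell (2 * real n) L. f x) = (\<Sum>x\<in>shell (2 * real n) L. p x) * exp (- 2 * pi * s) ^ n"
      by (simp add: sum_distrib_right)
    show "((\<lambda>x. f (snd (n, x))) has_sum (\<Sum>x\<in>shell (2 * real n) L. p x) * exp (- 2 * pi * s) ^ n) (shell (2 * real n) L)"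
      unfolding snd_conv eq[symmetric] by (rule has_sum_finite[OF finite_shell])
  qed
  then show ?thesis unfolding f_def by (rule has_sum_imp_sums)
qed

lemma shell_uminus: "bij_betw uminus (shell r L) (shell r L)"
  by (rule bij_betw_byWitness[where f' = uminus]) (auto simp: shell_def subgroup)

lemma odd_moment:
  assumes "odd d"
  shows "(\<Sum>x\<in>shell r L. (x \<bullet> v) ^ d) = 0"
proof -
  have "(\<Sum>x\<in>shell r L. (x \<bullet> v) ^ d) = (\<Sum>x\<in>shell r L. (- x \<bullet> v) ^ d)"
    by (rule sum.reindex_bij_betw[OF shell_uminus, symmetric])
  also have "\<dots> = (\<Sum>x\<in>shell r L. - ((x \<bullet> v) ^ d))"
    using assms by (simp add: power_minus_odd)
  also have "\<dots> = - (\<Sum>x\<in>shell r L. (x \<bullet> v) ^ d)" by (rule sum_negf)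
  finally show ?thesis by simp
qed

text \<open>Strong induction on \<open>d\<close> supplies the vanishing of all lower coefficients.
  Odd moments vanish by symmetry. For d = 2 m > 0 the weight 36 + d is 2 (18 + m), and 18 + m runs
  from 19 to 23.\<close>

theorem shell_moment_eq:
  assumes v: "v \<in> span L" "w \<in> span L" "norm v = norm w" and d: "d \<le> 11"
  shows "(\<Sum>x\<in>shell (2 * real n) L. (x \<bullet> v) ^ d) = (\<Sum>x\<in>shell (2 * real n) L. (x \<bullet> w) ^ d)"
  using d
proof (induction d arbitrary: n rule: less_induct)
  case (less d)
  define p where "p d x = (x \<bullet> v) ^ d - (x \<bullet> w) ^ d" for d and x :: 'a
  define c where "c d n = (\<Sum>x\<in>shell (2 * real n) L. p d x)" for d n
  have summ: "(\<lambda>x. exp (- pi * s * (norm x)\<^sup>2) * (x \<bullet> v) ^ d) summable_on L" if "s > 0" for s v d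
    by (rule abs_summable_summable) (rule summable_moment[OF that])
  define A where "A s d = (\<Sum>\<^sub>\<infinity>x\<in>L. exp (- pi * s * (norm x)\<^sup>2) * (x \<bullet> v) ^ d) - (\<Sum>\<^sub>\<infinity>x\<in>L. exp (- pi * s * (norm x)\<^sup>2) * (x \<bullet> w) ^ d)" for s d
  have A: "(\<lambda>n. c d n * exp (- 2 * pi * s) ^ n) sums A s d" if "s > 0" for s d
    using sums_diff[OF theta_sums_shells[OF summ[OF that]] theta_sums_shells[OF summ[OF that]], of v d w d]
    by (simp add: A_def c_def p_def sum_subtractf left_diff_distrib)
  consider "d = 0" | "odd d" | "even d" "d > 0" by blast
  then show ?case
  proof cases
    case 3
    then obtain m where m: "d = 2 * m" "m > 0" by auto
    have m5: "m \<le> 5" using less.prems m by simp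
    have low: "A s e = 0" if "s > 0" "e < d" for s e
    proof -
      have "c e n = 0" for n using less.IH[of e n] that less.prems by (simp add: c_def p_def sum_subtractf)
      then have "(\<lambda>n. 0) sums A s e" using A[OF that(1), of e] by simp
      then show ?thesis using sums_0 sums_unique2 by blast
    qed
    have "complex_of_real (c d n) = 0"
    proof (rule cusp_form_vanishes[of "\<lambda>n. of_real (c d n)" "18 + m"])
      show "19 \<le> 18 + m" "18 + m \<le> 23" using m m5 by auto
      \<comment> \<open>Only the zero vector has norm below 8, and it contributes nothing because
        \<open>d\<close> is positive.\<close>
      show "complex_of_real (c d k) = 0" if "k < 4" for k
      proof -
        have "p d x = 0" if "x \<in> shell (2 * real k) L" for x
        proof -
          have "x \<bullet> x < 8" "x \<in> L" using that \<open>k < 4\<close> by (auto simp: shell_def)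
          then have "x = 0" using norm_ge_8[of x] by fastforce
          then show ?thesis using 3 by (simp add: p_def)
        qed
        then show ?thesis by (simp add: c_def)
      qed
      show "summable (\<lambda>n. complex_of_real (c d n) * q ^ n)" if q: "norm q < 1" for q
      proof (cases "q = 0")
        case False
        \<comment> \<open>Any radius below 1 is exp (-2 pi s) for some positive \<open>s\<close>, so
          convergence in the disc follows from absolute convergence of the moments.\<close>
        define s where "s = - ln (norm q) / (2 * pi)"
        have "ln (norm q) < 0" using q False by simp
        then have s: "s > 0" "exp (- 2 * pi * s) = norm q" using False by (auto simp: s_def divide_neg_pos)
        have "summable (\<lambda>n. (\<Sum>x\<in>shell (2 * real n) L. norm ((x \<bullet> v) ^ d)) * norm q ^ n)" for v
          unfolding s(2)[symmetric] using summable_moment[OF s(1), of v d]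
          by (intro sums_summable[OF theta_sums_shells]) (simp only: abs_mult real_norm_def abs_exp_cancel)
        then have "summable (\<lambda>n. (\<Sum>x\<in>shell (2 * real n) L. norm ((x \<bullet> v) ^ d)) * norm q ^ n + (\<Sum>x\<in>shell (2 * real n) L. norm ((x \<bullet> w) ^ d)) * norm q ^ n)"
          by (intro summable_add)
        then show ?thesis
        proof (rule summable_comparison_test')
          fix n :: nat
          have "\<bar>c d n\<bar> \<le> (\<Sum>x\<in>shell (2 * real n) L. norm ((x \<bullet> v) ^ d) + norm ((x \<bullet> w) ^ d))"
            unfolding c_def p_def real_norm_def by (rule order_trans[OF sum_abs], rule sum_mono, rule abs_triangle_ineq4)
          then show "norm (complex_of_real (c d n) * q ^ n) \<le> (\<Sum>x\<in>shell (2 * real n) L. norm ((x \<bullet> v) ^ d)) * norm q ^ n + (\<Sum>x\<in>shell (2 * real n) L. norm ((x \<bullet> w) ^ d)) * norm q ^ n"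
            unfolding sum.distrib norm_mult norm_power norm_of_real distrib_right[symmetric] by (rule mult_right_mono) simp
        qed
      qed (simp add: summable_0_powser)
      fix s :: real assume s: "s > 0"
      have F: "(\<Sum>n. complex_of_real (c d n) * of_real (exp (- 2 * pi * s)) ^ n) = of_real (A s d)" if "s > 0" for s
        using sums_of_real[OF A[OF that, of d], where ?'a = complex] by (simp add: sums_iff)
      have "sqrt s ^ (2 * 36) = s ^ 36" unfolding power_mult using s by simp
      then have "sqrt s ^ 72 = s ^ 36" by simp
      moreover have "(- \<i>) ^ d = (- 1) ^ m" unfolding m(1) power_mult by simp
      moreover have "(\<i> * of_real s) ^ (2 * (18 + m)) = of_real (s ^ 36 * s ^ d) * (- 1) ^ m"
      proof -
        have "\<i> ^ (2 * (18 + m)) = (- 1) ^ m" unfolding power_mult by (simp add: power_add)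
        moreover have "s ^ (2 * (18 + m)) = s ^ 36 * s ^ d" unfolding m(1) by (simp flip: power_add)
        ultimately show ?thesis unfolding power_mult_distrib by (simp flip: of_real_power)
      qed
      moreover have "of_real (A (1 / s) d) = of_real (sqrt s ^ 72 * s ^ d) * (- \<i>) ^ d * complex_of_real (A s d)"
        unfolding A_def by (rule theta_moment_transform[OF lattice unimodular v low[unfolded A_def] s])
      ultimately have "of_real (A (1 / s) d) = (\<i> * of_real s) ^ (2 * (18 + m)) * of_real (A s d)"
        by (simp only:)
      then show "(\<Sum>n. complex_of_real (c d n) * of_real (exp (- 2 * pi / s)) ^ n) = (\<i> * of_real s) ^ (2 * (18 + m)) * (\<Sum>n. of_real (c d n) * of_real (exp (- 2 * pi * s)) ^ n)"
        using F[OF s] F[of "1 / s"] s by (simp only: zero_less_divide_1_iff times_divide_eq_right mult_1_right)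
    qed
    then have "c d n = 0" by (simp only: of_real_eq_0_iff)
    then show ?thesis by (simp add: c_def p_def sum_subtractf)
  next
    case 2
    show ?thesis unfolding odd_moment[OF 2] ..
  next
    case 1
    then show ?thesis by (simp only: power_0)
  qed
qed

end

section \<open>Explicit even moments of shells\<close>

lemma orthonormal_basis_exists:
  fixes B :: "'a::real_inner set"
  assumes "finite B" "independent B"
  obtains E where "finite E" "card E = card B" "span E = span B"
    "\<And>e f. e \<in> E \<Longrightarrow> f \<in> E \<Longrightarrow> e \<bullet> f = (if e = f then 1 else 0)"
proof -
  have "\<exists>E. finite E \<and> card E = card B \<and> span E = span B \<and> (\<forall>e\<in>E. \<forall>f\<in>E. e \<bullet> f = (if e = f then 1 else 0))"
    using assms
  proof (induction B rule: finite_induct)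
    case empty
    then show ?case by (intro exI[of _ "{}"]) auto
  next
    case (insert b B)
    have b: "b \<notin> span B" using insert by (simp add: independent_insert)
    have "independent B" using insert.prems independent_mono by blast
    then obtain E where E: "finite E" "card E = card B" "span E = span B" "\<And>e f. e \<in> E \<Longrightarrow> f \<in> E \<Longrightarrow> e \<bullet> f = (if e = f then 1 else 0)"
      using insert.IH by blast
    obtain p where p: "p \<in> span B" "\<And>x. x \<in> span B \<Longrightarrow> (b - p) \<bullet> x = 0"
      using orthogonal_projection_exists[OF insert.hyps(1)] by blast
    define d where "d = (1 / norm (b - p)) *\<^sub>R (b - p)"
    have bp: "b - p \<noteq> 0" using p b by auto
    have dd: "d \<bullet> d = 1" using bp by (simp add: d_def power2_norm_eq_inner[symmetric] power2_eq_square)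
    have dE: "d \<bullet> e = 0" "e \<bullet> d = 0" if "e \<in> E" for e
    proof -
      have "e \<in> span B" using span_base[OF that] E(3) by simp
      then show "d \<bullet> e = 0" by (simp add: d_def p(2))
      then show "e \<bullet> d = 0" by (simp add: inner_commute)
    qed
    have dnot: "d \<notin> E" using dE dd by force
    have span_eq: "span (insert d E) = span (insert b B)"
    proof
      have "p \<in> span (insert b B)" using p(1) span_mono[of B "insert b B"] by auto
      then have "d \<in> span (insert b B)"
        unfolding d_def by (intro span_scale span_diff) (auto intro: span_base)
      moreover have "E \<subseteq> span (insert b B)"
        using E(3) span_superset[of E] span_mono[of B "insert b B"] by auto
      ultimately show "span (insert d E) \<subseteq> span (insert b B)"
        by (intro span_minimal) auto
      have "B \<subseteq> span (insert d E)"
        using E(3) span_superset[of B] span_mono[of E "insert d E"] by auto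
      moreover have "p \<in> span (insert d E)"
        using p(1) E(3) span_mono[of E "insert d E"] by auto
      then have "p + norm (b - p) *\<^sub>R d \<in> span (insert d E)"
        by (intro span_add span_scale) (auto intro: span_base)
      then have "b \<in> span (insert d E)" using bp by (simp add: d_def)
      ultimately show "span (insert b B) \<subseteq> span (insert d E)" by (intro span_minimal) auto
    qed
    show ?case
      using E insert.hyps dnot dd dE span_eq by (intro exI[of _ "insert d E"]) auto
  qed
  then show ?thesis using that by blast
qed

lemma orthonormal_parseval:
  fixes x :: "'a::real_inner"
  assumes "finite E" "\<And>e f. e \<in> E \<Longrightarrow> f \<in> E \<Longrightarrow> e \<bullet> f = (if e = f then 1 else 0)" "x \<in> span E"
  shows "(\<Sum>f\<in>E. (x \<bullet> f)\<^sup>2) = x \<bullet> x"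
proof -
  define y where "y = x - (\<Sum>f\<in>E. (x \<bullet> f) *\<^sub>R f)"
  have y_orth: "y \<bullet> e = 0" if "e \<in> E" for e
  proof -
    have "(\<Sum>f\<in>E. (x \<bullet> f) *\<^sub>R f) \<bullet> e = (\<Sum>f\<in>E. if f = e then x \<bullet> f else 0)"
      unfolding inner_sum_left using assms(2) that by (intro sum.cong) auto
    also have "\<dots> = x \<bullet> e" using that assms(1) by simp
    finally show ?thesis by (simp add: y_def inner_diff_left)
  qed
  have orth: "y \<bullet> z = 0" if "z \<in> span E" for z
    using that by (induction rule: span_induct_alt) (auto simp: inner_add_right y_orth)
  have "y \<in> span E" unfolding y_def by (intro span_diff assms span_sum span_scale span_base)
  then have "y = 0" using orth[of y] by simp
  then have "x \<bullet> x = x \<bullet> (\<Sum>f\<in>E. (x \<bullet> f) *\<^sub>R f)" by (simp add: y_def)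
  then show ?thesis by (simp add: inner_sum_right power2_eq_square)
qed

text \<open>It extracts mixed moments along two orthogonal directions from the fact that pure
  moments depend only on length: the coefficient of t^2 is (m + 1) (2 m + 1) times the mixed moment
  on the left and (m + 1) C on the right.\<close>

lemma second_order_moment:
  fixes a b :: "'i \<Rightarrow> real"
  assumes "\<And>t. (\<Sum>x\<in>S. (a x + t * b x) ^ (2 * Suc m)) = (1 + t\<^sup>2) ^ Suc m * C"
  shows "(2 * real m + 1) * (\<Sum>x\<in>S. a x ^ (2 * m) * (b x)\<^sup>2) = C"
proof -
  \<comment> \<open>compare second derivatives at \<open>t = 0\<close>\<close>
  have d1: "((\<lambda>t. \<Sum>x\<in>S. (a x + t * b x) ^ (2 * Suc m)) has_real_derivative
      (\<Sum>x\<in>S. real (2 * Suc m) * (a x + t * b x) ^ (2 * m + 1) * b x)) (at t)" for t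
  proof (rule DERIV_sum)
    fix x
    have "((\<lambda>t. a x + t * b x) has_real_derivative b x) (at t)" by (auto intro!: derivative_eq_intros)
    moreover have "2 * Suc m - Suc 0 = 2 * m + 1" by simp
    ultimately show "((\<lambda>t. (a x + t * b x) ^ (2 * Suc m)) has_real_derivative real (2 * Suc m) * (a x + t * b x) ^ (2 * m + 1) * b x) (at t)"
      using DERIV_power[of "\<lambda>t. a x + t * b x" "b x" t UNIV "2 * Suc m"] by (simp only: mult_ac)
  qed
  have d2: "((\<lambda>t. (1 + t\<^sup>2) ^ Suc m * C) has_real_derivative real (Suc m) * (1 + t\<^sup>2) ^ m * (2 * t) * C) (at t)" for t
  proof -
    have "((\<lambda>t. 1 + t\<^sup>2) has_real_derivative 2 * t) (at t)" by (auto intro!: derivative_eq_intros)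
    from DERIV_cmult_right[OF DERIV_power[OF this, of "Suc m"], of C] show ?thesis
      by (simp only: diff_Suc_Suc diff_zero mult_ac)
  qed
  have eq: "(\<Sum>x\<in>S. real (2 * Suc m) * (a x + t * b x) ^ (2 * m + 1) * b x) = real (Suc m) * (1 + t\<^sup>2) ^ m * (2 * t) * C" for t
    using d1 unfolding assms by (rule DERIV_unique[OF _ d2])
  have e1: "((\<lambda>t. \<Sum>x\<in>S. real (2 * Suc m) * (a x + t * b x) ^ (2 * m + 1) * b x) has_real_derivative
      (\<Sum>x\<in>S. real (2 * Suc m) * (real (2 * m + 1) * a x ^ (2 * m) * b x) * b x)) (at 0)"
  proof (intro DERIV_sum DERIV_cmult_right DERIV_cmult)
    fix x
    have "((\<lambda>t. a x + t * b x) has_real_derivative b x) (at 0)" by (auto intro!: derivative_eq_intros)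
    from DERIV_power[OF this, of "2 * m + 1"]
    show "((\<lambda>t. (a x + t * b x) ^ (2 * m + 1)) has_real_derivative real (2 * m + 1) * a x ^ (2 * m) * b x) (at 0)"
      by (simp only: add_diff_cancel_right' mult_zero_left add_0_right mult_ac One_nat_def)
  qed
  have e2: "((\<lambda>t. real (Suc m) * (1 + t\<^sup>2) ^ m * (2 * t) * C) has_real_derivative real (Suc m) * 2 * C) (at 0)"
    by (auto intro!: derivative_eq_intros)
  have "(\<Sum>x\<in>S. real (2 * Suc m) * (real (2 * m + 1) * a x ^ (2 * m) * b x) * b x) = real (Suc m) * 2 * C"
    using e1 unfolding eq by (rule DERIV_unique[OF _ e2])
  moreover have "(\<Sum>x\<in>S. real (2 * Suc m) * (real (2 * m + 1) * a x ^ (2 * m) * b x) * b x) =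
      real (Suc m) * 2 * ((2 * real m + 1) * (\<Sum>x\<in>S. a x ^ (2 * m) * (b x)\<^sup>2))"
    unfolding sum_distrib_left by (intro sum.cong) (simp_all add: power2_eq_square algebra_simps)
  ultimately have "real (Suc m) * 2 * ((2 * real m + 1) * (\<Sum>x\<in>S. a x ^ (2 * m) * (b x)\<^sup>2)) = real (Suc m) * 2 * C"
    by simp
  then show ?thesis by (simp del: of_nat_Suc)
qed

context extremal72
begin

text \<open>These are the moments of the uniform measure on a sphere. Expanding the norm of x over
  an orthonormal basis inside the moment gives a recursion: after multiplication by 2 m + 1, the
  direction \<open>e\<close> counts 2 m + 1 times and the other 71 directions once each, which makes
  72 + 2 m.\<close>

lemma even_moment:
  assumes v: "v \<in> span L" and m: "m \<le> 5"
  shows "(\<Sum>x\<in>shell (2 * real n) L. (x \<bullet> v) ^ (2 * m)) =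
    real (card (shell (2 * real n) L)) * (2 * real n * (v \<bullet> v)) ^ m * (\<Prod>i<m. (2 * real i + 1) / (72 + 2 * real i))"
proof -
  define S where "S = shell (2 * real n) L"
  obtain B where B: "finite B" "card B = 72" "independent B" "L = int_span B"
    using lattice by (auto simp: is_lattice_def)
  have spanB: "span B = span L" unfolding B(4) by (rule span_int_span[symmetric])
  obtain E where E: "finite E" "card E = 72" "span E = span L" "\<And>e f. e \<in> E \<Longrightarrow> f \<in> E \<Longrightarrow> e \<bullet> f = (if e = f then 1 else 0)"
    using orthonormal_basis_exists[OF B(1,3)] unfolding B(2) spanB by blast
  have "E \<noteq> {}" using E(2) by auto
  then obtain e where e: "e \<in> E" by blast
  have E_span: "f \<in> span L" if "f \<in> E" for f using span_base[OF that] E(3) by simp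
  have ee: "e \<bullet> e = 1" using E(4)[OF e e] by simp
  define C where "C m = (\<Sum>x\<in>S. (x \<bullet> e) ^ (2 * m))" for m
  have moment: "(\<Sum>x\<in>S. (x \<bullet> v) ^ (2 * m)) = (v \<bullet> v) ^ m * C m" if "v \<in> span L" "m \<le> 5" for v m
  proof -
    have "norm v = norm (norm v *\<^sub>R e)" using ee by (simp add: norm_eq_sqrt_inner[of e])
    then have "(\<Sum>x\<in>S. (x \<bullet> v) ^ (2 * m)) = (\<Sum>x\<in>S. (x \<bullet> (norm v *\<^sub>R e)) ^ (2 * m))"
      unfolding S_def using that E_span[OF e] by (intro shell_moment_eq span_scale) auto
    also have "\<dots> = ((norm v)\<^sup>2) ^ m * C m"
      unfolding C_def sum_distrib_left by (simp add: power_mult_distrib flip: power_mult)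
    finally show ?thesis by (simp add: power2_norm_eq_inner)
  qed
  have rec: "(72 + 2 * real m) * C (Suc m) = (2 * real m + 1) * (2 * real n) * C m" if "Suc m \<le> 5" for m
  proof -
    have cross: "(2 * real m + 1) * (\<Sum>x\<in>S. (x \<bullet> e) ^ (2 * m) * (x \<bullet> f)\<^sup>2) = C (Suc m)" if f: "f \<in> E" "f \<noteq> e" for f
    proof (rule second_order_moment)
      fix t :: real
      have "(e + t *\<^sub>R f) \<bullet> (e + t *\<^sub>R f) = 1 + t\<^sup>2"
        using E(4)[OF e e] E(4)[OF e f(1)] E(4)[OF f(1) e] E(4)[OF f(1) f(1)] f(2)
        by (simp add: inner_add_left inner_add_right power2_eq_square)
      moreover have "e + t *\<^sub>R f \<in> span L" using E_span e f by (intro span_add span_scale) auto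
      ultimately show "(\<Sum>x\<in>S. (x \<bullet> e + t * (x \<bullet> f)) ^ (2 * Suc m)) = (1 + t\<^sup>2) ^ Suc m * C (Suc m)"
        using moment[of "e + t *\<^sub>R f" "Suc m"] \<open>Suc m \<le> 5\<close> by (simp only: inner_add_right inner_scaleR_right)
    qed
    have "(2 * real m + 1) * (2 * real n) * C m = (2 * real m + 1) * (\<Sum>x\<in>S. (x \<bullet> e) ^ (2 * m) * (\<Sum>f\<in>E. (x \<bullet> f)\<^sup>2))"
    proof -
      have "(x \<bullet> e) ^ (2 * m) * (\<Sum>f\<in>E. (x \<bullet> f)\<^sup>2) = 2 * real n * (x \<bullet> e) ^ (2 * m)" if "x \<in> S" for x
      proof -
        have "x \<in> span E" "x \<bullet> x = 2 * real n" using that E(3) in_span by (auto simp: S_def shell_def)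
        then show ?thesis by (simp add: orthonormal_parseval[OF E(1,4)])
      qed
      then have "(\<Sum>x\<in>S. (x \<bullet> e) ^ (2 * m) * (\<Sum>f\<in>E. (x \<bullet> f)\<^sup>2)) = 2 * real n * C m"
        unfolding C_def sum_distrib_left by (intro sum.cong) auto
      then show ?thesis by simp
    qed
    also have "\<dots> = (\<Sum>f\<in>E. (2 * real m + 1) * (\<Sum>x\<in>S. (x \<bullet> e) ^ (2 * m) * (x \<bullet> f)\<^sup>2))"
      unfolding sum_distrib_left by (rule sum.swap)
    also have "\<dots> = (2 * real m + 1) * (\<Sum>x\<in>S. (x \<bullet> e) ^ (2 * m) * (x \<bullet> e)\<^sup>2) + (\<Sum>f\<in>E - {e}. C (Suc m))"
      unfolding sum.remove[OF E(1) e] using cross by (intro arg_cong2[where f = "(+)"] sum.cong) auto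
    also have "(\<Sum>x\<in>S. (x \<bullet> e) ^ (2 * m) * (x \<bullet> e)\<^sup>2) = C (Suc m)"
      unfolding C_def by (simp add: power2_eq_square mult_ac)
    also have "(\<Sum>f\<in>E - {e}. C (Suc m)) = 71 * C (Suc m)" using E(1,2) e by simp
    finally show ?thesis by (simp add: algebra_simps)
  qed
  have "C m = real (card S) * (2 * real n) ^ m * (\<Prod>i<m. (2 * real i + 1) / (72 + 2 * real i))" if "m \<le> 5" for m
    using that
  proof (induction m)
    case (Suc m)
    have "C (Suc m) = (2 * real m + 1) / (72 + 2 * real m) * (2 * real n) * C m"
      using rec[OF Suc.prems] by (simp add: field_simps)
    then show ?case using Suc by simp
  qed (simp add: C_def)
  then show ?thesis using moment[OF v m] m by (simp add: S_def power_mult_distrib)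
qed

lemma even_poly_sum:
  fixes a :: "nat \<Rightarrow> real" and n :: nat
  assumes v: "v \<in> span L"
  defines "R \<equiv> 2 * real n * (v \<bullet> v)"
  shows "(\<Sum>x\<in>shell (2 * real n) L. \<Sum>i\<le>5. a i * (x \<bullet> v) ^ (2 * i)) =
    real (card (shell (2 * real n) L)) * (a 0 + a 1 * (R / 72) + a 2 * (3 * R\<^sup>2 / (72 * 74)) + a 3 * (15 * R ^ 3 / (72 * 74 * 76))
      + a 4 * (105 * R ^ 4 / (72 * 74 * 76 * 78)) + a 5 * (945 * R ^ 5 / (72 * 74 * 76 * 78 * 80)))"
proof -
  have "(\<Sum>x\<in>shell (2 * real n) L. \<Sum>i\<le>5. a i * (x \<bullet> v) ^ (2 * i)) =
    (\<Sum>i\<le>5. a i * (\<Sum>x\<in>shell (2 * real n) L. (x \<bullet> v) ^ (2 * i)))"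
    unfolding sum_distrib_left by (rule sum.swap)
  also have "\<dots> = (\<Sum>i\<le>5. a i * (real (card (shell (2 * real n) L)) * R ^ i * (\<Prod>j<i. (2 * real j + 1) / (72 + 2 * real j))))"
    unfolding R_def by (intro sum.cong refl arg_cong2[where f = "(*)"] even_moment v) auto
  also have "\<dots> = real (card (shell (2 * real n) L)) * (\<Sum>i\<le>5. a i * (R ^ i * (\<Prod>j<i. (2 * real j + 1) / (72 + 2 * real j))))"
    unfolding sum_distrib_left by (intro sum.cong) (auto simp: mult_ac)
  also have "(\<Sum>i\<le>5. a i * (R ^ i * (\<Prod>j<i. (2 * real j + 1) / (72 + 2 * real j)))) =
    a 0 + a 1 * (R / 72) + a 2 * (3 * R\<^sup>2 / (72 * 74)) + a 3 * (15 * R ^ 3 / (72 * 74 * 76))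
      + a 4 * (105 * R ^ 4 / (72 * 74 * 76 * 78)) + a 5 * (945 * R ^ 5 / (72 * 74 * 76 * 78 * 80))"
    by (simp add: eval_nat_numeral)
  finally show ?thesis .
qed

end

section \<open>Generation by vectors of norm 10\<close>

context extremal72
begin

lemma nonempty_card_shell: "x \<in> shell r L \<Longrightarrow> real (card (shell r L)) > 0"
  using finite_shell card_gt_0_iff by fastforce

text \<open>Specialised to polynomials with a double root at 0, hence without constant term. The
  denominators are the products 72, 72 * 74, up to 72 * 74 * 76 * 78 * 80.\<close>

lemma quintic_sum:
  fixes b c d e :: real and n :: nat
  assumes v: "v \<in> span L"
  defines "R \<equiv> 2 * real n * (v \<bullet> v)"
  shows "(\<Sum>x\<in>shell (2 * real n) L. (x \<bullet> v) ^ 10 - b * (x \<bullet> v) ^ 8 + c * (x \<bullet> v) ^ 6 - d * (x \<bullet> v) ^ 4 + e * (x \<bullet> v) ^ 2) =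
    real (card (shell (2 * real n) L)) * (e * (R / 72) - d * (3 * R\<^sup>2 / 5328) + c * (15 * R ^ 3 / 404928)
      - b * (105 * R ^ 4 / 31584384) + 945 * R ^ 5 / 2526750720)"
proof -
  define a where "a = (\<lambda>i::nat. 0::real)(1 := e, 2 := - d, 3 := c, 4 := - b, 5 := 1)"
  have a: "a 0 = 0" "a 1 = e" "a 2 = - d" "a 3 = c" "a 4 = - b" "a 5 = 1" by (simp_all add: a_def)
  have sum5: "(\<Sum>i\<le>5. f i) = f 0 + f 1 + f 2 + f 3 + f 4 + f 5" for f :: "nat \<Rightarrow> real" by (simp add: eval_nat_numeral)
  have eq: "y ^ 10 - b * y ^ 8 + c * y ^ 6 - d * y ^ 4 + e * y ^ 2 = (\<Sum>i\<le>5. a i * y ^ (2 * i))" for y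
    unfolding sum5 a by simp
  show ?thesis unfolding eq even_poly_sum[OF v] a R_def[symmetric] by (simp add: algebra_simps)
qed

lemma inner_int_bound:
  assumes "x \<in> L" "y \<in> L" "\<bar>x \<bullet> y\<bar> \<le> of_int m"
  obtains k :: int where "x \<bullet> y = of_int k" "\<bar>k\<bar> \<le> m"
proof -
  obtain k :: int where k: "x \<bullet> y = of_int k" using inner_Ints[OF assms(1,2)] by (auto elim: Ints_cases)
  then have "real_of_int \<bar>k\<bar> \<le> of_int m" using assms(3) by simp
  then show ?thesis using k that by (simp only: of_int_le_iff)
qed

lemma inner_diff_self: "(x - y) \<bullet> (x - y) = x \<bullet> x - 2 * (x \<bullet> y) + y \<bullet> (y::'a)"
  by (simp add: inner_diff_left inner_diff_right inner_commute)

lemma inner_add_self: "(x + y) \<bullet> (x + y) = x \<bullet> x + 2 * (x \<bullet> y) + y \<bullet> (y::'a)"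
  by (simp add: inner_add_left inner_add_right inner_commute)

text \<open>Sum and difference are nonzero, so each has norm at least 8.\<close>

lemma inner_bound_of_norms:
  assumes "x \<in> L" "y \<in> L" "x \<noteq> y" "x \<noteq> - y"
  shows "2 * \<bar>x \<bullet> y\<bar> \<le> x \<bullet> x + y \<bullet> y - 8"
proof -
  have "x - y \<noteq> 0" "x + y \<noteq> 0" using assms(3,4) by (auto simp: add_eq_0_iff2)
  then have "8 \<le> (x - y) \<bullet> (x - y)" "8 \<le> (x + y) \<bullet> (x + y)"
    by (simp_all add: norm_ge_8 subgroup(2)[OF assms(1,2)] subgroup(4)[OF assms(1,2)])
  then show ?thesis unfolding inner_diff_self inner_add_self by linarith
qed

text \<open>Inner product 3 or -3 of two norm 8 vectors gives a difference or sum of norm 8 + 8 - 6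
  = 10, so these values are excluded; 8 and -8 occur for x = v and x = - v, and all others have
  modulus at most 4. The coefficients are the elementary symmetric functions of 1, 4, 16, 64. The
  design average at R = 64 is nonzero.\<close>

lemma shell_10_nonempty: "shell 10 L \<noteq> {}"
proof
  assume empty: "shell 10 L = {}"
  obtain v where v: "v \<in> shell 8 L" using shell_8_nonempty by blast
  then have vL: "v \<in> L" "v \<bullet> v = 8" by (auto simp: shell_def)
  have "(x \<bullet> v) ^ 10 - 85 * (x \<bullet> v) ^ 8 + 1428 * (x \<bullet> v) ^ 6 - 5440 * (x \<bullet> v) ^ 4 + 4096 * (x \<bullet> v) ^ 2 = 0"
    if x: "x \<in> shell (2 * real 4) L" for x
  proof -
    have xL: "x \<in> L" "x \<bullet> x = 8" using x by (auto simp: shell_def)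
    consider "x = v" | "x = - v" | "x \<noteq> v" "x \<noteq> - v" by blast
    then show ?thesis
    proof cases
      case 3
      then have "\<bar>x \<bullet> v\<bar> \<le> of_int 4" using inner_bound_of_norms[OF xL(1) vL(1)] xL vL by simp
      then obtain k :: int where k: "x \<bullet> v = of_int k" "\<bar>k\<bar> \<le> 4" using inner_int_bound[OF xL(1) vL(1)] by blast
      have "x - v \<notin> shell 10 L" "x + v \<notin> shell 10 L" using empty by auto
      then have "(x - v) \<bullet> (x - v) \<noteq> 10" "(x + v) \<bullet> (x + v) \<noteq> 10"
        using subgroup xL(1) vL(1) by (auto simp: shell_def)
      then have "k \<noteq> 3" "k \<noteq> - 3" unfolding inner_diff_self inner_add_self xL vL k by auto
      then have "k = 0 \<or> k = 1 \<or> k = - 1 \<or> k = 2 \<or> k = - 2 \<or> k = 4 \<or> k = - 4" using k(2) by presburger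
      then show ?thesis unfolding k by auto
    qed (use vL in auto)
  qed
  then have "(\<Sum>x\<in>shell (2 * real 4) L. (x \<bullet> v) ^ 10 - 85 * (x \<bullet> v) ^ 8 + 1428 * (x \<bullet> v) ^ 6 - 5440 * (x \<bullet> v) ^ 4 + 4096 * (x \<bullet> v) ^ 2) = 0"
    by (rule sum.neutral[OF ballI])
  then show False
    unfolding quintic_sum[OF in_span[OF vL(1)]] vL using nonempty_card_shell[OF v] by simp
qed

definition L10 where "L10 = shell_lattice 10 L"

lemma L10_subgroup: "0 \<in> L10" "x \<in> L10 \<Longrightarrow> y \<in> L10 \<Longrightarrow> x - y \<in> L10" "x \<in> L10 \<Longrightarrow> y \<in> L10 \<Longrightarrow> x + y \<in> L10"
  by (auto simp: L10_def shell_lattice_def int_module.span_zero int_module.span_diff int_module.span_add)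

lemma shell_10_L10: "x \<in> L \<Longrightarrow> x \<bullet> x = 10 \<Longrightarrow> x \<in> L10"
  by (simp add: L10_def shell_lattice_def shell_def int_module.span_base)

lemma L10_subset: "L10 \<subseteq> L"
proof -
  obtain B where B: "L = int_span B" using lattice by (auto simp: is_lattice_def)
  have "shell 10 L \<subseteq> int_span B" using B by (auto simp: shell_def)
  then have "int_span (shell 10 L) \<subseteq> int_span B"
    by (rule int_module.span_minimal[OF _ int_module.subspace_span])
  then show ?thesis unfolding L10_def shell_lattice_def by (simp only: B[symmetric])
qed

text \<open>Inner product 4 or -4 would give a difference or sum of norm 10 + 8 - 8 = 10, putting
  \<open>v\<close> into \<open>L10\<close>; the remaining values have modulus at most 5. The
  coefficients come from 1, 4, 9, 25, and the design average at R = 80 is nonzero.\<close>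

lemma shell_8_L10:
  assumes "v \<in> L" "v \<bullet> v = 8"
  shows "v \<in> L10"
proof (rule ccontr)
  assume not: "v \<notin> L10"
  obtain z where z: "z \<in> shell 10 L" using shell_10_nonempty by blast
  have "(x \<bullet> v) ^ 10 - 39 * (x \<bullet> v) ^ 8 + 399 * (x \<bullet> v) ^ 6 - 1261 * (x \<bullet> v) ^ 4 + 900 * (x \<bullet> v) ^ 2 = 0"
    if x: "x \<in> shell (2 * real 5) L" for x
  proof -
    have xL: "x \<in> L" "x \<bullet> x = 10" using x by (auto simp: shell_def)
    have "x \<noteq> v" "x \<noteq> - v" using xL assms by auto
    then have "\<bar>x \<bullet> v\<bar> \<le> of_int 5" using inner_bound_of_norms[OF xL(1) assms(1)] xL assms by simp
    then obtain k :: int where k: "x \<bullet> v = of_int k" "\<bar>k\<bar> \<le> 5" using inner_int_bound[OF xL(1) assms(1)] by blast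
    have xM: "x \<in> L10" using xL by (rule shell_10_L10)
    have "x - v \<notin> L10"
    proof
      assume "x - v \<in> L10"
      then have "x - (x - v) \<in> L10" by (rule L10_subgroup(2)[OF xM])
      with not show False by simp
    qed
    moreover have "x + v \<notin> L10"
    proof
      assume "x + v \<in> L10"
      then have "x + v - x \<in> L10" using xM by (rule L10_subgroup(2))
      with not show False by simp
    qed
    ultimately have "(x - v) \<bullet> (x - v) \<noteq> 10" "(x + v) \<bullet> (x + v) \<noteq> 10"
      using shell_10_L10[OF subgroup(2)[OF xL(1) assms(1)]] shell_10_L10[OF subgroup(4)[OF xL(1) assms(1)]] by auto
    then have "k \<noteq> 4" "k \<noteq> - 4" unfolding inner_diff_self inner_add_self xL assms k by auto
    then have "k = 0 \<or> k = 1 \<or> k = - 1 \<or> k = 2 \<or> k = - 2 \<or> k = 3 \<or> k = - 3 \<or> k = 5 \<or> k = - 5" using k(2) by presburger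
    then show ?thesis unfolding k by auto
  qed
  then have "(\<Sum>x\<in>shell (2 * real 5) L. (x \<bullet> v) ^ 10 - 39 * (x \<bullet> v) ^ 8 + 399 * (x \<bullet> v) ^ 6 - 1261 * (x \<bullet> v) ^ 4 + 900 * (x \<bullet> v) ^ 2) = 0"
    by (rule sum.neutral[OF ballI])
  then show False
    unfolding quintic_sum[OF in_span[OF assms(1)]] assms using nonempty_card_shell[OF z] by simp
qed

lemma minimal_representative_ge_12:
  assumes v: "v \<in> L" "v \<notin> L10"
  shows "v \<bullet> v \<ge> 12"
proof -
  obtain n where n: "v \<bullet> v = 2 * real n" using norm_even[OF v(1)] .
  have "v \<noteq> 0" using v L10_subgroup by auto
  then have "v \<bullet> v \<ge> 8" by (rule norm_ge_8[OF v(1)])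
  moreover have "v \<bullet> v \<noteq> 8" "v \<bullet> v \<noteq> 10" using shell_8_L10 shell_10_L10 v by blast+
  ultimately have "n \<ge> 4" "n \<noteq> 4" "n \<noteq> 5" using n by auto
  then show ?thesis using n by simp
qed

theorem L10_eq: "L10 = L"
proof (rule ccontr)
  assume "L10 \<noteq> L"
  then obtain x0 where x0: "x0 \<in> L" "x0 \<notin> L10" using L10_subset by blast
  \<comment> \<open>Norms are even natural numbers, so well-ordering provides a shortest vector
    outside \<open>L10\<close>.\<close>
  define P where "P n \<longleftrightarrow> (\<exists>x\<in>L. x \<notin> L10 \<and> x \<bullet> x = 2 * real n)" for n
  have "\<exists>n. P n" using x0 norm_even[OF x0(1)] unfolding P_def by metis
  then have "P (LEAST n. P n)" by (rule LeastI_ex)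
  then obtain v where v: "v \<in> L" "v \<notin> L10" "v \<bullet> v = 2 * real (LEAST n. P n)" unfolding P_def by blast
  have min: "v \<bullet> v \<le> x \<bullet> x" if x: "x \<in> L" "x \<notin> L10" for x
  proof -
    obtain n where n: "x \<bullet> x = 2 * real n" using norm_even[OF x(1)] .
    then have "P n" using x by (auto simp: P_def)
    then have "(LEAST n. P n) \<le> n" by (rule Least_le)
    then show ?thesis using n v(3) by simp
  qed
  obtain z where z: "z \<in> shell 8 L" using shell_8_nonempty by blast
  \<comment> \<open>The coefficients come from 1, 4, 9, 16. Norm 8 vectors lie in
    \<open>L10\<close>, so both x - v and x + v stay outside it; comparing their norms with that of
    \<open>v\<close> cancels the norm of \<open>v\<close> and leaves 2 |x . v| <= 8.\<close>
  have "(x \<bullet> v) ^ 10 - 30 * (x \<bullet> v) ^ 8 + 273 * (x \<bullet> v) ^ 6 - 820 * (x \<bullet> v) ^ 4 + 576 * (x \<bullet> v) ^ 2 = 0"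
    if x: "x \<in> shell (2 * real 4) L" for x
  proof -
    have xL: "x \<in> L" "x \<bullet> x = 8" using x by (auto simp: shell_def)
    have xM: "x \<in> L10" using xL by (rule shell_8_L10)
    have "x - v \<notin> L10"
    proof
      assume "x - v \<in> L10"
      then have "x - (x - v) \<in> L10" by (rule L10_subgroup(2)[OF xM])
      with v(2) show False by simp
    qed
    moreover have "x + v \<notin> L10"
    proof
      assume "x + v \<in> L10"
      then have "x + v - x \<in> L10" using xM by (rule L10_subgroup(2))
      with v(2) show False by simp
    qed
    ultimately have "v \<bullet> v \<le> (x - v) \<bullet> (x - v)" "v \<bullet> v \<le> (x + v) \<bullet> (x + v)"
      using min[OF subgroup(2)[OF xL(1) v(1)]] min[OF subgroup(4)[OF xL(1) v(1)]] by simp_all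
    then have "\<bar>x \<bullet> v\<bar> \<le> of_int 4" unfolding inner_diff_self inner_add_self xL by simp
    then obtain k :: int where k: "x \<bullet> v = of_int k" "\<bar>k\<bar> \<le> 4" using inner_int_bound[OF xL(1) v(1)] by blast
    then have "k = 0 \<or> k = 1 \<or> k = - 1 \<or> k = 2 \<or> k = - 2 \<or> k = 3 \<or> k = - 3 \<or> k = 4 \<or> k = - 4" by presburger
    then show ?thesis unfolding k by auto
  qed
  then have 0: "(\<Sum>x\<in>shell (2 * real 4) L. (x \<bullet> v) ^ 10 - 30 * (x \<bullet> v) ^ 8 + 273 * (x \<bullet> v) ^ 6 - 820 * (x \<bullet> v) ^ 4 + 576 * (x \<bullet> v) ^ 2) = 0"
    by (rule sum.neutral[OF ballI])
  \<comment> \<open>Norm at least 12 means that 8 times the norm of \<open>v\<close> is at least 96.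
    Recentred at 96, the quartic factor of the average has only positive coefficients, which settles
    all lengths at once.\<close>
  define h where "h = 2 * real 4 * (v \<bullet> v) - 96"
  have R: "2 * real 4 * (v \<bullet> v) = 96 + h" and h: "h \<ge> 0"
    using minimal_representative_ge_12[OF v(1,2)] by (auto simp: h_def)
  have "576 * ((96 + h) / 72) - 820 * (3 * (96 + h)\<^sup>2 / 5328) + 273 * (15 * (96 + h) ^ 3 / 404928)
      - 30 * (105 * (96 + h) ^ 4 / 31584384) + 945 * (96 + h) ^ 5 / 2526750720 > 0"
  proof -
    have "20214005760 - 1166630400 * (96 + h) + 25552800 * (96 + h)\<^sup>2 - 252000 * (96 + h) ^ 3 + 945 * (96 + h) ^ 4 > 0"
    proof -
      have "20214005760 - 1166630400 * (96 + h) + 25552800 * (96 + h)\<^sup>2 - 252000 * (96 + h) ^ 3 + 945 * (96 + h) ^ 4 =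
        1021870080 + 116513280 * h + 5231520 * h\<^sup>2 + 110880 * h ^ 3 + 945 * h ^ 4"
        by (simp add: power2_eq_square power3_eq_cube power4_eq_xxxx algebra_simps)
      also have "\<dots> > 0" using h by (intro add_pos_nonneg) auto
      finally show ?thesis .
    qed
    then have "(96 + h) * (20214005760 - 1166630400 * (96 + h) + 25552800 * (96 + h)\<^sup>2 - 252000 * (96 + h) ^ 3 + 945 * (96 + h) ^ 4) > 0"
      using h by (intro mult_pos_pos) auto
    moreover have "576 * (x / 72) - 820 * (3 * x\<^sup>2 / 5328) + 273 * (15 * x ^ 3 / 404928)
      - 30 * (105 * x ^ 4 / 31584384) + 945 * x ^ 5 / 2526750720 =
      x * (20214005760 - 1166630400 * x + 25552800 * x\<^sup>2 - 252000 * x ^ 3 + 945 * x ^ 4) / 2526750720" for x :: real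
      by (simp add: field_simps eval_nat_numeral)
    ultimately show ?thesis by (simp only: zero_less_divide_iff) simp
  qed
  then show False
    using 0 nonempty_card_shell[OF z] unfolding quintic_sum[OF in_span[OF v(1)]] R by simp
qed

end

theorem theorem2:
  fixes L :: "'a::real_inner set"
  assumes "extremal_lattice 72 L"
  shows "shell_lattice 10 L = L"
proof -
  interpret extremal72 L by unfold_locales (rule assms)
  show ?thesis using L10_eq by (simp add: L10_def)
qed

end
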